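(* For every $\ell \geqslant 2$ and every function $p = p(n) \in [0,1]$ satisfying $p(n) / \big(n^{-(\ell-1)/(2\ell-1)} (\log n)^{\ell+1}\big) \to \infty$ as $n \to \infty$, we have $$\mathrm{ex}\big(G(n,p), C_{2\ell}\big) \leqslant p^{1/\ell} n^{1+1/\ell} \log n$$ with high probability as $n \to \infty$.
   Context: $G(n,p)$ is the Erdős–Rényi random graph on $n$ vertices with edge probability $p$. For a graph $\Gamma$, $\mathrm{ex}(\Gamma, C_{2\ell})$ is the maximum number of edges of a $C_{2\ell}$-free subgraph of $\Gamma$, where $C_{2\ell}$ is the cycle of length $2\ell$. "With high probability" means with probability tending to $1$. *)

theory Defs
  imports "HOL-Probability.Probability"
begin

text \<open>A simple graph is a pair of a vertex set and a set of two-element vertex subsets.\<close>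

type_synonym 'a graph = "'a set \<times> 'a set set"

abbreviation verts :: "'a graph \<Rightarrow> 'a set" where
  "verts \<equiv> fst"

abbreviation edges :: "'a graph \<Rightarrow> 'a set set" where
  "edges \<equiv> snd"

definition all_edges :: "'a set \<Rightarrow> 'a set set" where
  "all_edges V = {e. e \<subseteq> V \<and> card e = 2}"

definition simple_graph :: "'a graph \<Rightarrow> bool" where
  "simple_graph G \<longleftrightarrow> edges G \<subseteq> all_edges (verts G)"

definition subgraph_of :: "'a graph \<Rightarrow> 'a graph \<Rightarrow> bool" where
  "subgraph_of F G \<longleftrightarrow> simple_graph F \<and> verts F \<subseteq> verts G \<and> edges F \<subseteq> edges G"

text \<open>Copies need not be induced.\<close>

definition contains_copy :: "'a graph \<Rightarrow> 'b graph \<Rightarrow> bool" where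
  "contains_copy G H \<longleftrightarrow>
    (\<exists>f. inj_on f (verts H) \<and> f ` verts H \<subseteq> verts G \<and> (\<forall>e\<in>edges H. f ` e \<in> edges G))"

text \<open>This is the cycle of length \<open>k\<close> only for \<open>k \<ge> 3\<close>.\<close>

definition cycle_graph :: "nat \<Rightarrow> nat graph" where
  "cycle_graph k = ({..<k}, {{i, Suc i mod k} | i. i < k})"

text \<open>The maximum is meaningful when \<open>G\<close> is finite and \<open>H\<close> has at least one edge: the edgeless
  subgraphs of \<open>G\<close> are then \<open>H\<close>-free.\<close>

definition ex_number :: "'a graph \<Rightarrow> 'b graph \<Rightarrow> nat" where
  "ex_number G H = Max {card (edges F) | F. subgraph_of F G \<and> \<not> contains_copy F H}"

definition erdos_renyi :: "nat \<Rightarrow> real \<Rightarrow> nat graph pmf" where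
  "erdos_renyi n p =
    map_pmf (\<lambda>X. ({..<n}, {e \<in> all_edges {..<n}. X e}))
      (Pi_pmf (all_edges {..<n}) False (\<lambda>_. bernoulli_pmf p))"

end

theory Submission
  imports Defs "HOL-Real_Asymp.Real_Asymp"
begin

text \<open>
  The cycle-free graphs are covered by few sparse containers, and a first moment bound over all
  containers gives the theorem.

  Supersaturation: in a graph with minimum degree \<open>\<delta>\<close>, let \<open>P\<close> be the adjacency matrix with entries
  \<open>1 / sqrt (d u * d v)\<close>. It has the eigenvalue 1, so the trace of \<open>P ^ (2 * l)\<close> is at least 1. By
  log-convexity of the weights of closed walks, those closed walks that repeat a vertex contribute
  at most \<open>O(n powr (1 / l) / \<delta>)\<close> times this trace. If \<open>\<delta>\<close> is a large multiple of \<open>n powr (1 / l)\<close>,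
  genuine cycles carry half of the weight, and each has weight at most \<open>1 / \<delta> ^ (2 * l)\<close>; hence
  there are at least \<open>\<delta> ^ (2 * l) / 2\<close> labelled ones.

  Balanced supersaturation: take a maximal family of cycles in which every set of \<open>j\<close> edges lies in
  at most \<open>(1 / \<tau>) ^ (2 * l - j)\<close> members. If it were small, few edge sets would be saturated, and
  in a random set of about \<open>\<tau> * n\<close> vertices one could destroy all saturated sets by deleting few
  edges. Supersaturation in what remains yields a cycle that could have been added.

  Containers: from an independent set, repeatedly pick a vertex of maximum degree and pass to its
  link, dropping the edges through saturated sets. Either the links form a spread hypergraph of
  smaller uniformity, or the remaining hypergraph has small degrees on the independent set, which
  then avoids the many vertices of large degree.
\<close>

subsection \<open>Supersaturation of even cycles\<close>

text \<open>Degrees in the subgraph below are bounded from below only. With plain walk counts a few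
  vertices of huge degree could carry almost all closed walks; dividing by degrees caps the weight
  of a single cycle, so that a bound on weight becomes a bound on number. The exponents arise as
  follows. A sample of \<open>\<tau> * n\<close> vertices of a graph with \<open>N\<close> edges has
  average degree about \<open>\<tau> * N / n\<close>, and supersaturation needs this to exceed the
  \<open>l\<close>-th root of \<open>\<tau> * n\<close>. Moreover the cycles so forced, about
  \<open>(\<tau> * N / n) ^ (2 * l)\<close>, must outnumber the roughly \<open>\<tau> * N\<close>
  members of a small family inside the sample. These are the two lower bounds on
  \<open>\<tau>\<close> in the statements about cycles; solved for \<open>\<tau> * N\<close> they
  give the two terms in the logarithm of the number of containers. The first moment bound wants
  containers of size about \<open>m / p\<close>, with \<open>m\<close> the target. At the least
  admissible \<open>p\<close> the first term and \<open>m\<close> agree in the power of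
  \<open>n\<close>, which explains the threshold.\<close>

lemma min_degree_subgraph:
  fixes lam :: real
  assumes "finite V" "V \<noteq> {}" "E \<subseteq> all_edges V" "0 < lam" "lam * card V \<le> card E"
  obtains W where "W \<subseteq> V" "W \<noteq> {}" "\<And>v. v \<in> W \<Longrightarrow> lam \<le> card {u \<in> W. {v, u} \<in> E}"
proof -
  let ?E = "\<lambda>W. {e \<in> E. e \<subseteq> W}"
  let ?P = "\<lambda>W. W \<subseteq> V \<and> W \<noteq> {} \<and> lam * card W \<le> card (?E W)"
  have finE: "finite E"
    using assms(1,3) finite_subset[of E "Pow V"] by (auto simp: all_edges_def)
  have "?E V = E" using assms(3) by (auto simp: all_edges_def)
  then have "?P V" using assms by auto
  then obtain W where W: "?P W" "\<And>U. ?P U \<Longrightarrow> card W \<le> card U"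
    using ex_has_least_nat[of ?P V card] by blast
  have finW: "finite W" using W assms(1) finite_subset by blast
  \<comment> \<open>Deleting a vertex of smaller degree loses fewer than \<open>lam\<close> edges,
    so a smaller set would still have edge density \<open>lam\<close>, against the choice of
    \<open>W\<close>.\<close>
  have "lam \<le> card {u \<in> W. {v, u} \<in> E}" if v: "v \<in> W" for v
  proof (rule ccontr)
    assume less: "\<not> ?thesis"
    let ?D = "{u \<in> W. {v, u} \<in> E}"
    have sub: "?E W \<subseteq> ?E (W - {v}) \<union> (\<lambda>u. {v, u}) ` ?D"
    proof
      fix e assume e: "e \<in> ?E W"
      show "e \<in> ?E (W - {v}) \<union> (\<lambda>u. {v, u}) ` ?D"
      proof (cases "v \<in> e")
        case True
        moreover have "card e = 2" using e assms(3) by (auto simp: all_edges_def)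
        ultimately obtain u where "e = {v, u}" by (auto simp: card_2_iff)
        then show ?thesis using e by auto
      qed (use e in auto)
    qed
    have "card (?E W) \<le> card (?E (W - {v}) \<union> (\<lambda>u. {v, u}) ` ?D)"
      using sub finE finW by (intro card_mono) auto
    also have "\<dots> \<le> card (?E (W - {v})) + card ((\<lambda>u. {v, u}) ` ?D)" by (rule card_Un_le)
    also have "card ((\<lambda>u. {v, u}) ` ?D) \<le> card ?D" using finW by (intro card_image_le) auto
    finally have "real (card (?E W)) \<le> card (?E (W - {v})) + card ?D" by linarith
    then have *: "lam * (real (card W) - 1) < card (?E (W - {v}))"
      using less W(1) by (simp add: algebra_simps)
    have cW: "real (card (W - {v})) = real (card W) - 1"
      using v finW by (simp add: card_gt_0_iff Suc_le_eq of_nat_diff card_Diff_singleton) 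
        (metis One_nat_def Suc_leI card_gt_0_iff empty_iff of_nat_diff of_nat_1)
    show False
    proof (cases "W = {v}")
      case True
      then have none: "?E (W - {v}) = {}" using assms(3) by (auto simp: all_edges_def)
      show ?thesis using * True unfolding none by simp
    next
      case False
      then have "?P (W - {v})" using W(1) v * cW by auto
      then have "card W \<le> card (W - {v})" by (rule W(2))
      then show ?thesis using card_Diff1_less[OF finW v] by linarith
    qed
  qed
  then show ?thesis using that W(1) by blast
qed

section \<open>Sums over lists and log-convex sequences\<close>

lemma sum_lists_Suc:
  assumes "finite W"
  shows "(\<Sum>ys | set ys \<subseteq> W \<and> length ys = Suc k. f ys)
       = (\<Sum>x\<in>W. \<Sum>xs | set xs \<subseteq> W \<and> length xs = k. f (x # xs))"
proof -
  have "(\<Sum>x\<in>W. \<Sum>xs | set xs \<subseteq> W \<and> length xs = k. f (x # xs))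
      = (\<Sum>(x, xs)\<in>W \<times> {xs. set xs \<subseteq> W \<and> length xs = k}. f (x # xs))"
    by (rule sum.cartesian_product)
  also have "\<dots> = (\<Sum>ys | set ys \<subseteq> W \<and> length ys = Suc k. f ys)"
    by (rule sum.reindex_bij_witness[where i="\<lambda>ys. (hd ys, tl ys)" and j="\<lambda>(x, xs). x # xs"])
      (auto simp: length_Suc_conv)
  finally show ?thesis by simp
qed

lemma sum_lists_append:
  assumes "finite W"
  shows "(\<Sum>zs | set zs \<subseteq> W \<and> length zs = a + b. f zs)
       = (\<Sum>xs | set xs \<subseteq> W \<and> length xs = a. \<Sum>ys | set ys \<subseteq> W \<and> length ys = b. f (xs @ ys))"
proof -
  have "(\<Sum>xs | set xs \<subseteq> W \<and> length xs = a. \<Sum>ys | set ys \<subseteq> W \<and> length ys = b. f (xs @ ys))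
      = (\<Sum>(xs, ys)\<in>{xs. set xs \<subseteq> W \<and> length xs = a} \<times> {ys. set ys \<subseteq> W \<and> length ys = b}. f (xs @ ys))"
    by (rule sum.cartesian_product)
  also have "\<dots> = (\<Sum>zs | set zs \<subseteq> W \<and> length zs = a + b. f zs)"
    by (rule sum.reindex_bij_witness[where i="\<lambda>zs. (take a zs, drop a zs)" and j="\<lambda>(xs, ys). xs @ ys"])
      (auto dest: in_set_takeD in_set_dropD)
  finally show ?thesis by simp
qed

lemma log_convex_ratio:
  fixes g :: "nat \<Rightarrow> real"
  assumes "\<And>i. 0 < g i" "\<And>i. (g (Suc i))\<^sup>2 \<le> g i * g (Suc (Suc i))" "i \<le> j"
  shows "g (Suc i) / g i \<le> g (Suc j) / g j"
proof (rule lift_Suc_mono_le[of "\<lambda>i. g (Suc i) / g i", OF _ assms(3)])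
  fix n
  show "g (Suc n) / g n \<le> g (Suc (Suc n)) / g (Suc n)"
    using assms(1)[of n] assms(1)[of "Suc n"] assms(2)[of n] by (simp add: field_simps power2_eq_square)
qed

text \<open>Ratios of consecutive terms increase, so moving the two indices apart with their sum
  fixed cannot decrease the product. The extreme index 1 will stand for closed walks of length
  2.\<close>

lemma log_convex_product_le:
  fixes g :: "nat \<Rightarrow> real"
  assumes pos: "\<And>i. 0 < g i" and cvx: "\<And>i. (g (Suc i))\<^sup>2 \<le> g i * g (Suc (Suc i))"
    and "1 \<le> i" "1 \<le> j"
  shows "g i * g j \<le> g 1 * g (i + j - 1)"
  using assms(3)
proof (induction i arbitrary: rule: dec_induct)
  case base
  then show ?case by simp
next
  case (step i)
  have "g (Suc i) / g i \<le> g (i + j) / g (i + j - 1)"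
    using log_convex_ratio[of g i "i + j - 1"] assms step by simp
  then have r: "g (Suc i) * g (i + j - 1) \<le> g i * g (i + j)"
    using pos[of i] pos[of "i + j - 1"] by (simp add: field_simps)
  have "g (Suc i) * g j * g (i + j - 1) = (g (Suc i) * g (i + j - 1)) * g j" by simp
  also have "\<dots> \<le> g i * g (i + j) * g j" using r pos[of j] by (intro mult_right_mono) auto
  also have "\<dots> = (g i * g j) * g (i + j)" by simp
  also have "\<dots> \<le> g 1 * g (i + j - 1) * g (i + j)"
    using step.IH pos[of "i + j"] by (intro mult_right_mono) auto
  finally have "g (Suc i) * g j * g (i + j - 1) \<le> g 1 * g (i + j) * g (i + j - 1)" by (simp add: ac_simps)
  then show ?case using pos[of "i + j - 1"] by simp
qed

text \<open>The quotient of last and first term telescopes into \<open>Suc l\<close> ratios, the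
  last of which is the largest.\<close>

lemma log_convex_last_le:
  fixes g :: "nat \<Rightarrow> real"
  assumes pos: "\<And>i. 0 < g i" and cvx: "\<And>i. (g (Suc i))\<^sup>2 \<le> g i * g (Suc (Suc i))"
  shows "g (Suc l) * g l ^ Suc l \<le> g 0 * g (Suc l) ^ Suc l"
proof -
  define r where "r i = g (Suc i) / g i" for i
  have "(\<Prod>i\<le>l. r i) = g (Suc l) / g 0"
  proof (induction l)
    case (Suc l)
    then show ?case using pos[of "Suc l"] by (simp add: r_def)
  qed (simp add: r_def)
  moreover have "(\<Prod>i\<le>l. r i) \<le> (\<Prod>i\<le>l. r l)"
    using log_convex_ratio[of g, OF pos cvx] less_imp_le[OF pos] by (intro prod_mono) (auto simp: r_def)
  ultimately have "g (Suc l) / g 0 \<le> (g (Suc l) / g l) ^ Suc l" by (simp add: r_def)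
  then show ?thesis
    using pos[of 0] pos[of l] by (simp add: field_simps power_divide del: power_Suc)
qed

section \<open>The adjacency matrix normalised by degrees\<close>

locale min_degree_graph =
  fixes W :: "'a set" and E :: "'a set set" and \<delta> :: real
  assumes finW: "finite W" and nonempty: "W \<noteq> {}" and edges2: "\<And>e. e \<in> E \<Longrightarrow> card e = 2"
    and \<delta>_pos: "0 < \<delta>" and min_degree: "\<And>v. v \<in> W \<Longrightarrow> \<delta> \<le> card {u \<in> W. {v, u} \<in> E}"
begin

definition degree :: "'a \<Rightarrow> real" where
  "degree v = card {u \<in> W. {v, u} \<in> E}"

text \<open>Unlike transition probabilities of the random walk, this matrix is symmetric, so
  diagonal entries of its even powers are sums of squares.\<close>

definition nadj :: "'a \<Rightarrow> 'a \<Rightarrow> real" where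
  "nadj u v = (if {u, v} \<in> E then 1 / sqrt (degree u * degree v) else 0)"

text \<open>The entries of the powers of the matrix \<open>nadj\<close> on \<open>W\<close>.\<close>

primrec walk :: "nat \<Rightarrow> 'a \<Rightarrow> 'a \<Rightarrow> real" where
  "walk 0 u v = (if u = v then 1 else 0)"
| "walk (Suc k) u v = (\<Sum>x\<in>W. nadj u x * walk k x v)"

fun list_weight :: "'a list \<Rightarrow> real" where
  "list_weight (x # y # xs) = nadj x y * list_weight (y # xs)"
| "list_weight _ = 1"

abbreviation lists_of :: "nat \<Rightarrow> 'a list set" where
  "lists_of k \<equiv> {xs. set xs \<subseteq> W \<and> length xs = k}"

lemma degree_ge: "v \<in> W \<Longrightarrow> \<delta> \<le> degree v"
  using min_degree by (simp add: degree_def)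

lemma degree_pos: "v \<in> W \<Longrightarrow> 0 < degree v"
  using degree_ge \<delta>_pos by fastforce

lemma nadj_nonneg: "0 \<le> nadj u v"
  by (simp add: nadj_def degree_def)

lemma nadj_sym: "nadj u v = nadj v u"
  by (simp add: nadj_def insert_commute mult.commute)

lemma nadj_self: "nadj v v = 0"
  using edges2[of "{v}"] by (auto simp: nadj_def)

lemma nadj_le: "u \<in> W \<Longrightarrow> v \<in> W \<Longrightarrow> nadj u v \<le> 1 / \<delta>"
proof -
  assume "u \<in> W" "v \<in> W"
  then have "\<delta> * \<delta> \<le> degree u * degree v"
    using degree_ge \<delta>_pos degree_pos less_imp_le by (intro mult_mono) auto
  then have "\<delta> \<le> sqrt (degree u * degree v)"
    using \<delta>_pos real_sqrt_le_mono by fastforce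
  then show "nadj u v \<le> 1 / \<delta>" using \<delta>_pos by (simp add: nadj_def frac_le)
qed

lemma walk_nonneg: "0 \<le> walk k u v"
  by (induction k arbitrary: u) (auto intro!: sum_nonneg mult_nonneg_nonneg nadj_nonneg)

lemma walk_1: "v \<in> W \<Longrightarrow> walk (Suc 0) u v = nadj u v"
  using finW by (simp add: if_distrib cong: if_cong)

lemma walk_add:
  assumes "u \<in> W"
  shows "walk (a + b) u v = (\<Sum>x\<in>W. walk a u x * walk b x v)"
  using assms
proof (induction a arbitrary: u)
  case 0
  have "(\<Sum>x\<in>W. walk 0 u x * walk b x v) = (\<Sum>x\<in>W. if x = u then walk b u v else 0)"
    by (intro sum.cong) auto
  then show ?case using finW 0 by simp
next
  case (Suc a)
  have "walk (Suc a + b) u v = (\<Sum>y\<in>W. nadj u y * (\<Sum>x\<in>W. walk a y x * walk b x v))"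
    using Suc.IH by simp
  also have "\<dots> = (\<Sum>y\<in>W. \<Sum>x\<in>W. nadj u y * walk a y x * walk b x v)"
    by (simp add: sum_distrib_left mult.assoc)
  also have "\<dots> = (\<Sum>x\<in>W. \<Sum>y\<in>W. nadj u y * walk a y x * walk b x v)" by (rule sum.swap)
  finally show ?case by (simp add: sum_distrib_right)
qed

lemma walk_sym: "u \<in> W \<Longrightarrow> v \<in> W \<Longrightarrow> walk k u v = walk k v u"
proof (induction k arbitrary: u v)
  case (Suc k)
  have "walk (Suc k) u v = (\<Sum>x\<in>W. walk k v x * walk (Suc 0) x u)"
    using Suc by (auto intro!: sum.cong simp: walk_1 nadj_sym mult.commute simp del: walk.simps(2))
      (simp add: nadj_sym mult.commute)
  also have "\<dots> = walk (Suc k) v u" using walk_add[OF Suc.prems(2), of k "Suc 0" u] by simp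
  finally show ?case .
qed simp

text \<open>This is the eigenvector for the eigenvalue 1: in one step, each of the
  \<open>degree u\<close> neighbours of \<open>u\<close> contributes
  \<open>1 / sqrt (degree u)\<close>.\<close>

lemma walk_fixes_sqrt_degree: "u \<in> W \<Longrightarrow> (\<Sum>v\<in>W. walk k u v * sqrt (degree v)) = sqrt (degree u)"
proof (induction k arbitrary: u)
  case 0
  have "(\<Sum>v\<in>W. walk 0 u v * sqrt (degree v)) = (\<Sum>v\<in>W. if v = u then sqrt (degree u) else 0)"
    by (intro sum.cong) auto
  then show ?case using finW 0 by simp
next
  case (Suc k)
  have "(\<Sum>v\<in>W. walk (Suc k) u v * sqrt (degree v)) = (\<Sum>v\<in>W. \<Sum>x\<in>W. nadj u x * walk k x v * sqrt (degree v))"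
    by (simp add: sum_distrib_right)
  also have "\<dots> = (\<Sum>x\<in>W. \<Sum>v\<in>W. nadj u x * walk k x v * sqrt (degree v))" by (rule sum.swap)
  also have "\<dots> = (\<Sum>x\<in>W. nadj u x * (\<Sum>v\<in>W. walk k x v * sqrt (degree v)))"
    by (simp add: sum_distrib_left mult.assoc)
  also have "\<dots> = (\<Sum>x\<in>W. nadj u x * sqrt (degree x))" using Suc.IH by simp
  also have "\<dots> = (\<Sum>x\<in>{x\<in>W. {u, x} \<in> E}. 1 / sqrt (degree u))"
    using finW degree_pos by (intro sum.mono_neutral_cong_right)
      (auto simp: nadj_def real_sqrt_mult less_imp_neq[THEN not_sym])
  also have "\<dots> = degree u / sqrt (degree u)" by (simp add: degree_def)
  also have "\<dots> = sqrt (degree u)" using degree_pos[OF Suc.prems] by (simp add: real_div_sqrt)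
  finally show ?case .
qed

lemma walk_double: "u \<in> W \<Longrightarrow> walk (2 * a) u u = (\<Sum>x\<in>W. (walk a u x)\<^sup>2)"
  using walk_add[of u a a u] walk_sym by (auto simp: mult_2 power2_eq_square intro!: sum.cong)

text \<open>The row of \<open>u\<close> in the power \<open>a\<close> cannot vanish, since it maps
  the eigenvector to a positive number. Strict positivity lets the log-convexity lemmas form
  ratios.\<close>

lemma walk_double_pos:
  assumes "u \<in> W"
  shows "0 < walk (2 * a) u u"
proof -
  have "(\<Sum>v\<in>W. walk a u v * sqrt (degree v)) \<noteq> 0"
    using walk_fixes_sqrt_degree[OF assms] degree_pos[OF assms] by simp
  then obtain v where "v \<in> W" "walk a u v \<noteq> 0" using sum.neutral by force
  then show ?thesis
    unfolding walk_double[OF assms] using finW by (intro sum_pos2[of W v]) auto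
qed

lemma walk_Cauchy_Schwarz:
  assumes "u \<in> W"
  shows "(walk (a + b) u u)\<^sup>2 \<le> walk (2 * a) u u * walk (2 * b) u u"
proof -
  have "walk (a + b) u u = (\<Sum>x\<in>W. walk a u x * walk b u x)"
    using walk_add[OF assms, of a b u] walk_sym assms by (auto intro!: sum.cong)
  then show ?thesis
    unfolding walk_double[OF assms] using Cauchy_Schwarz_ineq_sum by metis
qed

lemma walk_convex:
  assumes "u \<in> W"
  shows "(walk (2 * Suc i) u u)\<^sup>2 \<le> walk (2 * i) u u * walk (2 * Suc (Suc i)) u u"
proof -
  have "i + Suc (Suc i) = 2 * Suc i" by simp
  then show ?thesis using walk_Cauchy_Schwarz[OF assms, of i "Suc (Suc i)"] by metis
qed

text \<open>A closed walk that meets \<open>v\<close> twice splits into closed walks of lengths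
  \<open>a\<close> and \<open>b\<close> at \<open>v\<close>; the extreme split is 2 and
  \<open>2 * l - 2\<close>. Even lengths are covered by log-convexity. Odd diagonal entries need not
  obey it, so their squares are bounded by neighbouring even entries, which are then paired
  crosswise so that each pair again has index sum \<open>l\<close>. A loop of length 1 has weight
  0.\<close>

lemma walk_product_le:
  assumes v: "v \<in> W" and "a + b = 2 * l" "1 \<le> a" "1 \<le> b"
  shows "walk a v v * walk b v v \<le> walk 2 v v * walk (2 * (l - 1)) v v"
proof -
  define g where "g i = walk (2 * i) v v" for i
  have pos: "0 < g i" for i unfolding g_def by (rule walk_double_pos[OF v])
  have cvx: "(g (Suc i))\<^sup>2 \<le> g i * g (Suc (Suc i))" for i unfolding g_def by (rule walk_convex[OF v])
  have main: "g i * g j \<le> g 1 * g (l - 1)" if "1 \<le> i" "1 \<le> j" "i + j = l" for i j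
    using log_convex_product_le[of g, OF pos cvx that(1,2)] that(3) by simp
  have rhs: "walk 2 v v * walk (2 * (l - 1)) v v = g 1 * g (l - 1)" by (simp add: g_def numeral_2_eq_2)
  consider "a = 1 \<or> b = 1" | i j where "a = 2 * i" "b = 2 * j" | i j where "a = Suc (2 * i)" "b = Suc (2 * j)" "1 \<le> i" "1 \<le> j"
  proof (cases "even a")
    case True
    then have "even b" using assms(2) by presburger
    with True show ?thesis using that(2) by (auto elim!: evenE)
  next
    case False
    then have "odd b" using assms(2) by presburger
    from False obtain i where i: "a = 2 * i + 1" by (auto elim!: oddE)
    from \<open>odd b\<close> obtain j where j: "b = 2 * j + 1" by (auto elim!: oddE)
    show ?thesis using that(1) that(3)[of i j] i j by (cases "i = 0 \<or> j = 0") auto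
  qed
  then show ?thesis
  proof cases
    case 1
    then have "walk a v v * walk b v v = 0" using walk_1[OF v] nadj_self by auto
    moreover have "0 \<le> g 1 * g (l - 1)" using less_imp_le[OF pos] by simp
    ultimately show ?thesis unfolding rhs by linarith
  next
    case (2 i j)
    then show ?thesis unfolding rhs using main[of i j] assms by (simp add: g_def)
  next
    case (3 i j)
    have a: "(walk a v v)\<^sup>2 \<le> g i * g (Suc i)"
      using walk_Cauchy_Schwarz[OF v, of i "Suc i"] 3 by (simp add: g_def mult_2 del: walk.simps)
    have b: "(walk b v v)\<^sup>2 \<le> g j * g (Suc j)"
      using walk_Cauchy_Schwarz[OF v, of j "Suc j"] 3 by (simp add: g_def mult_2 del: walk.simps)
    have "(walk a v v * walk b v v)\<^sup>2 \<le> (g i * g (Suc i)) * (g j * g (Suc j))"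
      unfolding power_mult_distrib using a b less_imp_le[OF pos] by (intro mult_mono) auto
    also have "\<dots> = (g i * g (Suc j)) * (g (Suc i) * g j)" by simp
    also have "\<dots> \<le> (g 1 * g (l - 1)) * (g 1 * g (l - 1))"
    proof (rule mult_mono)
      show "g i * g (Suc j) \<le> g 1 * g (l - 1)" by (rule main) (use 3 assms(2) in auto)
      show "g (Suc i) * g j \<le> g 1 * g (l - 1)" by (rule main) (use 3 assms(2) in auto)
    qed (use less_imp_le[OF pos] in auto)
    finally have "(walk a v v * walk b v v)\<^sup>2 \<le> (g 1 * g (l - 1))\<^sup>2" by (simp only: power2_eq_square)
    then show ?thesis
      unfolding rhs by (rule power2_le_imp_le) (simp add: less_imp_le[OF pos])
  qed
qed

text \<open>One step out and back: each of the \<open>degree v\<close> neighbours contributes at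
  most \<open>1 / (degree v * \<delta>)\<close>. This factor \<open>1 / \<delta>\<close> is what
  makes walks with a repeated vertex rare.\<close>

lemma walk_2_le: "v \<in> W \<Longrightarrow> walk 2 v v \<le> 1 / \<delta>"
proof -
  assume v: "v \<in> W"
  have "walk 2 v v = (\<Sum>x\<in>W. (nadj v x)\<^sup>2)"
    using walk_double[OF v, of "Suc 0"] walk_1 by (simp add: numeral_2_eq_2)
  also have "\<dots> = (\<Sum>x\<in>{x\<in>W. {v, x} \<in> E}. 1 / (degree v * degree x))"
    using finW by (intro sum.mono_neutral_cong_right) (auto simp: nadj_def power_divide degree_def)
  also have "\<dots> \<le> (\<Sum>x\<in>{x\<in>W. {v, x} \<in> E}. 1 / (degree v * \<delta>))"
    using degree_pos[OF v] degree_ge \<delta>_pos degree_pos by (intro sum_mono frac_le mult_left_mono mult_pos_pos) auto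
  also have "\<dots> = degree v / (degree v * \<delta>)" by (simp add: degree_def)
  also have "\<dots> = 1 / \<delta>" using degree_pos[OF v] by simp
  finally show "walk 2 v v \<le> 1 / \<delta>" .
qed

section \<open>Traces of even powers\<close>

definition trace :: "nat \<Rightarrow> real" where
  "trace j = (\<Sum>v\<in>W. walk (2 * j) v v)"

lemma trace_eq: "a + b = 2 * j \<Longrightarrow> trace j = (\<Sum>(u, v)\<in>W \<times> W. walk a u v * walk b u v)"
  unfolding trace_def sum.cartesian_product[symmetric]
  by (intro sum.cong refl) (metis (no_types, lifting) sum.cong walk_add walk_sym)

lemma trace_square: "trace j = (\<Sum>p\<in>W \<times> W. (walk j (fst p) (snd p))\<^sup>2)"
  using trace_eq[of j j j] by (simp add: case_prod_beta power2_eq_square)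

lemma trace_pos: "0 < trace j"
  unfolding trace_def using finW nonempty walk_double_pos by (intro sum_pos) auto

lemma trace_convex: "(trace (Suc j))\<^sup>2 \<le> trace j * trace (Suc (Suc j))"
proof -
  have "trace (Suc j) = (\<Sum>p\<in>W \<times> W. walk j (fst p) (snd p) * walk (Suc (Suc j)) (fst p) (snd p))"
    by (subst trace_eq[of j "Suc (Suc j)"]) (auto simp: case_prod_beta)
  then show ?thesis unfolding trace_square[of j] trace_square[of "Suc (Suc j)"]
    using Cauchy_Schwarz_ineq_sum by metis
qed

lemma trace_0: "trace 0 = card W"
  by (simp add: trace_def)

text \<open>The eigenvalue 1 contributes 1 to the trace. Instead of diagonalising, Cauchy-Schwarz is
  applied to the entries of the \<open>j\<close>-th power and of the rank one matrix formed from the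
  eigenvector.\<close>

lemma trace_ge_1: "1 \<le> trace j"
proof -
  define s where "s = (\<Sum>u\<in>W. degree u)"
  have s: "0 < s" unfolding s_def using finW nonempty degree_pos by (intro sum_pos) auto
  have "(\<Sum>p\<in>W \<times> W. walk j (fst p) (snd p) * (sqrt (degree (fst p)) * sqrt (degree (snd p))))
      = (\<Sum>u\<in>W. sqrt (degree u) * (\<Sum>v\<in>W. walk j u v * sqrt (degree v)))"
    by (simp add: sum.cartesian_product' sum_distrib_left mult_ac)
  also have "\<dots> = (\<Sum>u\<in>W. sqrt (degree u) * sqrt (degree u))" using walk_fixes_sqrt_degree by simp
  also have "\<dots> = s" unfolding s_def using degree_pos by (intro sum.cong refl) (simp add: less_imp_le)
  finally have 1: "(\<Sum>p\<in>W \<times> W. walk j (fst p) (snd p) * (sqrt (degree (fst p)) * sqrt (degree (snd p)))) = s" .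
  have "(\<Sum>p\<in>W \<times> W. (sqrt (degree (fst p)) * sqrt (degree (snd p)))\<^sup>2) = (\<Sum>p\<in>W \<times> W. degree (fst p) * degree (snd p))"
    using degree_pos by (intro sum.cong refl) (auto simp: power_mult_distrib less_imp_le)
  also have "\<dots> = s * s" by (simp add: s_def sum_product sum.cartesian_product')
  finally have 2: "(\<Sum>p\<in>W \<times> W. (sqrt (degree (fst p)) * sqrt (degree (snd p)))\<^sup>2) = s * s" .
  have "s\<^sup>2 \<le> trace j * (s * s)"
    using Cauchy_Schwarz_ineq_sum[of "\<lambda>p. walk j (fst p) (snd p)"
        "\<lambda>p. sqrt (degree (fst p)) * sqrt (degree (snd p))" "W \<times> W"]
    unfolding 1 2 trace_square[symmetric] .
  then show ?thesis using s by (simp add: power2_eq_square)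
qed

text \<open>Here \<open>b\<close> bounds the \<open>Suc l\<close>-th root of the number of vertices,
  which is \<open>trace 0\<close>. The extra factor \<open>trace (Suc l)\<close>, at least 1, only
  brings the left side into the form of \<open>log_convex_last_le\<close>.\<close>

lemma trace_pred_le:
  fixes b :: real
  assumes "card W \<le> b ^ Suc l" "0 \<le> b"
  shows "trace l \<le> b * trace (Suc l)"
proof -
  have "trace l ^ Suc l \<le> trace (Suc l) * trace l ^ Suc l"
    using trace_ge_1[of "Suc l"] less_imp_le[OF trace_pos, of l]
    by (metis mult_le_cancel_right1 not_le zero_le_power)
  also have "\<dots> \<le> trace 0 * trace (Suc l) ^ Suc l"
    by (rule log_convex_last_le[of trace, OF trace_pos trace_convex])
  also have "\<dots> \<le> b ^ Suc l * trace (Suc l) ^ Suc l"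
    using assms less_imp_le[OF trace_pos] by (intro mult_right_mono) (auto simp: trace_0 simp del: power_Suc)
  finally have "trace l ^ Suc l \<le> (b * trace (Suc l)) ^ Suc l" by (simp only: power_mult_distrib)
  then show ?thesis
    by (rule power_le_imp_le_base) (use assms less_imp_le[OF trace_pos] in auto)
qed

section \<open>Weights of closed walks\<close>

lemma list_weight_nonneg: "0 \<le> list_weight xs"
  by (induction xs rule: list_weight.induct) (auto simp: nadj_nonneg)

lemma list_weight_append: "list_weight (xs @ y # ys) = list_weight (xs @ [y]) * list_weight (y # ys)"
proof (induction xs)
  case (Cons x xs)
  then show ?case by (cases xs) auto
qed simp

lemma walk_eq_sum_lists:
  "walk (Suc k) u v = (\<Sum>xs\<in>lists_of k. list_weight (u # xs @ [v]))" if "v \<in> W"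
proof (induction k arbitrary: u)
  case 0
  have "lists_of 0 = {[]}" by auto
  then show ?case using walk_1[OF that] by simp
next
  case (Suc k)
  have "walk (Suc (Suc k)) u v = (\<Sum>x\<in>W. nadj u x * (\<Sum>xs\<in>lists_of k. list_weight (x # xs @ [v])))"
    using Suc.IH by (subst walk.simps) simp
  also have "\<dots> = (\<Sum>x\<in>W. \<Sum>xs\<in>lists_of k. list_weight (u # (x # xs) @ [v]))"
    by (simp add: sum_distrib_left)
  also have "\<dots> = (\<Sum>xs\<in>lists_of (Suc k). list_weight (u # xs @ [v]))"
    by (rule sum_lists_Suc[OF finW, symmetric])
  finally show ?case .
qed

abbreviation closed_weight :: "'a list \<Rightarrow> real" where
  "closed_weight xs \<equiv> list_weight (xs @ [hd xs])"

lemma sum_closed_weight: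
  assumes "0 < l"
  shows "(\<Sum>xs\<in>lists_of (2 * l). closed_weight xs) = trace l"
proof -
  obtain k where k: "2 * l = Suc k" using assms by (cases "2 * l") auto
  show ?thesis unfolding trace_def k
    by (subst sum_lists_Suc[OF finW]) (use walk_eq_sum_lists in auto)
qed

text \<open>Cutting at both visits to \<open>y\<close> yields an inner closed walk and an outer one;
  the latter is rotated so that it starts at \<open>y\<close> too.\<close>

lemma closed_weight_decomp:
  "closed_weight (as @ y # bs @ y # cs) = list_weight (y # bs @ [y]) * list_weight (y # (cs @ as) @ [y])"
proof -
  let ?h = "hd (as @ [y])"
  have "closed_weight (as @ y # bs @ y # cs) = list_weight (as @ y # bs @ y # cs @ [?h])"
    by (cases as) auto
  also have "\<dots> = list_weight (as @ [y]) * (list_weight (y # bs @ [y]) * list_weight (y # cs @ [?h]))"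
    using list_weight_append[of as y "bs @ y # cs @ [?h]"] list_weight_append[of "y # bs" y "cs @ [?h]"] by simp
  also have "list_weight (as @ [y]) * (list_weight (y # bs @ [y]) * list_weight (y # cs @ [?h]))
      = list_weight (y # bs @ [y]) * (list_weight (y # cs @ [?h]) * list_weight (as @ [y]))" by simp
  also have "list_weight (y # cs @ [?h]) * list_weight (as @ [y]) = list_weight (y # (cs @ as) @ [y])"
  proof (cases as)
    case (Cons a as')
    then show ?thesis using list_weight_append[of "y # cs" a "as' @ [y]"] by simp
  qed simp
  finally show ?thesis .
qed

text \<open>After cutting at the repeated vertex, all other vertices are summed freely, which turns
  the two pieces into diagonal entries of the powers \<open>j - i\<close> and
  \<open>2 * l - (j - i)\<close>. In the proof \<open>b\<close> and \<open>c\<close> count the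
  entries strictly between positions \<open>i\<close> and \<open>j\<close> and those after
  \<open>j\<close>.\<close>

lemma sum_closed_weight_repeat_le:
  assumes "i < j" "j < 2 * l"
  shows "(\<Sum>xs\<in>lists_of (2 * l). if xs ! i = xs ! j then closed_weight xs else 0) \<le> trace (l - 1) / \<delta>"
proof -
  define b where "b = j - i - 1"
  define c where "c = 2 * l - j - 1"
  have len: "2 * l = i + Suc (b + Suc c)" and j: "j = Suc (i + b)" using assms by (auto simp: b_def c_def)
  let ?f = "\<lambda>xs. if xs ! i = xs ! j then closed_weight xs else 0"
  have "(\<Sum>xs\<in>lists_of (2 * l). ?f xs)
     = (\<Sum>as\<in>lists_of i. \<Sum>y\<in>W. \<Sum>bs\<in>lists_of b. \<Sum>z\<in>W. \<Sum>cs\<in>lists_of c. ?f (as @ y # bs @ z # cs))"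
    unfolding len by (simp only: sum_lists_append[OF finW] sum_lists_Suc[OF finW])
  also have "\<dots> = (\<Sum>as\<in>lists_of i. \<Sum>y\<in>W. \<Sum>bs\<in>lists_of b. \<Sum>z\<in>W.
      if z = y then \<Sum>cs\<in>lists_of c. closed_weight (as @ y # bs @ y # cs) else 0)"
    by (intro sum.cong refl) (auto simp: j nth_append intro!: sum.neutral)
  also have "\<dots> = (\<Sum>as\<in>lists_of i. \<Sum>y\<in>W. \<Sum>bs\<in>lists_of b. \<Sum>cs\<in>lists_of c.
      list_weight (y # bs @ [y]) * list_weight (y # (cs @ as) @ [y]))"
    using finW by (simp add: closed_weight_decomp[simplified])
  also have "\<dots> = (\<Sum>y\<in>W. \<Sum>as\<in>lists_of i. \<Sum>cs\<in>lists_of c. \<Sum>bs\<in>lists_of b.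
      list_weight (y # bs @ [y]) * list_weight (y # (cs @ as) @ [y]))"
    by (subst sum.swap) (intro sum.cong refl sum.swap)
  also have "\<dots> = (\<Sum>y\<in>W. walk (Suc b) y y * walk (Suc (c + i)) y y)"
  proof (intro sum.cong refl)
    fix y assume y: "y \<in> W"
    have "walk (Suc (c + i)) y y = (\<Sum>cs\<in>lists_of c. \<Sum>as\<in>lists_of i. list_weight (y # (cs @ as) @ [y]))"
      by (simp only: walk_eq_sum_lists[OF y] sum_lists_append[OF finW])
    also have "\<dots> = (\<Sum>as\<in>lists_of i. \<Sum>cs\<in>lists_of c. list_weight (y # (cs @ as) @ [y]))"
      by (rule sum.swap)
    finally show "(\<Sum>as\<in>lists_of i. \<Sum>cs\<in>lists_of c. \<Sum>bs\<in>lists_of b.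
      list_weight (y # bs @ [y]) * list_weight (y # (cs @ as) @ [y])) = walk (Suc b) y y * walk (Suc (c + i)) y y"
      by (simp only: walk_eq_sum_lists[OF y, of b] sum_distrib_left sum_distrib_right)
  qed
  also have "\<dots> \<le> (\<Sum>y\<in>W. 1 / \<delta> * walk (2 * (l - 1)) y y)"
  proof (intro sum_mono)
    fix y assume y: "y \<in> W"
    have "walk (Suc b) y y * walk (Suc (c + i)) y y \<le> walk 2 y y * walk (2 * (l - 1)) y y"
      using len by (intro walk_product_le[OF y]) auto
    also have "\<dots> \<le> 1 / \<delta> * walk (2 * (l - 1)) y y"
      using walk_2_le[OF y] walk_nonneg by (rule mult_right_mono)
    finally show "walk (Suc b) y y * walk (Suc (c + i)) y y \<le> 1 / \<delta> * walk (2 * (l - 1)) y y" .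
  qed
  also have "\<dots> = trace (l - 1) / \<delta>" by (simp add: trace_def sum_divide_distrib)
  finally show ?thesis .
qed

text \<open>A union bound over the pairs of positions that may coincide: there are at most
  \<open>4 * l\<^sup>2\<close> pairs and each accounts for at most the share
  \<open>b / \<delta>\<close> of the trace. The 8 in the hypothesis leaves half of the trace to
  distinct lists.\<close>

lemma sum_distinct_closed_weight_ge:
  fixes b :: real
  assumes "0 < l" "card W \<le> b ^ l" "0 \<le> b" "8 * real l ^ 2 * b \<le> \<delta>"
  shows "1 / 2 \<le> (\<Sum>xs | xs \<in> lists_of (2 * l) \<and> distinct xs. closed_weight xs)"
proof -
  let ?L = "lists_of (2 * l)"
  let ?I = "{(i, j). i < j \<and> j < 2 * l}"
  have finL: "finite ?L" using finW by (simp add: finite_lists_length_eq)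
  have subI: "?I \<subseteq> {..<2 * l} \<times> {..<2 * l}" by auto
  then have finI: "finite ?I" by (rule finite_subset) simp
  have cardI: "card ?I \<le> 4 * l\<^sup>2"
    using card_mono[OF _ subI] by (simp add: card_cartesian_product power2_eq_square)
  define h where "h xs p = (if xs ! fst p = xs ! snd p then closed_weight xs else 0)" for xs p
  have h_nonneg: "0 \<le> h xs p" for xs p by (simp add: h_def list_weight_nonneg)
  have "(\<Sum>xs | xs \<in> ?L \<and> \<not> distinct xs. closed_weight xs)
      \<le> (\<Sum>xs | xs \<in> ?L \<and> \<not> distinct xs. \<Sum>p\<in>?I. h xs p)"
  proof (intro sum_mono)
    fix xs assume xs: "xs \<in> {xs. xs \<in> ?L \<and> \<not> distinct xs}"
    then obtain m n where mn: "m < length xs" "n < length xs" "m \<noteq> n" "xs ! m = xs ! n"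
      by (auto simp: distinct_conv_nth)
    define i j where "i = min m n" and "j = max m n"
    have ij: "i < j" "j < length xs" "xs ! i = xs ! j"
      using mn by (auto simp: i_def j_def min_def max_def)
    have "closed_weight xs = (\<Sum>p\<in>{(i, j)}. h xs p)"
      using ij by (simp add: h_def)
    also have "\<dots> \<le> (\<Sum>p\<in>?I. h xs p)"
      using ij xs finI h_nonneg by (intro sum_mono2) auto
    finally show "closed_weight xs \<le> (\<Sum>p\<in>?I. h xs p)" .
  qed
  also have "\<dots> \<le> (\<Sum>xs\<in>?L. \<Sum>p\<in>?I. h xs p)"
    using finL h_nonneg by (intro sum_mono2) (auto intro!: sum_nonneg)
  also have "\<dots> = (\<Sum>p\<in>?I. \<Sum>xs\<in>?L. h xs p)"
    by (rule sum.swap)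
  also have "\<dots> \<le> (\<Sum>p\<in>?I. trace (l - 1) / \<delta>)"
    unfolding h_def by (intro sum_mono sum_closed_weight_repeat_le) auto
  also have "\<dots> = real (card ?I) * (trace (l - 1) / \<delta>)" by simp
  also have "\<dots> \<le> real (4 * l\<^sup>2) * (b * trace l / \<delta>)"
  proof (rule mult_mono)
    show "real (card ?I) \<le> real (4 * l\<^sup>2)" using cardI by (rule of_nat_mono)
    have "trace (l - 1) \<le> b * trace l"
      using trace_pred_le[of b "l - 1"] assms by simp
    then show "trace (l - 1) / \<delta> \<le> b * trace l / \<delta>"
      using \<delta>_pos by (intro divide_right_mono) auto
    show "0 \<le> trace (l - 1) / \<delta>" using less_imp_le[OF trace_pos] \<delta>_pos by simp
  qed simp
  also have "\<dots> \<le> trace l / 2"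
  proof -
    have "8 * real l ^ 2 * b * trace l \<le> \<delta> * trace l"
      using assms(4) less_imp_le[OF trace_pos] by (intro mult_right_mono) auto
    then show ?thesis using \<delta>_pos by (simp add: field_simps)
  qed
  finally have *: "(\<Sum>xs | xs \<in> ?L \<and> \<not> distinct xs. closed_weight xs) \<le> trace l / 2" .
  have "trace l = (\<Sum>xs\<in>?L. closed_weight xs)" using sum_closed_weight assms by simp
  also have "\<dots> = (\<Sum>xs | xs \<in> ?L \<and> distinct xs. closed_weight xs) + (\<Sum>xs | xs \<in> ?L \<and> \<not> distinct xs. closed_weight xs)"
  proof -
    have "?L = {xs. xs \<in> ?L \<and> distinct xs} \<union> {xs. xs \<in> ?L \<and> \<not> distinct xs}" by blast
    moreover have "finite {xs. xs \<in> ?L \<and> distinct xs}" "finite {xs. xs \<in> ?L \<and> \<not> distinct xs}"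
      using finL by (auto elim: rev_finite_subset)
    moreover have "{xs. xs \<in> ?L \<and> distinct xs} \<inter> {xs. xs \<in> ?L \<and> \<not> distinct xs} = {}" by blast
    ultimately show ?thesis by (metis (no_types, lifting) sum.union_disjoint)
  qed
  finally show ?thesis using * trace_ge_1[of l] by linarith
qed

lemma list_weight_le: "set xs \<subseteq> W \<Longrightarrow> list_weight xs \<le> (1 / \<delta>) ^ (length xs - 1)"
proof (induction xs rule: list_weight.induct)
  case (1 x y xs)
  then have "nadj x y * list_weight (y # xs) \<le> 1 / \<delta> * (1 / \<delta>) ^ length xs"
    using nadj_le[of x y] list_weight_nonneg nadj_nonneg \<delta>_pos by (intro mult_mono) auto
  then show ?case by simp
qed auto

lemma list_weight_nonzero: "list_weight xs \<noteq> 0 \<Longrightarrow> Suc i < length xs \<Longrightarrow> {xs ! i, xs ! Suc i} \<in> E"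
proof (induction xs arbitrary: i rule: list_weight.induct)
  case (1 x y xs)
  then show ?case by (cases i) (auto simp: nadj_def split: if_splits)
qed auto

end

section \<open>Cycles as edge sets\<close>

definition cycle_edges :: "'a list \<Rightarrow> 'a set set" where
  "cycle_edges xs = {{xs ! i, xs ! (Suc i mod length xs)} | i. i < length xs}"

text \<open>Identifying a cycle with its edge set makes cycles the hyperedges of a hypergraph whose
  vertices are the edges of the graph.\<close>

definition cycles :: "nat \<Rightarrow> 'a set set \<Rightarrow> 'a set set set" where
  "cycles k E = {cycle_edges xs | xs. length xs = k \<and> distinct xs \<and> cycle_edges xs \<subseteq> E}"

lemma Union_cycle_edges: "\<Union> (cycle_edges xs) = set xs"
proof (rule set_eqI)
  fix x
  have "x \<in> \<Union> (cycle_edges xs)" if x: "x \<in> set xs"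
  proof -
    obtain i where "i < length xs" "xs ! i = x" using x by (auto simp: in_set_conv_nth)
    then show ?thesis unfolding cycle_edges_def by blast
  qed
  moreover have "x \<in> set xs" if "x \<in> \<Union> (cycle_edges xs)"
  proof -
    from that obtain i where "i < length xs" "x = xs ! i \<or> x = xs ! (Suc i mod length xs)"
      unfolding cycle_edges_def by auto
    then show ?thesis by (metis gr_implies_not0 mod_less_divisor neq0_conv nth_mem)
  qed
  ultimately show "x \<in> \<Union> (cycle_edges xs) \<longleftrightarrow> x \<in> set xs" by blast
qed

lemma (in min_degree_graph) card_distinct_closed_ge:
  fixes b :: real
  assumes "0 < l" "card W \<le> b ^ l" "0 \<le> b" "8 * real l ^ 2 * b \<le> \<delta>"
  shows "\<delta> ^ (2 * l) / 2 \<le> card {xs. set xs \<subseteq> W \<and> length xs = 2 * l \<and> distinct xs \<and> cycle_edges xs \<subseteq> E}"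
proof -
  let ?A = "{xs. xs \<in> lists_of (2 * l) \<and> distinct xs}"
  let ?B = "{xs. set xs \<subseteq> W \<and> length xs = 2 * l \<and> distinct xs \<and> cycle_edges xs \<subseteq> E}"
  have finL: "finite (lists_of (2 * l))" using finW by (simp add: finite_lists_length_eq)
  then have finA: "finite ?A" by (rule finite_subset[rotated]) auto
  have zero: "closed_weight xs = 0" if "xs \<in> ?A - ?B" for xs
  proof (rule ccontr)
    assume nz: "closed_weight xs \<noteq> 0"
    have xs: "length xs = 2 * l" "xs \<noteq> []" using that assms(1) by auto
    have "{xs ! i, xs ! (Suc i mod length xs)} \<in> E" if i: "i < length xs" for i
    proof -
      have "(xs @ [hd xs]) ! Suc i = xs ! (Suc i mod length xs)"
      proof (cases "Suc i < length xs")
        case False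
        then have "Suc i = length xs" using i by simp
        then show ?thesis using xs by (simp add: nth_append hd_conv_nth)
      qed (simp add: nth_append)
      then show ?thesis using list_weight_nonzero[OF nz, of i] i by (simp add: nth_append)
    qed
    then have "cycle_edges xs \<subseteq> E" unfolding cycle_edges_def by auto
    then show False using that by blast
  qed
  have "1 / 2 \<le> (\<Sum>xs\<in>?A. closed_weight xs)" by (rule sum_distinct_closed_weight_ge[OF assms])
  also have "\<dots> = (\<Sum>xs\<in>?B. closed_weight xs)"
    using finA zero by (intro sum.mono_neutral_right) auto
  also have "\<dots> \<le> (\<Sum>xs\<in>?B. (1 / \<delta>) ^ (2 * l))"
  proof (intro sum_mono)
    fix xs assume "xs \<in> ?B"
    then have "set (xs @ [hd xs]) \<subseteq> W" "length (xs @ [hd xs]) - 1 = 2 * l"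
      using assms(1) by (cases xs; auto)+
    then show "closed_weight xs \<le> (1 / \<delta>) ^ (2 * l)" using list_weight_le by metis
  qed
  also have "\<dots> = card ?B / \<delta> ^ (2 * l)" by (simp add: power_divide)
  finally show ?thesis using \<delta>_pos by (simp add: field_simps)
qed

text \<open>All lists that trace the same cycle use the same \<open>2 * l\<close> vertices, so
  passing from lists to edge sets costs at most \<open>(2 * l) ^ (2 * l)\<close>. The parameter
  \<open>b\<close> stands for the \<open>l\<close>-th root of the number of vertices.\<close>

theorem cycle_supersaturation:
  fixes lam b :: real
  assumes "finite V" "V \<noteq> {}" "E \<subseteq> all_edges V" "0 < l" "lam * card V \<le> card E"
    and "card V \<le> b ^ l" "0 \<le> b" "8 * real l ^ 2 * b \<le> lam" "0 < lam"
  shows "lam ^ (2 * l) \<le> 2 * (2 * l) ^ (2 * l) * card (cycles (2 * l) E)"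
proof -
  obtain W where W: "W \<subseteq> V" "W \<noteq> {}" "\<And>v. v \<in> W \<Longrightarrow> lam \<le> card {u \<in> W. {v, u} \<in> E}"
    using min_degree_subgraph[OF assms(1,2,3,9,5)] by blast
  have finW: "finite W" using W assms(1) finite_subset by blast
  interpret min_degree_graph W E lam
    by unfold_locales (use W finW assms in \<open>auto simp: all_edges_def\<close>)
  let ?B = "{xs. set xs \<subseteq> W \<and> length xs = 2 * l \<and> distinct xs \<and> cycle_edges xs \<subseteq> E}"
  have finE: "finite E"
    using assms(1,3) finite_subset[of E "Pow V"] by (auto simp: all_edges_def)
  have finC: "finite (cycles (2 * l) E)"
    by (rule finite_subset[of _ "Pow E"]) (use finE in \<open>auto simp: cycles_def\<close>)
  have fib: "finite {xs \<in> ?B. cycle_edges xs = C} \<and> card {xs \<in> ?B. cycle_edges xs = C} \<le> (2 * l) ^ (2 * l)"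
    if "C \<in> cycles (2 * l) E" for C
  proof -
    from that obtain ys where ys: "length ys = 2 * l" "distinct ys" "C = cycle_edges ys"
      unfolding cycles_def by blast
    have sub: "{xs \<in> ?B. cycle_edges xs = C} \<subseteq> {xs. set xs \<subseteq> set ys \<and> length xs = 2 * l}"
      by (auto simp: ys(3) Union_cycle_edges[symmetric])
    have "card {xs. set xs \<subseteq> set ys \<and> length xs = 2 * l} = (2 * l) ^ (2 * l)"
      using ys by (simp add: card_lists_length_eq distinct_card)
    then show ?thesis
      using sub card_mono[OF _ sub] finite_subset[OF sub] finite_lists_length_eq[of "set ys" "2 * l"] by simp
  qed
  have "?B \<subseteq> (\<Union>C\<in>cycles (2 * l) E. {xs \<in> ?B. cycle_edges xs = C})"
    unfolding cycles_def by blast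
  then have "card ?B \<le> card (\<Union>C\<in>cycles (2 * l) E. {xs \<in> ?B. cycle_edges xs = C})"
    using finC fib by (intro card_mono) auto
  also have "\<dots> \<le> (\<Sum>C\<in>cycles (2 * l) E. card {xs \<in> ?B. cycle_edges xs = C})"
    by (rule card_UN_le[OF finC])
  also have "\<dots> \<le> (\<Sum>C\<in>cycles (2 * l) E. (2 * l) ^ (2 * l))" using fib by (intro sum_mono) auto
  finally have 1: "card ?B \<le> (2 * l) ^ (2 * l) * card (cycles (2 * l) E)" by (simp add: mult.commute)
  have "card W \<le> card V" using W assms(1) by (intro card_mono) auto
  then have "card W \<le> b ^ l" using assms(6) by linarith
  then have "lam ^ (2 * l) \<le> 2 * real (card ?B)"
    using card_distinct_closed_ge[of l b] assms by simp
  also have "\<dots> \<le> 2 * real ((2 * l) ^ (2 * l) * card (cycles (2 * l) E))"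
    using 1 by (intro mult_left_mono of_nat_mono) auto
  finally show ?thesis by simp
qed

subsection \<open>Balanced supersaturation\<close>

lemma Suc_mod_eq: "i < k \<Longrightarrow> Suc i mod k = (if Suc i = k then 0 else Suc i)"
  by auto

text \<open>The residue 1 generates all residues modulo \<open>k\<close>. It serves to find, in a
  nonempty proper set of cycle edges, an edge whose successor is missing.\<close>

lemma closed_under_successor_mod:
  assumes "i \<in> J" "J \<subseteq> {..<k}" "\<And>i. i \<in> J \<Longrightarrow> Suc i mod k \<in> J"
  shows "J = {..<k}"
proof -
  have *: "(i + m) mod k \<in> J" for m
  proof (induction m)
    case 0
    then show ?case using assms(1,2) by auto
  next
    case (Suc m)
    then show ?case using assms(3)[of "(i + m) mod k"] by (simp add: mod_Suc_eq)
  qed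
  have "j \<in> J" if "j < k" for j
  proof -
    have "i < k" using assms(1,2) by auto
    then have "(i + (j + k - i)) mod k = j" using that by simp
    then show ?thesis using * by metis
  qed
  then show ?thesis using assms(2) by auto
qed

lemma cycle_edges_eq_image: "cycle_edges xs = (\<lambda>i. {xs ! i, xs ! (Suc i mod length xs)}) ` {..<length xs}"
  unfolding cycle_edges_def by auto

text \<open>Two different positions with the same edge would be successors of each other, which
  forces length 2.\<close>

lemma card_cycle_edges:
  assumes "distinct xs" "3 \<le> length xs"
  shows "card (cycle_edges xs) = length xs"
proof -
  let ?k = "length xs"
  have "inj_on (\<lambda>i. {xs ! i, xs ! (Suc i mod ?k)}) {..<?k}"
  proof (rule inj_onI)
    fix i j assume ij: "i \<in> {..<?k}" "j \<in> {..<?k}"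
      and eq: "{xs ! i, xs ! (Suc i mod ?k)} = {xs ! j, xs ! (Suc j mod ?k)}"
    have "0 < ?k" using assms(2) by linarith
    then have lt: "i < ?k" "j < ?k" "Suc i mod ?k < ?k" "Suc j mod ?k < ?k"
      using ij by (auto intro: mod_less_divisor)
    have "xs ! i = xs ! j \<or> (xs ! i = xs ! (Suc j mod ?k) \<and> xs ! (Suc i mod ?k) = xs ! j)"
      using eq unfolding doubleton_eq_iff by blast
    then have "i = j \<or> (i = Suc j mod ?k \<and> j = Suc i mod ?k)"
      using nth_eq_iff_index_eq[OF assms(1) lt(1,2)] nth_eq_iff_index_eq[OF assms(1) lt(1,4)]
        nth_eq_iff_index_eq[OF assms(1) lt(3,2)] by argo
    then show "i = j"
    proof
      assume "i = Suc j mod ?k \<and> j = Suc i mod ?k"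
      then have "Suc j = ?k \<and> i = 0 \<or> i = Suc j" "Suc i = ?k \<and> j = 0 \<or> j = Suc i"
        using Suc_mod_eq[OF lt(1)] Suc_mod_eq[OF lt(2)] by metis+
      then show ?thesis using assms(2) by linarith
    qed
  qed
  then show ?thesis unfolding cycle_edges_eq_image by (simp add: card_image)
qed

text \<open>Such a set is a disjoint union of paths. In the proof, the first endpoints of its edges
  are counted, together with the end of an edge whose successor is missing. The surplus vertex later
  gives the factor by which saturated sets are rarer than edges in a random sample.\<close>

lemma card_Union_proper_subset_cycle:
  assumes "distinct xs" "S \<subset> cycle_edges xs" "S \<noteq> {}"
  shows "card S < card (\<Union> S)"
proof -
  let ?k = "length xs" and ?e = "\<lambda>i. {xs ! i, xs ! (Suc i mod length xs)}"
  define J where "J = {i. i < ?k \<and> ?e i \<in> S}"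
  have S: "S = ?e ` J" using assms(2) unfolding J_def cycle_edges_eq_image by blast
  have finJ: "finite J" and subJ: "J \<subseteq> {..<?k}" unfolding J_def by auto
  have "J \<noteq> {..<?k}" using assms(2) unfolding S cycle_edges_eq_image by auto
  moreover obtain i0 where "i0 \<in> J" using assms(3) S by auto
  ultimately obtain i where i: "i \<in> J" "Suc i mod ?k \<notin> J"
    using closed_under_successor_mod[OF _ subJ] by blast
  have lt: "Suc i mod ?k < ?k" using i(1) unfolding J_def by (auto intro!: mod_less_divisor)
  have "card S \<le> card J" unfolding S using finJ by (rule card_image_le)
  also have "\<dots> < card (insert (Suc i mod ?k) J)" using i finJ by simp
  also have "\<dots> = card ((!) xs ` insert (Suc i mod ?k) J)"
    using subJ lt assms(1) by (intro card_image[symmetric] inj_onI) (auto simp: nth_eq_iff_index_eq subset_iff)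
  also have "\<dots> \<le> card (\<Union> S)"
  proof (rule card_mono)
    show "finite (\<Union> S)" unfolding S using finJ by auto
    show "(!) xs ` insert (Suc i mod ?k) J \<subseteq> \<Union> S" unfolding S using i(1) by auto
  qed
  finally show ?thesis .
qed

lemma cyclesE:
  assumes "D \<in> cycles k E"
  obtains xs where "D = cycle_edges xs" "distinct xs" "length xs = k" "D \<subseteq> E"
  using assms unfolding cycles_def by blast

lemma card_cycle: "D \<in> cycles k E \<Longrightarrow> 3 \<le> k \<Longrightarrow> card D = k"
  by (metis cyclesE card_cycle_edges)

lemma card_Union_cycle: "D \<in> cycles k E \<Longrightarrow> card (\<Union> D) = k"
  by (metis cyclesE Union_cycle_edges distinct_card)

lemma finite_cycle: "D \<in> cycles k E \<Longrightarrow> finite D"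
  by (auto elim!: cyclesE simp: cycle_edges_eq_image)

lemma cycle_subset: "D \<in> cycles k E \<Longrightarrow> D \<subseteq> E"
  by (auto elim!: cyclesE)

lemma cycles_mono: "E \<subseteq> E' \<Longrightarrow> cycles k E \<subseteq> cycles k E'"
  unfolding cycles_def by blast

lemma finite_cycles: "finite E \<Longrightarrow> finite (cycles k E)"
  by (rule finite_subset[of _ "Pow E"]) (auto dest: cycle_subset)

section \<open>Sampling vertex sets of a fixed size\<close>

lemma card_subsets_containing:
  assumes "finite V" "X \<subseteq> V" "card X \<le> s"
  shows "card {S. S \<subseteq> V \<and> card S = s \<and> X \<subseteq> S} = (card V - card X) choose (s - card X)"
proof -
  have finX: "finite X" using assms finite_subset by blast
  have "bij_betw (\<lambda>S. S - X) {S. S \<subseteq> V \<and> card S = s \<and> X \<subseteq> S} {T. T \<subseteq> V - X \<and> card T = s - card X}"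
  proof (rule bij_betw_byWitness[where f'="\<lambda>T. T \<union> X"])
    show "(\<lambda>T. T \<union> X) ` {T. T \<subseteq> V - X \<and> card T = s - card X} \<subseteq> {S. S \<subseteq> V \<and> card S = s \<and> X \<subseteq> S}"
    proof (intro image_subsetI)
      fix T assume T: "T \<in> {T. T \<subseteq> V - X \<and> card T = s - card X}"
      then have "finite T" using assms(1) finite_subset by blast
      then have "card (T \<union> X) = card T + card X" using T finX by (intro card_Un_disjoint) auto
      then show "T \<union> X \<in> {S. S \<subseteq> V \<and> card S = s \<and> X \<subseteq> S}" using T assms by auto
    qed
  qed (use finX in \<open>auto simp: card_Diff_subset\<close>)
  then have "card {S. S \<subseteq> V \<and> card S = s \<and> X \<subseteq> S} = card {T. T \<subseteq> V - X \<and> card T = s - card X}"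
    by (rule bij_betw_same_card)
  then show ?thesis using assms finX by (simp add: n_subsets card_Diff_subset)
qed

lemma binomial_diff_step:
  assumes "x < s" "s \<le> n"
  shows "real (n - Suc x choose (s - Suc x)) * real (n - x) = real (n - x choose (s - x)) * real (s - x)"
proof -
  obtain a b where ab: "s - x = Suc a" "n - x = Suc b" using assms by (metis Suc_diff_Suc less_le_trans)
  then have *: "s - Suc x = a" "n - Suc x = b" by auto
  have "real (Suc b * (b choose a)) = real ((Suc b choose Suc a) * Suc a)"
    by (simp only: Suc_times_binomial_eq)
  then have "real (b choose a) * real (Suc b) = real (Suc b choose Suc a) * real (Suc a)"
    by (simp only: of_nat_mult mult.commute)
  then show ?thesis by (simp only: * ab)
qed

text \<open>The probability that a random \<open>s\<close>-set contains a given \<open>x\<close>-set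
  is a product of factors \<open>(s - i) / (n - i)\<close>, each at most
  \<open>s / n\<close>.\<close>

lemma binomial_diff_le:
  assumes "x \<le> s" "s \<le> n" "0 < n"
  shows "real (n - x choose (s - x)) \<le> (s / n) ^ x * real (n choose s)"
  using assms(1)
proof (induction x)
  case (Suc x)
  then have x: "x < s" "x < n" using assms by auto
  have "real (s - x) / real (n - x) \<le> s / n"
    using x assms by (simp add: of_nat_diff divide_simps) (simp add: algebra_simps mult_right_mono)
  have "real (n - Suc x choose (s - Suc x)) = real (n - x choose (s - x)) * (real (s - x) / real (n - x))"
    using binomial_diff_step[OF x(1) assms(2)] x by (simp add: field_simps)
  also have "\<dots> \<le> ((s / n) ^ x * real (n choose s)) * (s / n)"
  proof (rule mult_mono)
    show "real (n - x choose (s - x)) \<le> (s / n) ^ x * real (n choose s)" using Suc.IH x by simp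
  qed (use \<open>real (s - x) / real (n - x) \<le> s / n\<close> in simp_all)
  finally show ?case by (simp add: mult_ac)
qed simp

text \<open>For pairs the reverse inequality loses only a factor 2, because
  \<open>(s - 1) / (n - 1)\<close> is at least \<open>s / (2 * n)\<close> once \<open>s\<close> is
  at least 2.\<close>

lemma binomial_diff_2_ge:
  assumes "2 \<le> s" "s \<le> n"
  shows "(s / n) ^ 2 / 2 * real (n choose s) \<le> real (n - 2 choose (s - 2))"
proof -
  have 1: "real (n - 1 choose (s - 1)) * real n = real (n choose s) * real s"
    using binomial_diff_step[of 0 s n] assms by simp
  have 2: "real (n - 2 choose (s - 2)) * real (n - 1) = real (n - 1 choose (s - 1)) * real (s - 1)"
    using binomial_diff_step[of 1 s n] assms by (simp add: numeral_2_eq_2)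
  have n: "real (n - 1) = real n - 1" "real (s - 1) = real s - 1" "real n > 1" using assms by (auto simp: of_nat_diff)
  have "real (n - 2 choose (s - 2)) = real (n - 1 choose (s - 1)) * ((real s - 1) / (real n - 1))"
    using 2 n by (simp add: field_simps)
  also have "real (n - 1 choose (s - 1)) = real (n choose s) * (s / n)"
    using 1 n by (simp add: field_simps)
  finally have eq: "real (n - 2 choose (s - 2)) = real (n choose s) * (s / n) * ((real s - 1) / (real n - 1))" .
  have "real n * 2 \<le> real n * real s" using assms by (intro mult_left_mono) auto
  then have "real s * (real n - 1) \<le> 2 * real n * (real s - 1)" by (simp add: algebra_simps)
  then have "s / n / 2 \<le> (real s - 1) / (real n - 1)" using n by (simp add: field_simps)
  then have "real (n choose s) * (s / n) * (s / n / 2) \<le> real (n choose s) * (s / n) * ((real s - 1) / (real n - 1))"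
    by (intro mult_left_mono) auto
  then show ?thesis unfolding eq by (simp add: power2_eq_square mult_ac)
qed

lemma sum_card_contained:
  assumes "finite \<T>" "finite A"
  shows "(\<Sum>S\<in>\<T>. real (card {x \<in> A. f x \<subseteq> S})) = (\<Sum>x\<in>A. real (card {S \<in> \<T>. f x \<subseteq> S}))"
proof -
  have "(\<Sum>S\<in>\<T>. real (card {x \<in> A. f x \<subseteq> S})) = (\<Sum>S\<in>\<T>. \<Sum>x\<in>A. if f x \<subseteq> S then 1 else 0)"
    using assms by (simp add: sum.If_cases Int_def)
  also have "\<dots> = (\<Sum>x\<in>A. \<Sum>S\<in>\<T>. if f x \<subseteq> S then 1 else 0)" by (rule sum.swap)
  also have "\<dots> = (\<Sum>x\<in>A. real (card {S \<in> \<T>. f x \<subseteq> S}))"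
    using assms by (simp add: sum.If_cases Int_def)
  finally show ?thesis .
qed

lemma finite_card_edges:
  assumes "finite V" "E \<subseteq> all_edges V"
  shows "finite E" "card E \<le> card V ^ 2"
proof -
  have "finite (all_edges V)" unfolding all_edges_def using assms(1) by (auto intro: finite_subset[of _ "Pow V"])
  moreover have "card (all_edges V) = card V choose 2"
    unfolding all_edges_def using n_subsets[OF assms(1)] by simp
  moreover have "card V choose 2 \<le> card V ^ 2"
    by (cases "2 \<le> card V") (simp_all add: binomial_le_pow binomial_eq_0)
  ultimately show "finite E" "card E \<le> card V ^ 2"
    using assms(2) card_mono[of "all_edges V" E] finite_subset[of E "all_edges V"] by auto
qed

text \<open>The degree bounds are shaped for containers: divided by the lower bound on
  \<open>card F\<close>, they become \<open>K * \<tau> ^ (card S - 1) / card E\<close>, the spread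
  condition with parameter \<open>\<tau>\<close>.\<close>

theorem balanced_supersaturation:
  fixes l :: nat
  assumes l: "2 \<le> l"
  obtains K C :: real where "0 < K" "1 \<le> C"
    and "\<And>(V::'a set) E (\<tau>::real). finite V \<Longrightarrow> V \<noteq> {} \<Longrightarrow> E \<subseteq> all_edges V \<Longrightarrow> 0 < \<tau> \<Longrightarrow> \<tau> \<le> 1 / 2 \<Longrightarrow>
      C * card V ^ (l + 1) \<le> card E ^ l * \<tau> ^ (l - 1) \<Longrightarrow>
      C * card V ^ (2 * l) \<le> (card E * \<tau>) ^ (2 * l - 1) \<Longrightarrow>
      \<exists>F\<subseteq>cycles (2 * l) E. card E * (1 / \<tau>) ^ (2 * l - 1) / K \<le> card F \<and>
        (\<forall>S. S \<noteq> {} \<longrightarrow> card {D \<in> F. S \<subseteq> D} \<le> (1 / \<tau>) ^ (2 * l - card S))"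
proof -
  \<comment> \<open>\<open>K\<close> makes saturated sets in a sample at most a quarter as frequent
    as the lower bound on its edges; see \<open>sumY\<close>. \<open>C\<close> dominates the
    constants of the two uses of the hypotheses, recorded as \<open>Cl\<close> and
    \<open>C2l\<close>.\<close>
  define K :: real where "K = 2 ^ (4 * l + 4)"
  define C :: real where "C = 2 * (64 * real l ^ 2) ^ (2 * l)"
  have K: "1 \<le> K" by (simp add: K_def)
  have l64: "1 \<le> 64 * real l ^ 2" using l by (simp add: one_le_power mult_le_cancel_left1 order_trans[of 1 64])
  have "1 \<le> (64 * real l ^ 2) ^ (2 * l)" using l64 by (rule one_le_power)
  then have C1: "2 \<le> C" unfolding C_def by linarith
  have Cl: "(64 * real l ^ 2) ^ l \<le> C"
  proof -
    have "(64 * real l ^ 2) ^ l \<le> (64 * real l ^ 2) ^ (2 * l)" using l64 by (intro power_increasing) auto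
    also have "\<dots> \<le> C" unfolding C_def using l64 by simp
    finally show ?thesis .
  qed
  have C2l: "2 * (16 * real l) ^ (2 * l) \<le> C"
  proof -
    have "16 * real l \<le> 64 * real l ^ 2" using l by (simp add: power2_eq_square)
    then show ?thesis unfolding C_def by (intro mult_left_mono power_mono) auto
  qed
  show ?thesis
  proof (rule that[of K C])
    fix V :: "'a set" and E and \<tau> :: real
    assume V: "finite V" "V \<noteq> {}" and E: "E \<subseteq> all_edges V" and \<tau>: "0 < \<tau>" "\<tau> \<le> 1 / 2"
      and c1: "C * card V ^ (l + 1) \<le> card E ^ l * \<tau> ^ (l - 1)"
      and c2: "C * card V ^ (2 * l) \<le> (card E * \<tau>) ^ (2 * l - 1)"
    define n N R where "n = real (card V)" and "N = real (card E)" and "R = 1 / \<tau>"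
    have n1: "1 \<le> n" using V by (simp add: n_def card_gt_0_iff Suc_le_eq)
    have R: "2 \<le> R" "0 < R" using \<tau> by (auto simp: R_def field_simps)
    have finE: "finite E" and Nn: "N \<le> n ^ 2"
      using finite_card_edges[OF V(1) E] by (auto simp: N_def n_def simp flip: of_nat_power)
    let ?cyc = "cycles (2 * l) E"
    have finC: "finite ?cyc" by (rule finite_cycles[OF finE])
    define deg where "deg F S = card {D \<in> F. S \<subseteq> D}" for F :: "'a set set set" and S
    define P where "P F \<longleftrightarrow> F \<subseteq> ?cyc \<and> (\<forall>S. S \<noteq> {} \<longrightarrow> deg F S \<le> R ^ (2 * l - card S))" for F
    have "P {}" using R by (simp add: P_def deg_def)
    moreover have "card F < Suc (card ?cyc)" if "P F" for F
      using that finC by (simp add: P_def card_mono less_Suc_eq_le)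
    ultimately obtain F where PF: "P F" and F_max: "\<And>G. P G \<Longrightarrow> card G \<le> card F"
      using ex_has_greatest_nat[of P "{}" card "Suc (card ?cyc)"] by blast
    have F: "F \<subseteq> ?cyc" using PF by (simp add: P_def)
    have finF: "finite F" using F finC finite_subset by blast
    have card_D: "card D = 2 * l" "card (\<Union> D) = 2 * l" "finite D" if "D \<in> ?cyc" for D
      using card_cycle[OF that] card_Union_cycle[OF that] finite_cycle[OF that] l by simp_all
    have "N * R ^ (2 * l - 1) / K \<le> card F"
    proof (rule ccontr)
      assume "\<not> ?thesis"
      then have small: "card F < N * R ^ (2 * l - 1) / K" by simp
      have N0: "0 < N"
        using le_less_trans[OF of_nat_0_le_iff small] K R by (simp add: zero_less_mult_iff zero_less_divide_iff)
      \<comment> \<open>Saturation is declared at half the bound because degrees are integers and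
        bounds are not: if one more cycle violates a bound of at least 2, the old degree is only
        known to exceed the bound minus 1, hence half of it.\<close>
      define Sat where "Sat = {S \<in> (\<Union>D\<in>F. Pow D). S \<noteq> {} \<and> card S < 2 * l \<and> R ^ (2 * l - card S) \<le> 2 * deg F S}"
      have finU: "finite (\<Union>D\<in>F. Pow D)" using finF F card_D(3) by auto
      have finSat: "finite Sat" using finU by (rule finite_subset[rotated]) (auto simp: Sat_def)
      have new: "\<exists>S\<in>Sat. S \<subseteq> D" if D: "D \<in> ?cyc" "D \<notin> F" for D
      proof -
        have "\<not> P (insert D F)" using F_max[of "insert D F"] finF D(2) by auto
        then obtain S where S: "S \<noteq> {}" "R ^ (2 * l - card S) < deg (insert D F) S"
          using F D(1) unfolding P_def by (auto simp: not_le)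
        have "S \<subseteq> D"
        proof (rule ccontr)
          assume "\<not> S \<subseteq> D"
          then have "{D' \<in> insert D F. S \<subseteq> D'} = {D' \<in> F. S \<subseteq> D'}" by auto
          then have "deg (insert D F) S = deg F S" by (simp add: deg_def)
          then show False using S PF unfolding P_def by (metis not_le)
        qed
        then have "{D' \<in> insert D F. S \<subseteq> D'} = insert D {D' \<in> F. S \<subseteq> D'}" by auto
        then have degS: "real (deg (insert D F) S) = deg F S + 1" using finF D(2) by (simp add: deg_def)
        \<comment> \<open>All cycles have \<open>2 * l\<close> edges, so no member of
          \<open>F\<close> contains \<open>D\<close>. A violation at \<open>S = D\<close> would thus
          mean that degree 1 exceeds \<open>R ^ 0\<close>.\<close>
        have "card S < 2 * l"
        proof (rule ccontr)
          assume "\<not> ?thesis"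
          then have SD: "S = D" using card_seteq[OF card_D(3)[OF D(1)] \<open>S \<subseteq> D\<close>] card_D(1)[OF D(1)] by simp
          have "{D' \<in> F. D \<subseteq> D'} = {}"
          proof (rule ccontr)
            assume "{D' \<in> F. D \<subseteq> D'} \<noteq> {}"
            then obtain D' where D': "D' \<in> F" "D \<subseteq> D'" by blast
            then have "D' \<in> ?cyc" using F by blast
            then have "D = D'"
              using card_subset_eq[OF _ D'(2)] card_D(1)[OF D(1)] card_D(1,3)[of D'] by simp
            then show False using D' D(2) by simp
          qed
          then have "deg F S = 0" unfolding SD deg_def by (metis card.empty)
          then show False using S(2) degS R card_D[OF D(1)] SD by simp
        qed
        have "1 \<le> R ^ (2 * l - card S - 1)" using R by simp
        with R(1) have "2 * 1 \<le> R * R ^ (2 * l - card S - 1)" by (rule mult_mono) (use R in auto)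
        also have "R * R ^ (2 * l - card S - 1) = R ^ (2 * l - card S)"
          using \<open>card S < 2 * l\<close> using power_minus_mult[of "2 * l - card S" R] by (simp add: mult.commute)
        finally have "2 \<le> R ^ (2 * l - card S)" by simp
        then have half: "R ^ (2 * l - card S) \<le> 2 * deg F S" using S(2) degS by linarith
        then have "deg F S \<noteq> 0" using \<open>2 \<le> R ^ (2 * l - card S)\<close> by auto
        then have "{D' \<in> F. S \<subseteq> D'} \<noteq> {}" unfolding deg_def by (metis card.empty)
        then have "S \<in> (\<Union>D\<in>F. Pow D)" by auto
        then have "S \<in> Sat" using S(1) \<open>card S < 2 * l\<close> half by (simp add: Sat_def)
        then show ?thesis using \<open>S \<subseteq> D\<close> by blast
      qed

      define s where "s = nat \<lceil>\<tau> * n\<rceil>"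
      define q where "q = s / n"
      \<comment> \<open>Otherwise \<open>N * \<tau>\<close> is at most \<open>n\<close>, too small
        for the second hypothesis. Rounding \<open>\<tau> * n\<close> up now at most doubles it and
        leaves room for an edge.\<close>
      have \<tau>n: "1 < \<tau> * n"
      proof (rule ccontr)
        assume "\<not> ?thesis"
        then have "\<tau> * n * n \<le> 1 * n" using n1 by (intro mult_right_mono) auto
        moreover have "N * \<tau> \<le> n ^ 2 * \<tau>" using Nn \<tau> by (intro mult_right_mono) auto
        ultimately have "N * \<tau> \<le> n" by (simp add: power2_eq_square mult_ac)
        then have "(N * \<tau>) ^ (2 * l - 1) \<le> n ^ (2 * l - 1)" using N0 \<tau> by (intro power_mono) auto
        also have "\<dots> \<le> n ^ (2 * l)" using n1 by (intro power_increasing) auto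
        also have "\<dots> < C * n ^ (2 * l)" using C1 n1 by simp
        finally show False using c2 by (simp add: n_def N_def)
      qed
      have s_ge: "\<tau> * n \<le> s" and s_le: "s \<le> 2 * (\<tau> * n)" and s2: "2 \<le> s" unfolding s_def using \<tau>n by linarith+
      have sn: "s \<le> card V"
      proof -
        have "\<tau> * n \<le> 1 * n" using \<tau> n1 by (intro mult_right_mono) auto
        then show ?thesis unfolding s_def n_def by (simp add: nat_le_iff ceiling_le_iff)
      qed
      have "real s \<le> n" using sn by (simp add: n_def)
      then have q: "\<tau> \<le> q" "q \<le> 2 * \<tau>" "q \<le> 1" "0 < q"
        using s_ge s_le s2 n1 \<tau> unfolding q_def by (auto simp: field_simps)
      have sq: "real s = q * n" using n1 by (simp add: q_def)
      define \<T> where "\<T> = {S. S \<subseteq> V \<and> card S = s}"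
      have fin\<T>: "finite \<T>" unfolding \<T>_def using V by (auto intro: finite_subset[of _ "Pow V"])
      have card\<T>: "card \<T> = card V choose s" unfolding \<T>_def by (rule n_subsets[OF V(1)])
      have T0: "0 < real (card \<T>)" using sn by (simp add: card\<T> zero_less_binomial)
      have sample_le: "card {S \<in> \<T>. X \<subseteq> S} \<le> q ^ card X * card \<T>" if "X \<subseteq> V" for X
      proof (cases "card X \<le> s")
        case True
        have "card {S \<in> \<T>. X \<subseteq> S} = (card V - card X) choose (s - card X)"
          using card_subsets_containing[OF V(1) that True] unfolding \<T>_def by (simp add: conj_assoc)
        then show ?thesis
          using binomial_diff_le[OF True sn] V by (simp add: card\<T> q_def n_def card_gt_0_iff)
      next
        case False
        have "\<not> X \<subseteq> S" if "S \<in> \<T>" for S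
          using that False card_mono[OF finite_subset[OF _ V(1)], of S X] by (auto simp: \<T>_def)
        then have "{S \<in> \<T>. X \<subseteq> S} = {}" by blast
        then have "card {S \<in> \<T>. X \<subseteq> S} = 0" by (metis card.empty)
        then show ?thesis using q by simp
      qed
      have sample_ge: "q ^ 2 / 2 * card \<T> \<le> card {S \<in> \<T>. e \<subseteq> S}" if "e \<in> E" for e
      proof -
        have e: "e \<subseteq> V" "card e = 2" using that E by (auto simp: all_edges_def)
        have "card {S \<in> \<T>. e \<subseteq> S} = (card V - 2) choose (s - 2)"
          using card_subsets_containing[OF V(1) e(1), of s] e(2) s2 unfolding \<T>_def by (simp add: conj_assoc)
        then show ?thesis using binomial_diff_2_ge[OF s2 sn] by (simp add: card\<T> q_def n_def)
      qed
      have UE: "\<Union> D \<subseteq> V" if "D \<subseteq> E" for D using that E by (auto simp: all_edges_def)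

      \<comment> \<open>Edges, saturated sets and members of \<open>F\<close> inside the sample;
        \<open>id\<close> fits the pattern of \<open>sum_card_contained\<close>.\<close>
      define X where "X S = card {e \<in> E. id e \<subseteq> S}" for S
      define Y where "Y S = card {T \<in> Sat. \<Union> T \<subseteq> S}" for S
      define Z where "Z S = card {D \<in> F. \<Union> D \<subseteq> S}" for S
      have sumX: "N * (q ^ 2 / 2) * card \<T> \<le> (\<Sum>S\<in>\<T>. real (X S))"
      proof -
        have "N * (q ^ 2 / 2) * card \<T> = (\<Sum>e\<in>E. q ^ 2 / 2 * card \<T>)" by (simp add: N_def)
        also have "\<dots> \<le> (\<Sum>e\<in>E. real (card {S \<in> \<T>. id e \<subseteq> S}))" using sample_ge by (intro sum_mono) simp
        finally show ?thesis unfolding X_def sum_card_contained[OF fin\<T> finE] .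
      qed
      have sumY: "(\<Sum>S\<in>\<T>. real (Y S)) \<le> N * (q ^ 2 / 8) * card \<T>"
      proof -
        define c where "c = 2 * 2 ^ (2 * l) * q ^ 2 * \<tau> ^ (2 * l - 1)"
        have c: "0 \<le> c" using \<tau> by (simp add: c_def)
        \<comment> \<open>\<open>T\<close> spans at least \<open>card T + 1\<close> vertices, so the
          sample contains it with probability at most \<open>q\<^sup>2 * q ^ (card T - 1)\<close>.
          Saturation pays a factor \<open>\<tau> ^ (2 * l - card T)\<close> times twice the degree.
          The powers of \<open>\<tau>\<close> combine to an exponent independent of
          \<open>T\<close>, and the degrees can be summed over all subsets of members of
          \<open>F\<close>.\<close>
        have bound: "card {S \<in> \<T>. \<Union> T \<subseteq> S} \<le> c * card \<T> * deg F T" if T: "T \<in> Sat" for T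
        proof -
          obtain D where D: "D \<in> F" "T \<subseteq> D" using T unfolding Sat_def by blast
          have T': "T \<noteq> {}" "card T < 2 * l" "R ^ (2 * l - card T) \<le> 2 * deg F T" using T by (auto simp: Sat_def)
          have Dc: "D \<in> ?cyc" using D F by auto
          then obtain xs where xs: "D = cycle_edges xs" "distinct xs" by (auto elim: cyclesE)
          have "T \<noteq> D" using T'(2) card_D(1)[OF Dc] by auto
          then have "card T < card (\<Union> T)"
            using card_Union_proper_subset_cycle[OF xs(2), of T] D T'(1) xs(1) by auto
          then have "q ^ card (\<Union> T) \<le> q ^ (card T + 1)" using q by (intro power_decreasing) auto
          also have "\<dots> = q ^ 2 * q ^ (card T - 1)"
          proof -
            have "0 < card T" using T'(1) finite_subset[OF D(2) card_D(3)[OF Dc]] by (simp add: card_gt_0_iff)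
            then have "card T + 1 = 2 + (card T - 1)" by simp
            then show ?thesis by (metis power_add)
          qed
          also have "\<dots> \<le> q ^ 2 * (2 * \<tau>) ^ (card T - 1)" using q by (intro mult_left_mono power_mono) auto
          also have "\<dots> \<le> q ^ 2 * (2 ^ (2 * l) * \<tau> ^ (card T - 1))"
            unfolding power_mult_distrib using T'(2) \<tau> by (intro mult_left_mono mult_right_mono power_increasing) auto
          finally have a: "q ^ card (\<Union> T) \<le> q ^ 2 * 2 ^ (2 * l) * \<tau> ^ (card T - 1)" by simp
          have "\<tau> ^ (2 * l - card T) * R ^ (2 * l - card T) = 1"
            using \<tau> by (simp add: R_def flip: power_mult_distrib)
          then have b: "1 \<le> \<tau> ^ (2 * l - card T) * (2 * deg F T)"
            using T'(3) \<tau> mult_left_mono[of "R ^ (2 * l - card T)" "2 * deg F T" "\<tau> ^ (2 * l - card T)"] by simp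
          have "q ^ card (\<Union> T) \<le> (q ^ 2 * 2 ^ (2 * l) * \<tau> ^ (card T - 1)) * (\<tau> ^ (2 * l - card T) * (2 * deg F T))"
            using a mult_left_mono[OF b, of "q ^ 2 * 2 ^ (2 * l) * \<tau> ^ (card T - 1)"] \<tau> by simp
          also have "\<dots> = 2 * 2 ^ (2 * l) * q ^ 2 * (\<tau> ^ (card T - 1) * \<tau> ^ (2 * l - card T)) * deg F T" by simp
          also have "\<tau> ^ (card T - 1) * \<tau> ^ (2 * l - card T) = \<tau> ^ (2 * l - 1)"
          proof -
            have "0 < card T" using T'(1) finite_subset[OF D(2) card_D(3)[OF Dc]] by (simp add: card_gt_0_iff)
            then have "card T - 1 + (2 * l - card T) = 2 * l - 1" using T'(2) by simp
            then show ?thesis by (metis power_add)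
          qed
          finally have "q ^ card (\<Union> T) * card \<T> \<le> c * deg F T * card \<T>"
            unfolding c_def by (intro mult_right_mono) auto
          moreover have "\<Union> T \<subseteq> V" using UE D cycle_subset[OF Dc] by auto
          ultimately show ?thesis using sample_le[of "\<Union> T"] by (simp add: mult_ac)
        qed
        have "(\<Sum>T\<in>Sat. real (card {S \<in> \<T>. \<Union> T \<subseteq> S})) \<le> (\<Sum>T\<in>Sat. c * card \<T> * deg F T)"
          by (intro sum_mono bound)
        also have "\<dots> = c * card \<T> * (\<Sum>T\<in>Sat. real (deg F T))" by (rule sum_distrib_left[symmetric])
        also have "(\<Sum>T\<in>Sat. real (deg F T)) \<le> (\<Sum>T\<in>(\<Union>D\<in>F. Pow D). real (deg F T))"
          using finU by (intro sum_mono2) (auto simp: Sat_def)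
        also have "\<dots> = (\<Sum>D\<in>F. real (card {T \<in> (\<Union>D\<in>F. Pow D). id T \<subseteq> D}))"
          unfolding deg_def using sum_card_contained[OF finF finU, of id] by simp
        also have "\<dots> = (\<Sum>D\<in>F. real (card (Pow D)))"
          by (intro sum.cong refl arg_cong[of _ _ "\<lambda>A. real (card A)"]) auto
        also have "\<dots> = card F * 2 ^ (2 * l)"
          using F card_D by (simp add: card_Pow subset_iff)
        finally have "(\<Sum>T\<in>Sat. real (card {S \<in> \<T>. \<Union> T \<subseteq> S})) \<le> c * card \<T> * (card F * 2 ^ (2 * l))"
          using c by (simp add: mult_left_mono)
        also have "\<dots> \<le> c * card \<T> * (N * R ^ (2 * l - 1) / K * 2 ^ (2 * l))"
          using c mult_right_mono[OF less_imp_le[OF small], of "2 ^ (2 * l)"] by (intro mult_left_mono) auto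
        also have "\<dots> = N * q ^ 2 * card \<T> * (2 * 2 ^ (2 * l) * 2 ^ (2 * l) / K) * (\<tau> ^ (2 * l - 1) * R ^ (2 * l - 1))"
          by (simp add: c_def)
        also have "\<tau> ^ (2 * l - 1) * R ^ (2 * l - 1) = 1"
          using \<tau> by (simp add: R_def flip: power_mult_distrib)
        also have "2 * 2 ^ (2 * l) * 2 ^ (2 * l) / K = 1 / 8"
        proof -
          have "(2::real) ^ (4 * l + 4) = 2 ^ (2 * l) * 2 ^ (2 * l) * 16"
            using power_add[of "2::real" "2 * l" "2 * l + 4"] by (simp add: power_add)
          then show ?thesis by (simp add: K_def)
        qed
        finally have "(\<Sum>T\<in>Sat. real (card {S \<in> \<T>. \<Union> T \<subseteq> S})) \<le> N * (q ^ 2 / 8) * card \<T>" by simp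
        then show ?thesis unfolding Y_def sum_card_contained[OF fin\<T> finSat] .
      qed
      define B where "B = N * R ^ (2 * l - 1) / K * q ^ (2 * l)"
      have B: "0 < B" using N0 R K q by (simp add: B_def)
      have sumZ: "(\<Sum>S\<in>\<T>. real (Z S)) \<le> B * card \<T>"
      proof -
        have "(\<Sum>D\<in>F. real (card {S \<in> \<T>. \<Union> D \<subseteq> S})) \<le> (\<Sum>D\<in>F. q ^ (2 * l) * card \<T>)"
        proof (intro sum_mono)
          fix D assume "D \<in> F"
          then have D: "D \<in> ?cyc" using F by auto
          show "real (card {S \<in> \<T>. \<Union> D \<subseteq> S}) \<le> q ^ (2 * l) * card \<T>"
            using sample_le[OF UE[OF cycle_subset[OF D]]] card_D(2)[OF D] by simp
        qed
        also have "\<dots> = card F * (q ^ (2 * l) * card \<T>)" by simp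
        also have "\<dots> \<le> N * R ^ (2 * l - 1) / K * (q ^ (2 * l) * card \<T>)"
          using q by (intro mult_right_mono less_imp_le[OF small]) auto
        finally show ?thesis unfolding Z_def sum_card_contained[OF fin\<T> finF] by (simp add: B_def)
      qed
      \<comment> \<open>In these units the average of \<open>X\<close> is at least 4, that of
        \<open>Y\<close> at most 1, and that of \<open>1 + Z S / B\<close> at most 2.\<close>
      define \<mu> where "\<mu> = N * (q ^ 2 / 8)"
      have \<mu>: "0 < \<mu>" using N0 q by (simp add: \<mu>_def)
      \<comment> \<open>\<open>B\<close> bounds the average of \<open>Z\<close>, so one linear functional secures both many surviving edges
        and few members of \<open>F\<close> inside the sample\<close>
      have "\<exists>S\<in>\<T>. \<mu> * (1 + Z S / B) \<le> real (X S) - real (Y S)"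
      proof (rule ccontr)
        assume "\<not> ?thesis"
        then have "(\<Sum>S\<in>\<T>. real (X S) - real (Y S)) \<le> (\<Sum>S\<in>\<T>. \<mu> * (1 + Z S / B))"
          by (intro sum_mono) auto
        also have "\<dots> = \<mu> * card \<T> + \<mu> / B * (\<Sum>S\<in>\<T>. real (Z S))"
          by (simp add: algebra_simps sum.distrib sum_distrib_left sum_divide_distrib)
        also have "\<dots> \<le> \<mu> * card \<T> + \<mu> / B * (B * card \<T>)"
          using sumZ \<mu> B by (intro add_left_mono mult_left_mono) auto
        also have "\<dots> = 2 * \<mu> * card \<T>" using B by simp
        finally have "(\<Sum>S\<in>\<T>. real (X S)) - (\<Sum>S\<in>\<T>. real (Y S)) \<le> 2 * \<mu> * card \<T>"
          by (simp add: sum_subtractf)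
        then have "N * (q ^ 2 / 2) * card \<T> - N * (q ^ 2 / 8) * card \<T> \<le> 2 * \<mu> * card \<T>"
          using order_trans[OF diff_mono[OF sumX sumY]] by blast
        moreover have "N * (q ^ 2 / 2) * card \<T> - N * (q ^ 2 / 8) * card \<T> = 3 * \<mu> * card \<T>"
          by (simp add: \<mu>_def algebra_simps)
        moreover have "0 < \<mu> * card \<T>" using \<mu> T0 by simp
        ultimately show False by linarith
      qed
      then obtain S where S: "S \<in> \<T>" "\<mu> * (1 + Z S / B) \<le> real (X S) - real (Y S)" by blast
      have S': "S \<subseteq> V" "card S = s" "finite S" "S \<noteq> {}"
        using S(1) s2 finite_subset[OF _ V(1), of S] by (auto simp: \<T>_def)
      define pick where "pick T = (SOME e. e \<in> T)" for T :: "'a set set"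
      have pick: "pick T \<in> T" if "T \<in> Sat" for T
        using that some_in_eq[of T] by (auto simp: pick_def Sat_def)
      \<comment> \<open>Removing one edge of every saturated set inside the sample destroys all
        cycles outside \<open>F\<close>, since each of them contains a saturated set.\<close>
      define E' where "E' = {e \<in> E. id e \<subseteq> S} - pick ` {T \<in> Sat. \<Union> T \<subseteq> S}"
      have "real (X S) - real (Y S) \<le> card E'"
      proof -
        have "card {e \<in> E. id e \<subseteq> S} - card (pick ` {T \<in> Sat. \<Union> T \<subseteq> S}) \<le> card E'"
          unfolding E'_def using finSat by (intro diff_card_le_card_Diff) auto
        moreover have "card (pick ` {T \<in> Sat. \<Union> T \<subseteq> S}) \<le> Y S"
          unfolding Y_def using finSat by (intro card_image_le) auto
        ultimately show ?thesis unfolding X_def by linarith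
      qed
      with S(2) have E'_ge: "\<mu> * (1 + Z S / B) \<le> card E'" by linarith
      have E'_sub: "E' \<subseteq> all_edges S" "E' \<subseteq> E" using E by (auto simp: E'_def all_edges_def)
      have "cycles (2 * l) E' \<subseteq> {D \<in> F. \<Union> D \<subseteq> S}"
      proof
        fix D assume D: "D \<in> cycles (2 * l) E'"
        have DE': "D \<subseteq> E'" by (rule cycle_subset[OF D])
        have "E' \<subseteq> Pow S" unfolding E'_def by auto
        then have US: "\<Union> D \<subseteq> S" using DE' by blast
        have "D \<in> F"
        proof (rule ccontr)
          assume "D \<notin> F"
          then obtain T where T: "T \<in> Sat" "T \<subseteq> D" using new D cycles_mono[OF E'_sub(2)] by blast
          then have "pick T \<in> E'" using pick DE' by blast
          moreover have "\<Union> T \<subseteq> S" using T(2) US by auto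
          ultimately show False using T(1) by (auto simp: E'_def)
        qed
        then show "D \<in> {D \<in> F. \<Union> D \<subseteq> S}" using US by simp
      qed
      then have Z_ge: "card (cycles (2 * l) E') \<le> Z S"
        unfolding Z_def using finF by (intro card_mono) auto
      define m where "m = N * q / (8 * n)"
      have m: "0 < m" "m * s = \<mu>"
        using N0 q n1 unfolding m_def \<mu>_def sq by (auto simp: power2_eq_square)
      \<comment> \<open>The edge density of \<open>E'\<close> on the sample. It grows with
        \<open>Z S\<close>, so a sample rich in members of \<open>F\<close> also retains more
        edges.\<close>
      define lam where "lam = m * (1 + Z S / B)"
      have zb: "1 \<le> 1 + Z S / B" using B by simp
      have lam: "m \<le> lam" "0 < lam"
        using m zb by (auto simp: lam_def intro: less_le_trans)
      have "real s \<le> (m / (8 * real l ^ 2)) ^ l"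
      proof -
        have "(64 * real l ^ 2) ^ l * n ^ (l + 1) \<le> C * n ^ (l + 1)"
          using Cl n1 by (intro mult_right_mono) auto
        also have "\<dots> \<le> N ^ l * \<tau> ^ (l - 1)" using c1 by (simp add: n_def N_def)
        also have "\<dots> \<le> N ^ l * q ^ (l - 1)" using q \<tau> N0 by (intro mult_left_mono power_mono) auto
        finally have "(64 * real l ^ 2) ^ l * n ^ (l + 1) * q \<le> N ^ l * q ^ (l - 1) * q"
          using q by (intro mult_right_mono) auto
        also have "N ^ l * q ^ (l - 1) * q = N ^ l * q ^ l"
          using l power_minus_mult[of l q] by (simp add: mult.assoc)
        finally have "(q * n) * (64 * real l ^ 2 * n) ^ l \<le> (N * q) ^ l"
          by (simp add: power_mult_distrib mult_ac)
        moreover have "0 < (64 * real l ^ 2 * n) ^ l" using l n1 by simp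
        ultimately have "q * n \<le> (N * q) ^ l / (64 * real l ^ 2 * n) ^ l" by (simp add: pos_le_divide_eq)
        also have "\<dots> = (m / (8 * real l ^ 2)) ^ l"
          unfolding m_def power_divide[symmetric] by (simp add: mult_ac)
        finally show ?thesis unfolding sq .
      qed
      also have "\<dots> \<le> (lam / (8 * real l ^ 2)) ^ l"
        using lam m by (intro power_mono divide_right_mono) auto
      finally have s_lam: "real (card S) \<le> (lam / (8 * real l ^ 2)) ^ l" by (simp add: S')
      have "lam ^ (2 * l) \<le> 2 * (2 * l) ^ (2 * l) * card (cycles (2 * l) E')"
      proof (rule cycle_supersaturation[OF S'(3,4) E'_sub(1) _ _ s_lam])
        have "lam * card S = \<mu> * (1 + Z S / B)" using m(2) by (simp add: lam_def S' mult_ac)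
        then show "lam * card S \<le> card E'" using E'_ge by simp
      qed (use l lam in auto)
      also have "real (2 * (2 * l) ^ (2 * l) * card (cycles (2 * l) E')) \<le> real (2 * (2 * l) ^ (2 * l) * Z S)"
        using Z_ge by (intro of_nat_mono mult_left_mono) auto
      finally have up: "lam ^ (2 * l) \<le> 2 * (2 * l) ^ (2 * l) * Z S" .
      \<comment> \<open>The second hypothesis in use: even at density \<open>m\<close>,
        supersaturation yields more cycles than the average bound \<open>B\<close> allows.\<close>
      have mB: "2 * (2 * real l) ^ (2 * l) * B \<le> m ^ (2 * l)"
      proof -
        have "2 * (16 * real l) ^ (2 * l) * n ^ (2 * l) \<le> C * n ^ (2 * l)"
          using C2l n1 by (intro mult_right_mono) auto
        also have "\<dots> \<le> (N * \<tau>) ^ (2 * l - 1)" using c2 by (simp add: n_def N_def)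
        also have "\<dots> \<le> K * (N * \<tau>) ^ (2 * l - 1)" using K N0 \<tau> by simp
        finally have "2 * (16 * real l * n) ^ (2 * l) \<le> K * (N * \<tau>) ^ (2 * l - 1)"
          by (simp add: power_mult_distrib mult_ac)
        then have "2 * (16 * real l * n) ^ (2 * l) * (N * R ^ (2 * l - 1) / K * q ^ (2 * l))
            \<le> K * (N * \<tau>) ^ (2 * l - 1) * (N * R ^ (2 * l - 1) / K * q ^ (2 * l))"
          using N0 R K q by (intro mult_right_mono) auto
        also have "\<dots> = (N * N ^ (2 * l - 1)) * (\<tau> ^ (2 * l - 1) * R ^ (2 * l - 1)) * q ^ (2 * l)"
          using K by (simp add: power_mult_distrib)
        also have "\<tau> ^ (2 * l - 1) * R ^ (2 * l - 1) = 1"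
          using \<tau> by (simp add: R_def flip: power_mult_distrib)
        also have "N * N ^ (2 * l - 1) = N ^ (2 * l)" using l power_minus_mult[of "2 * l" N] by (simp add: mult.commute)
        finally have le: "2 * (16 * real l * n) ^ (2 * l) * B \<le> (N * q) ^ (2 * l)"
          by (simp add: B_def power_mult_distrib)
        have "16 * real l * n = 2 * real l * (8 * n)" by simp
        then have "2 * (2 * real l) ^ (2 * l) * B * (8 * n) ^ (2 * l)
            = 2 * (16 * real l * n) ^ (2 * l) * B"
          by (simp only: power_mult_distrib mult_ac)
        also note le
        finally have "2 * (2 * real l) ^ (2 * l) * B \<le> (N * q) ^ (2 * l) / (8 * n) ^ (2 * l)"
          using n1 by (subst pos_le_divide_eq) auto
        then show ?thesis unfolding m_def power_divide .
      qed
      \<comment> \<open>Supersaturation forces at least \<open>B + Z S\<close> cycles in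
        \<open>E'\<close>, because a power of \<open>1 + Z S / B\<close> is at least its base. But
        only \<open>Z S\<close> are available and \<open>B\<close> is positive.\<close>
      have "2 * (2 * real l) ^ (2 * l) * (B + Z S) = 2 * (2 * real l) ^ (2 * l) * B * (1 + Z S / B)"
        using B by (simp add: field_simps)
      also have "\<dots> \<le> m ^ (2 * l) * (1 + Z S / B)" using mB zb by (intro mult_right_mono) auto
      also have "\<dots> \<le> m ^ (2 * l) * (1 + Z S / B) ^ (2 * l)"
        using zb m l by (intro mult_left_mono self_le_power) auto
      also have "\<dots> = lam ^ (2 * l)" by (simp add: lam_def power_mult_distrib)
      also have "\<dots> \<le> 2 * (2 * real l) ^ (2 * l) * Z S" using up by simp
      finally have "2 * (2 * real l) ^ (2 * l) * B \<le> 0" by (simp add: algebra_simps)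
      moreover have "0 < 2 * (2 * real l) ^ (2 * l) * B" using B l by simp
      ultimately show False by linarith
    qed
    then show "\<exists>F\<subseteq>cycles (2 * l) E. card E * (1 / \<tau>) ^ (2 * l - 1) / K \<le> card F \<and>
        (\<forall>S. S \<noteq> {} \<longrightarrow> card {D \<in> F. S \<subseteq> D} \<le> (1 / \<tau>) ^ (2 * l - card S))"
      using PF unfolding P_def deg_def N_def R_def by blast
  qed (use K C1 in auto)
qed

subsection \<open>Containers for spread hypergraphs\<close>

text \<open>Hypergraphs are weight functions because links of different vertices are added up and
  the same set may occur in several of them. \<open>wdeg V w {}\<close> is the total weight.\<close>

definition wdeg :: "'a set \<Rightarrow> ('a set \<Rightarrow> real) \<Rightarrow> 'a set \<Rightarrow> real" where
  "wdeg V w S = (\<Sum>e | e \<subseteq> V \<and> S \<subseteq> e. w e)"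

lemma wdeg_nonneg: "(\<And>e. 0 \<le> w e) \<Longrightarrow> 0 \<le> wdeg V w S"
  by (simp add: wdeg_def sum_nonneg)

lemma wdeg_mono: "(\<And>e. u e \<le> w e) \<Longrightarrow> wdeg V u S \<le> wdeg V w S"
  by (simp add: wdeg_def sum_mono)

lemma wdeg_add: "wdeg V (\<lambda>e. u e + w e) S = wdeg V u S + wdeg V w S"
  by (simp add: wdeg_def sum.distrib)

lemma wdeg_scale: "wdeg V (\<lambda>e. c * w e) S = c * wdeg V w S"
  by (simp add: wdeg_def sum_distrib_left)

lemma wdeg_link:
  assumes "finite V" "v \<in> V"
  shows "wdeg V (\<lambda>f. if v \<in> f then 0 else w (insert v f)) S
           = (if v \<in> S then 0 else wdeg V w (insert v S))"
proof (cases "v \<in> S")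
  case True
  then show ?thesis unfolding wdeg_def by (auto intro!: sum.neutral)
next
  case False
  have "(\<Sum>e | e \<subseteq> V \<and> insert v S \<subseteq> e. w e)
          = (\<Sum>f | f \<subseteq> V \<and> S \<subseteq> f \<and> v \<notin> f. w (insert v f))"
    by (rule sum.reindex_bij_witness[where i="\<lambda>f. insert v f" and j="\<lambda>e. e - {v}"])
      (use False assms in \<open>auto simp: insert_absorb\<close>)
  also have "\<dots> = (\<Sum>f | f \<subseteq> V \<and> S \<subseteq> f. if v \<in> f then 0 else w (insert v f))"
    using assms by (intro sum.mono_neutral_cong_left) auto
  finally show ?thesis using False by (simp add: wdeg_def)
qed

lemma sum_wdeg_le:
  assumes "finite V" "\<And>e. 0 \<le> w e" "\<And>e. w e \<noteq> 0 \<Longrightarrow> card e \<le> r"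
  shows "(\<Sum>S\<in>Pow V. wdeg V w S) \<le> 2 ^ r * wdeg V w {}"
proof -
  have "(\<Sum>S\<in>Pow V. wdeg V w S) = (\<Sum>S\<in>Pow V. \<Sum>e\<in>Pow V. if S \<subseteq> e then w e else 0)"
    unfolding wdeg_def using assms(1)
    by (intro sum.cong refl sum.mono_neutral_cong_left) auto
  also have "\<dots> = (\<Sum>e\<in>Pow V. \<Sum>S\<in>Pow V. if S \<subseteq> e then w e else 0)"
    by (rule sum.swap)
  also have "\<dots> = (\<Sum>e\<in>Pow V. \<Sum>S\<in>Pow e. w e)"
    using assms(1) by (intro sum.cong refl sum.mono_neutral_cong_right) auto
  also have "\<dots> \<le> (\<Sum>e\<in>Pow V. 2 ^ r * w e)"
  proof (intro sum_mono)
    fix e assume "e \<in> Pow V"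
    then have "finite e" using assms(1) finite_subset by auto
    then show "(\<Sum>S\<in>Pow e. w e) \<le> 2 ^ r * w e"
      using assms(2)[of e] assms(3)[of e]
      by (cases "w e = 0") (auto simp: card_Pow intro!: mult_right_mono power_increasing)
  qed
  also have "\<dots> = 2 ^ r * wdeg V w {}"
    by (simp add: wdeg_def sum_distrib_left Pow_def)
  finally show ?thesis .
qed

lemma sum_wdeg_singleton_ge:
  assumes "finite V" "\<And>e. 0 \<le> w e" "\<And>e. w e \<noteq> 0 \<Longrightarrow> e \<noteq> {}"
  shows "wdeg V w {} \<le> (\<Sum>x\<in>V. wdeg V w {x})"
proof -
  have "wdeg V w {} = (\<Sum>e\<in>Pow V. w e)" by (simp add: wdeg_def Pow_def)
  also have "\<dots> \<le> (\<Sum>e\<in>Pow V. \<Sum>x\<in>V. if x \<in> e then w e else 0)"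
  proof (intro sum_mono)
    fix e assume e: "e \<in> Pow V"
    show "w e \<le> (\<Sum>x\<in>V. if x \<in> e then w e else 0)"
    proof (cases "w e = 0")
      case False
      then obtain x where "x \<in> e" using assms(3) by blast
      then have "w e \<le> (\<Sum>x\<in>{x}. if x \<in> e then w e else 0)" by simp
      also have "\<dots> \<le> (\<Sum>x\<in>V. if x \<in> e then w e else 0)"
        using \<open>x \<in> e\<close> e assms by (intro sum_mono2) auto
      finally show ?thesis .
    qed (simp add: sum_nonneg assms)
  qed
  also have "\<dots> = (\<Sum>x\<in>V. \<Sum>e\<in>Pow V. if x \<in> e then w e else 0)"
    by (rule sum.swap)
  also have "\<dots> = (\<Sum>x\<in>V. wdeg V w {x})"
    unfolding wdeg_def using assms(1)
    by (intro sum.cong refl sum.mono_neutral_cong_right) auto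
  finally show ?thesis .
qed

text \<open>What later picks may still use: \<open>vs\<close> are the vertices already picked,
  \<open>u\<close> is the sum of the links gathered so far, and \<open>cap\<close> is the level at
  which a set counts as saturated in \<open>u\<close>.\<close>

definition residue_weight ::
    "'a set \<Rightarrow> (nat \<Rightarrow> real) \<Rightarrow> ('a set \<Rightarrow> real) \<Rightarrow> 'a list \<Rightarrow> ('a set \<Rightarrow> real) \<Rightarrow> 'a set \<Rightarrow> real" where
  "residue_weight V cap w vs u e =
     (if e \<inter> set vs \<noteq> {} \<or> (\<exists>S\<subseteq>e. S \<noteq> {} \<and> cap (card S) \<le> wdeg V u S) then 0 else w e)"

text \<open>The head of the list is the vertex that was picked last.\<close>

primrec link_weight ::
    "'a set \<Rightarrow> (nat \<Rightarrow> real) \<Rightarrow> ('a set \<Rightarrow> real) \<Rightarrow> 'a list \<Rightarrow> 'a set \<Rightarrow> real" where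
  "link_weight V cap w [] = (\<lambda>f. 0)"
| "link_weight V cap w (v # vs) =
     (\<lambda>f. link_weight V cap w vs f +
       (if v \<in> f then 0 else residue_weight V cap w vs (link_weight V cap w vs) (insert v f)))"

abbreviation remaining_weight ::
    "'a set \<Rightarrow> (nat \<Rightarrow> real) \<Rightarrow> ('a set \<Rightarrow> real) \<Rightarrow> 'a list \<Rightarrow> 'a set \<Rightarrow> real" where
  "remaining_weight V cap w vs \<equiv> residue_weight V cap w vs (link_weight V cap w vs)"

context
  fixes V :: "'a set" and cap :: "nat \<Rightarrow> real" and w :: "'a set \<Rightarrow> real"
  assumes finV: "finite V" and w_nonneg: "\<And>e. 0 \<le> w e"
begin

lemma residue_weight_nonneg: "0 \<le> residue_weight V cap w vs u e"
  and residue_weight_le: "residue_weight V cap w vs u e \<le> w e"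
  using w_nonneg by (auto simp: residue_weight_def)

lemma link_weight_nonneg: "0 \<le> link_weight V cap w vs f"
  by (induction vs arbitrary: f) (auto simp: residue_weight_nonneg)

lemma remaining_weight_Cons_le:
  "remaining_weight V cap w (v # vs) e \<le> remaining_weight V cap w vs e"
proof -
  have "wdeg V (link_weight V cap w vs) S \<le> wdeg V (link_weight V cap w (v # vs)) S" for S
    by (rule wdeg_mono) (simp add: residue_weight_nonneg)
  then have sat: "cap (card S) \<le> wdeg V (link_weight V cap w (v # vs)) S"
    if "cap (card S) \<le> wdeg V (link_weight V cap w vs) S" for S
    using that order_trans by blast
  show ?thesis
  proof (cases "remaining_weight V cap w (v # vs) e = 0")
    case True
    then show ?thesis by (simp add: residue_weight_nonneg)
  next
    case False
    then have "e \<inter> set (v # vs) = {}"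
      "\<not> (\<exists>S\<subseteq>e. S \<noteq> {} \<and> cap (card S) \<le> wdeg V (link_weight V cap w (v # vs)) S)"
      unfolding residue_weight_def by metis+
    then have "e \<inter> set vs = {}"
      "\<not> (\<exists>S\<subseteq>e. S \<noteq> {} \<and> cap (card S) \<le> wdeg V (link_weight V cap w vs) S)"
      using sat by auto
    then have "remaining_weight V cap w vs e = w e"
      unfolding residue_weight_def by metis
    then show ?thesis using residue_weight_le by simp
  qed
qed

lemma wdeg_link_weight_Cons:
  assumes "v \<in> V"
  shows "wdeg V (link_weight V cap w (v # vs)) S = wdeg V (link_weight V cap w vs) S
     + (if v \<in> S then 0 else wdeg V (remaining_weight V cap w vs) (insert v S))"
  by (simp add: wdeg_add wdeg_link[OF finV assms])

lemma wdeg_link_weight_total_le: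
  assumes "\<And>v. v \<in> V \<Longrightarrow> wdeg V w {v} \<le> d" "set vs \<subseteq> V"
  shows "wdeg V (link_weight V cap w vs) {} \<le> real (length vs) * d"
  using assms(2)
proof (induction vs)
  case Nil
  then show ?case by (simp add: wdeg_def)
next
  case (Cons v vs)
  have "wdeg V (remaining_weight V cap w vs) {v} \<le> d"
    using wdeg_mono[of "remaining_weight V cap w vs" w V "{v}"] residue_weight_le assms(1)[of v] Cons.prems
    by fastforce
  then show ?case
    using Cons wdeg_link_weight_Cons[of v vs "{}"] by (simp add: algebra_simps)
qed

text \<open>A set that has reached its cap receives nothing more, so it overshoots by at most the
  contribution \<open>b\<close> of one pick.\<close>

lemma wdeg_link_weight_le:
  assumes "\<And>S v. S \<noteq> {} \<Longrightarrow> v \<notin> S \<Longrightarrow> v \<in> V \<Longrightarrow> wdeg V w (insert v S) \<le> b (card S)"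
    and "\<And>j. 0 \<le> b j" "\<And>j. 0 \<le> cap j" "set vs \<subseteq> V" "S \<noteq> {}"
  shows "wdeg V (link_weight V cap w vs) S \<le> cap (card S) + b (card S)"
  using assms(4)
proof (induction vs)
  case Nil
  then show ?case using assms(2,3) by (simp add: wdeg_def)
next
  case (Cons v vs)
  show ?case
  proof (cases "v \<in> S")
    case True
    then show ?thesis using Cons wdeg_link_weight_Cons[of v vs S] by simp
  next
    case False
    show ?thesis
    proof (cases "cap (card S) \<le> wdeg V (link_weight V cap w vs) S")
      case True
      then have "residue_weight V cap w vs (link_weight V cap w vs) e = 0" if "insert v S \<subseteq> e" for e
        using that assms(5) unfolding residue_weight_def by auto
      then have "wdeg V (remaining_weight V cap w vs) (insert v S) = 0"
        unfolding wdeg_def by (intro sum.neutral) auto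
      then show ?thesis using Cons wdeg_link_weight_Cons[of v vs S] by simp
    next
      case sat: False
      have "wdeg V (remaining_weight V cap w vs) (insert v S) \<le> b (card S)"
        using wdeg_mono[of "remaining_weight V cap w vs" w V "insert v S"] residue_weight_le
          assms(1)[of S v] assms(5) False Cons.prems by fastforce
      then show ?thesis using sat False Cons wdeg_link_weight_Cons[of v vs S] by simp
    qed
  qed
qed

text \<open>Hence the links have uniformity one less, and an independent set that contains all picks
  is independent for the links as well.\<close>

lemma link_weight_support:
  assumes "link_weight V cap w vs f \<noteq> 0"
  shows "\<exists>v\<in>set vs. v \<notin> f \<and> w (insert v f) \<noteq> 0"
  using assms
proof (induction vs)
  case (Cons v vs)
  show ?case
  proof (cases "link_weight V cap w vs f = 0")
    case True
    then have "v \<notin> f \<and> remaining_weight V cap w vs (insert v f) \<noteq> 0"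
      using Cons.prems by (auto split: if_splits)
    then show ?thesis by (auto simp: residue_weight_def split: if_splits)
  qed (use Cons in auto)
qed simp

text \<open>Each pick has maximum remaining degree in \<open>I\<close> and adds that degree to the
  total link weight, while remaining degrees only fall. So every vertex of \<open>I\<close> ends
  with at most the average contribution. Picks may repeat, so \<open>t\<close> may exceed the size
  of \<open>I\<close>.\<close>

lemma greedy_list:
  assumes "I \<subseteq> V" "I \<noteq> {}"
  shows "\<exists>vs. length vs = t \<and> set vs \<subseteq> I \<and>
     (\<forall>x\<in>I. real t * wdeg V (remaining_weight V cap w vs) {x} \<le> wdeg V (link_weight V cap w vs) {})"
proof (induction t)
  case 0
  then show ?case by (auto simp: wdeg_def)
next
  case (Suc t)
  then obtain vs where vs: "length vs = t" "set vs \<subseteq> I"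
    "\<And>x. x \<in> I \<Longrightarrow> real t * wdeg V (remaining_weight V cap w vs) {x} \<le> wdeg V (link_weight V cap w vs) {}"
    by blast
  let ?d = "\<lambda>x. wdeg V (remaining_weight V cap w vs) {x}"
  have finI: "finite I" using assms(1) finV finite_subset by blast
  obtain v where v: "v \<in> I" "\<And>x. x \<in> I \<Longrightarrow> ?d x \<le> ?d v"
    using Max_in[of "?d ` I"] Max_ge[of "?d ` I"] finI assms(2) by fastforce
  have "real (Suc t) * wdeg V (remaining_weight V cap w (v # vs)) {x}
          \<le> wdeg V (link_weight V cap w (v # vs)) {}" if "x \<in> I" for x
  proof -
    have "wdeg V (remaining_weight V cap w (v # vs)) {x} \<le> ?d x"
      by (intro wdeg_mono remaining_weight_Cons_le)
    then have "real (Suc t) * wdeg V (remaining_weight V cap w (v # vs)) {x} \<le> real (Suc t) * ?d v"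
      using v(2)[OF that] by (intro mult_left_mono) auto
    also have "\<dots> = real t * ?d v + ?d v" by (simp add: algebra_simps)
    also have "\<dots> \<le> wdeg V (link_weight V cap w (v # vs)) {}"
      using vs(3)[OF v(1)] v(1) assms(1) wdeg_link_weight_Cons[of v vs "{}"] by auto
    finally show ?thesis .
  qed
  then show ?case using vs v by (intro exI[of _ "v # vs"]) auto
qed

text \<open>Edges through picked vertices account for the first loss. For edges through saturated
  sets, the weight through such a set is at most \<open>c\<close> times its weight in the links, and
  an edge of the links has at most \<open>2 ^ r\<close> subsets.\<close>

lemma wdeg_remaining_ge:
  assumes "set vs \<subseteq> V"
    and "\<And>v. v \<in> V \<Longrightarrow> wdeg V w {v} \<le> d"
    and "\<And>S. S \<noteq> {} \<Longrightarrow> S \<subseteq> V \<Longrightarrow> wdeg V w S \<le> c * cap (card S)"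
    and "\<And>j. 0 \<le> cap j" "0 \<le> c"
    and "\<And>e. w e \<noteq> 0 \<Longrightarrow> card e \<le> Suc r" "\<And>e. w e \<noteq> 0 \<Longrightarrow> finite e"
  shows "wdeg V w {} - real (length vs) * d - c * 2 ^ r * (real (length vs) * d)
      \<le> wdeg V (remaining_weight V cap w vs) {}"
proof -
  define u where "u = link_weight V cap w vs"
  define Q where "Q = {S. S \<noteq> {} \<and> S \<subseteq> V \<and> cap (card S) \<le> wdeg V u S}"
  have finQ: "finite Q" unfolding Q_def using finV by (auto intro: finite_subset[of _ "Pow V"])
  have u_nonneg: "0 \<le> u e" for e unfolding u_def by (rule link_weight_nonneg)
  have u_card: "card f \<le> r" if "u f \<noteq> 0" for f
  proof -
    from link_weight_support[OF that[unfolded u_def]]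
    obtain v where "v \<notin> f" "w (insert v f) \<noteq> 0" by blast
    then show ?thesis using assms(6)[of "insert v f"] assms(7)[of "insert v f"] by simp
  qed
  define f1 where "f1 e = (\<Sum>v\<in>set vs. if {v} \<subseteq> e then w e else 0)" for e
  define f2 where "f2 e = (\<Sum>S\<in>Q. if S \<subseteq> e then w e else 0)" for e
  have pt: "w e \<le> residue_weight V cap w vs u e + f1 e + f2 e" if "e \<subseteq> V" for e
  proof -
    have nn: "0 \<le> f1 e" "0 \<le> f2 e"
      unfolding f1_def f2_def by (auto intro!: sum_nonneg w_nonneg)
    have r0: "0 \<le> residue_weight V cap w vs u e" by (rule residue_weight_nonneg)
    show ?thesis
    proof (cases "e \<inter> set vs = {}")
      case False
      then obtain v where v: "v \<in> e" "v \<in> set vs" by blast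
      have "(\<Sum>x\<in>{v}. if {x} \<subseteq> e then w e else 0) \<le> f1 e"
        unfolding f1_def using v w_nonneg by (intro sum_mono2) auto
      then have "w e \<le> f1 e" using v by simp
      then show ?thesis using nn r0 by linarith
    next
      case disj: True
      show ?thesis
      proof (cases "\<exists>S\<subseteq>e. S \<noteq> {} \<and> cap (card S) \<le> wdeg V u S")
        case True
        then obtain S where S: "S \<subseteq> e" "S \<in> Q" unfolding Q_def using \<open>e \<subseteq> V\<close> by blast
        have "(\<Sum>x\<in>{S}. if x \<subseteq> e then w e else 0) \<le> f2 e"
          unfolding f2_def using S w_nonneg finQ by (intro sum_mono2) auto
        then have "w e \<le> f2 e" using S by simp
        then show ?thesis using nn r0 by linarith
      next
        case False
        then have "residue_weight V cap w vs u e = w e"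
          using disj unfolding residue_weight_def by metis
        then show ?thesis using nn by linarith
      qed
    qed
  qed
  have swap: "(\<Sum>e\<in>Pow V. \<Sum>S\<in>A. if S \<subseteq> e then w e else 0) = (\<Sum>S\<in>A. wdeg V w S)" for A
  proof -
    have "(\<Sum>e\<in>Pow V. \<Sum>S\<in>A. if S \<subseteq> e then w e else 0) = (\<Sum>S\<in>A. \<Sum>e\<in>Pow V. if S \<subseteq> e then w e else 0)"
      by (rule sum.swap)
    also have "\<dots> = (\<Sum>S\<in>A. wdeg V w S)"
      unfolding wdeg_def using finV
      by (intro sum.cong refl sum.mono_neutral_cong_right) auto
    finally show ?thesis .
  qed
  have "wdeg V w {} = (\<Sum>e\<in>Pow V. w e)" by (simp add: wdeg_def Pow_def)
  also have "\<dots> \<le> (\<Sum>e\<in>Pow V. residue_weight V cap w vs u e + f1 e + f2 e)"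
    by (intro sum_mono pt) auto
  also have "\<dots> = wdeg V (residue_weight V cap w vs u) {} + (\<Sum>e\<in>Pow V. f1 e) + (\<Sum>e\<in>Pow V. f2 e)"
    by (simp add: sum.distrib wdeg_def Pow_def)
  also have "(\<Sum>e\<in>Pow V. f1 e) = (\<Sum>v\<in>set vs. wdeg V w {v})"
    using swap[of "(\<lambda>v. {v}) ` set vs"] by (simp add: f1_def sum.reindex)
  also have "(\<Sum>e\<in>Pow V. f2 e) = (\<Sum>S\<in>Q. wdeg V w S)"
    unfolding f2_def by (rule swap)
  finally have *: "wdeg V w {} \<le> wdeg V (residue_weight V cap w vs u) {}
      + (\<Sum>v\<in>set vs. wdeg V w {v}) + (\<Sum>S\<in>Q. wdeg V w S)" .
  have d: "0 \<le> d" if "vs \<noteq> []"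
    using assms(1) assms(2)[of "hd vs"] wdeg_nonneg[of w V "{hd vs}"] w_nonneg that
    by (cases vs) auto
  have "(\<Sum>v\<in>set vs. wdeg V w {v}) \<le> (\<Sum>v\<in>set vs. d)"
    using assms(1,2) by (intro sum_mono) auto
  also have "\<dots> \<le> real (length vs) * d"
    using d by (cases "vs = []") (auto intro!: mult_right_mono simp: card_length)
  finally have **: "(\<Sum>v\<in>set vs. wdeg V w {v}) \<le> real (length vs) * d" .
  have "(\<Sum>S\<in>Q. wdeg V w S) \<le> (\<Sum>S\<in>Q. c * wdeg V u S)"
  proof (intro sum_mono)
    fix S assume "S \<in> Q"
    then show "wdeg V w S \<le> c * wdeg V u S"
      using assms(3)[of S] assms(5) mult_left_mono[of "cap (card S)" "wdeg V u S" c]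
      unfolding Q_def by fastforce
  qed
  also have "\<dots> \<le> (\<Sum>S\<in>Pow V. c * wdeg V u S)"
    using finV assms(5) u_nonneg by (intro sum_mono2) (auto simp: Q_def wdeg_nonneg)
  also have "\<dots> \<le> c * (2 ^ r * wdeg V u {})"
    unfolding sum_distrib_left[symmetric] using assms(5) finV u_nonneg u_card
    by (intro mult_left_mono sum_wdeg_le) auto
  also have "\<dots> \<le> c * (2 ^ r * (real (length vs) * d))"
    unfolding u_def using assms(1,2,5)
    by (intro mult_left_mono wdeg_link_weight_total_le) auto
  finally show ?thesis using * ** unfolding u_def by (simp add: algebra_simps)
qed

end


section \<open>Induction on the uniformity\<close>

lemma wdeg_infinite: "finite V \<Longrightarrow> infinite S \<Longrightarrow> wdeg V w S = 0"
  unfolding wdeg_def by (rule sum.neutral) (auto dest: finite_subset)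

lemma wdeg_pos_witness:
  assumes "wdeg V w S > 0"
  obtains e where "w e \<noteq> 0" "S \<subseteq> e" "e \<subseteq> V"
proof -
  have "\<exists>e\<in>{e. e \<subseteq> V \<and> S \<subseteq> e}. w e \<noteq> 0"
    using assms unfolding wdeg_def by (metis (no_types, lifting) less_irrefl sum.neutral)
  then show ?thesis using that by blast
qed

text \<open>Markov's inequality reversed: values capped at \<open>K / card V\<close> cannot reach
  the sum \<open>a\<close> if too many of them are at most \<open>b\<close>.\<close>

lemma card_low_value_le:
  fixes f :: "'a \<Rightarrow> real" and a b K :: real
  assumes "finite V" "V \<noteq> {}" "0 < K" "0 \<le> b" "a \<le> (\<Sum>x\<in>V. f x)"
    and "\<And>x. x \<in> V \<Longrightarrow> f x \<le> K / card V"
  shows "card {x \<in> V. f x \<le> b} \<le> (1 - (a - b * card V) / K) * card V"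
proof -
  let ?L = "{x \<in> V. f x \<le> b}" and ?N = "real (card V)"
  have N: "?N > 0" using assms by (simp add: card_gt_0_iff)
  have "a \<le> (\<Sum>x\<in>V. f x)" by fact
  also have "\<dots> = (\<Sum>x\<in>?L. f x) + (\<Sum>x\<in>V - ?L. f x)"
    using assms(1) by (subst add.commute, intro sum.subset_diff) auto
  also have "(\<Sum>x\<in>?L. f x) \<le> (\<Sum>x\<in>?L. b)" by (intro sum_mono) auto
  also have "(\<Sum>x\<in>?L. b) \<le> ?N * b"
    using assms(1,4) by (auto intro!: mult_right_mono card_mono)
  also have "(\<Sum>x\<in>V - ?L. f x) \<le> (\<Sum>x\<in>V - ?L. K / ?N)"
    using assms(6) by (intro sum_mono) auto
  also have "(\<Sum>x\<in>V - ?L. K / ?N) = (?N - card ?L) * (K / ?N)"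
    using assms(1) by (simp add: card_Diff_subset card_mono of_nat_diff)
  finally have "a \<le> ?N * b + (?N - card ?L) * (K / ?N)" by simp
  then have "(a - ?N * b) * ?N / K \<le> ?N - card ?L"
    using N assms(3) by (simp add: field_simps)
  then show ?thesis by (simp add: field_simps)
qed

text \<open>The usual codegree condition for containers, normalised so that an average vertex degree
  has order \<open>1 / card V\<close> and each further vertex of \<open>S\<close> gains a factor
  \<open>\<tau>\<close>.\<close>

definition spread_weight :: "'a set \<Rightarrow> nat \<Rightarrow> real \<Rightarrow> real \<Rightarrow> ('a set \<Rightarrow> real) \<Rightarrow> bool" where
  "spread_weight V r K \<tau> w \<longleftrightarrow>
     (\<forall>e. 0 \<le> w e) \<and> (\<forall>e. w e \<noteq> 0 \<longrightarrow> e \<subseteq> V \<and> card e = r) \<and> 1 \<le> wdeg V w {} \<and>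
     (\<forall>S. S \<noteq> {} \<longrightarrow> wdeg V w S \<le> K * \<tau> ^ (card S - 1) / card V)"

text \<open>The empty set is left out because the greedy picks have to come from
  \<open>I\<close>.\<close>

definition covers_independent :: "'a set \<Rightarrow> ('a set \<Rightarrow> real) \<Rightarrow> 'a set set \<Rightarrow> bool" where
  "covers_independent V w \<C> \<longleftrightarrow>
     (\<forall>I\<subseteq>V. I \<noteq> {} \<longrightarrow> (\<forall>e. w e \<noteq> 0 \<longrightarrow> \<not> e \<subseteq> I) \<longrightarrow> (\<exists>C\<in>\<C>. I \<subseteq> C))"

text \<open>Each level of the induction chooses one list of \<open>t\<close> vertices, where
  \<open>t\<close> is \<open>\<tau> * card V\<close> rounded up; this multiplies the number of
  containers by \<open>card V ^ t\<close>. The quantifiers are those of the object logic so that the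
  induction can generalise over \<open>K\<close>, which grows from level to level.\<close>

lemma container_step_exists:
  fixes K :: real
  assumes "0 < K"
  shows "\<exists>(\<delta>::real)>0. \<exists>(\<tau>0::real)>0. \<forall>(V::'a set) (\<tau>::real) w. finite V \<longrightarrow> V \<noteq> {} \<longrightarrow> 0 < \<tau> \<longrightarrow> \<tau> \<le> \<tau>0 \<longrightarrow> 1 \<le> \<tau> * card V \<longrightarrow>
     spread_weight V (Suc r) K \<tau> w \<longrightarrow>
     (\<exists>\<C>. finite \<C> \<and> card \<C> \<le> card V ^ (r * nat \<lceil>\<tau> * card V\<rceil>) \<and>
        (\<forall>C\<in>\<C>. C \<subseteq> V \<and> card C \<le> (1 - \<delta>) * card V) \<and> covers_independent V w \<C>)"
  using assms
proof (induction r arbitrary: K)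
  case 0
  show ?case
  proof (rule exI[of _ "1 / K"], rule conjI, use 0 in simp, rule exI[of _ 1], intro conjI allI impI)
    fix V :: "'a set" and \<tau> :: real and w
    assume V: "finite V" "V \<noteq> {}" and "0 < \<tau>" and sp: "spread_weight V (Suc 0) K \<tau> w"
    \<comment> \<open>Hyperedges are single vertices here, so an independent set avoids all vertices
      of positive degree and one container suffices.\<close>
    let ?L = "{x \<in> V. wdeg V w {x} \<le> 0}"
    have "1 \<le> wdeg V w {}" using sp by (simp add: spread_weight_def)
    also have "\<dots> \<le> (\<Sum>x\<in>V. wdeg V w {x})"
      using sp V by (intro sum_wdeg_singleton_ge) (auto simp: spread_weight_def)
    finally have "card ?L \<le> (1 - (1 - 0 * real (card V)) / K) * card V"
      using 0 V sp by (intro card_low_value_le) (auto simp: spread_weight_def)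
    moreover have "covers_independent V w {?L}"
      unfolding covers_independent_def
    proof (intro allI impI bexI[of _ ?L] subsetI)
      fix I x
      assume I: "I \<subseteq> V" "I \<noteq> {}" "\<forall>e. w e \<noteq> 0 \<longrightarrow> \<not> e \<subseteq> I" and x: "x \<in> I"
      have "\<not> wdeg V w {x} > 0"
      proof
        assume "wdeg V w {x} > 0"
        then obtain e where e: "w e \<noteq> 0" "{x} \<subseteq> e" by (rule wdeg_pos_witness)
        then have "card e = 1" using sp by (simp add: spread_weight_def)
        then have "e = {x}" using e(2) by (auto simp: card_1_singleton_iff)
        then show False using e(1) I x by auto
      qed
      then show "x \<in> ?L" using I x by auto
    qed simp
    ultimately show "\<exists>\<C>. finite \<C> \<and> card \<C> \<le> card V ^ (0 * nat \<lceil>\<tau> * card V\<rceil>) \<and>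
        (\<forall>C\<in>\<C>. C \<subseteq> V \<and> card C \<le> (1 - 1 / K) * card V) \<and> covers_independent V w \<C>"
      by (intro exI[of _ "{?L}"]) auto
  qed auto
next
  case (Suc r)
  \<comment> \<open>\<open>K'\<close> governs the caps and is so large that saturated sets cost at
    most 1/4 of the weight. \<open>K''\<close> is the spread constant of the links after rescaling
    by \<open>4 / \<tau>\<close>.\<close>
  define K' where "K' = K\<^sup>2 * 2 ^ (r + 4)"
  define K'' where "K'' = 4 * (K' + K)"
  have K': "K' > 0" and K'': "K'' > 0" using Suc.prems by (auto simp: K'_def K''_def intro!: add_pos_pos)
  obtain \<delta>1 \<tau>1 :: real where \<delta>1: "\<delta>1 > 0" and \<tau>1: "\<tau>1 > 0" and
    IH: "\<And>(V::'a set) (\<tau>::real) w. finite V \<Longrightarrow> V \<noteq> {} \<Longrightarrow> 0 < \<tau> \<Longrightarrow> \<tau> \<le> \<tau>1 \<Longrightarrow> 1 \<le> \<tau> * card V \<Longrightarrow>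
     spread_weight V (Suc r) K'' \<tau> w \<Longrightarrow>
     (\<exists>\<C>. finite \<C> \<and> card \<C> \<le> card V ^ (r * nat \<lceil>\<tau> * card V\<rceil>) \<and>
        (\<forall>C\<in>\<C>. C \<subseteq> V \<and> card C \<le> (1 - \<delta>1) * card V) \<and> covers_independent V w \<C>)"
    using Suc.IH[OF K''] by blast
  define \<delta> where "\<delta> = min \<delta>1 (1 / (4 * K))"
  \<comment> \<open>The bound \<open>1 / (8 * K)\<close> limits the loss through picked vertices to
    another 1/4, so half of the weight remains.\<close>
  define \<tau>0 where "\<tau>0 = min \<tau>1 (1 / (8 * K))"
  have \<delta>: "\<delta> > 0" and \<tau>0: "\<tau>0 > 0" using \<delta>1 \<tau>1 Suc.prems by (auto simp: \<delta>_def \<tau>0_def)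
  show ?case
  proof (rule exI[of _ \<delta>], rule conjI[OF \<delta>], rule exI[of _ \<tau>0], intro conjI allI impI \<tau>0)
    fix V :: "'a set" and \<tau> :: real and w
    assume V: "finite V" "V \<noteq> {}" and \<tau>: "0 < \<tau>" "\<tau> \<le> \<tau>0" "1 \<le> \<tau> * card V"
      and sp: "spread_weight V (Suc (Suc r)) K \<tau> w"
    define N where "N = real (card V)"
    define t where "t = nat \<lceil>\<tau> * card V\<rceil>"
    define cap where "cap j = K' * \<tau> ^ j / N" for j
    have N: "N > 0" using V by (simp add: N_def card_gt_0_iff)
    have t: "\<tau> * N \<le> real t" "real t \<le> 2 * (\<tau> * N)"
      using \<tau>(3) unfolding t_def N_def by linarith+
    have cap_pos: "0 < cap j" for j using K' \<tau> N by (simp add: cap_def)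
    have w_nonneg: "0 \<le> w e" for e using sp by (simp add: spread_weight_def)
    have w_card: "e \<subseteq> V \<and> card e = Suc (Suc r)" if "w e \<noteq> 0" for e
      using sp that by (simp add: spread_weight_def)
    have w_total: "1 \<le> wdeg V w {}" using sp by (simp add: spread_weight_def)
    have w_spread: "wdeg V w S \<le> K * \<tau> ^ (card S - 1) / N" if "S \<noteq> {}" for S
      using sp that by (simp add: spread_weight_def N_def)
    let ?u = "link_weight V cap w" and ?rem = "remaining_weight V cap w"
    let ?low = "\<lambda>vs. {x \<in> V. wdeg V (?rem vs) {x} \<le> 1 / (4 * N)}"
    have u_nonneg: "0 \<le> ?u vs e" for vs e by (rule link_weight_nonneg[OF V(1) w_nonneg])
    have u_spread: "wdeg V (?u vs) S \<le> (K' + K) * \<tau> ^ card S / N" if "set vs \<subseteq> V" "S \<noteq> {}" for vs S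
    proof -
      have "wdeg V (?u vs) S \<le> cap (card S) + K * \<tau> ^ card S / N"
      proof (rule wdeg_link_weight_le[OF V(1) w_nonneg])
        fix S :: "'a set" and v assume S: "S \<noteq> {}" "v \<notin> S"
        then show "wdeg V w (insert v S) \<le> K * \<tau> ^ card S / N"
          using w_spread[of "insert v S"] by (cases "finite S") auto
      qed (use that cap_pos \<tau> N Suc.prems in \<open>auto intro: less_imp_le\<close>)
      then show ?thesis by (simp add: cap_def add_divide_distrib distrib_right)
    qed
    \<comment> \<open>The family depends on the picks \<open>vs\<close> alone; \<open>I\<close>
      ranges over all independent sets for which \<open>vs\<close> is a valid outcome of the greedy
      process. Therefore the union over all lists serves every independent set.\<close>
    have ex: "\<exists>\<D>. finite \<D> \<and> card \<D> \<le> card V ^ (r * t) \<and>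
        (\<forall>C\<in>\<D>. C \<subseteq> V \<and> card C \<le> (1 - \<delta>) * card V) \<and>
        (\<forall>I. I \<subseteq> V \<longrightarrow> I \<noteq> {} \<longrightarrow> (\<forall>e. w e \<noteq> 0 \<longrightarrow> \<not> e \<subseteq> I) \<longrightarrow> set vs \<subseteq> I \<longrightarrow>
          (\<forall>x\<in>I. real t * wdeg V (?rem vs) {x} \<le> wdeg V (?u vs) {}) \<longrightarrow> (\<exists>C\<in>\<D>. I \<subseteq> C))"
      if vs: "set vs \<subseteq> V" "length vs = t" for vs
    proof (cases "\<tau> / 4 \<le> wdeg V (?u vs) {}")
      case True
      \<comment> \<open>Heavy links: rescaling lifts their total to at least 1 and lowers the power
        of \<open>\<tau>\<close> in the degree bounds by one, as the spread condition
        requires.\<close>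
      let ?w = "\<lambda>e. 4 / \<tau> * ?u vs e"
      have "spread_weight V (Suc r) K'' \<tau> ?w"
        unfolding spread_weight_def wdeg_scale
      proof (intro conjI allI impI)
        fix e assume "?w e \<noteq> 0"
        then have "?u vs e \<noteq> 0" by simp
        from link_weight_support[OF V(1) w_nonneg this]
        obtain v where v: "v \<notin> e" "w (insert v e) \<noteq> 0" by blast
        from w_card[OF v(2)] have *: "insert v e \<subseteq> V" "card (insert v e) = Suc (Suc r)" by auto
        then show "e \<subseteq> V" by auto
        then have "finite e" using V(1) finite_subset by blast
        then show "card e = Suc r" using * v by simp
      next
        fix S :: "'a set" assume S: "S \<noteq> {}"
        show "4 / \<tau> * wdeg V (?u vs) S \<le> K'' * \<tau> ^ (card S - 1) / card V"
        proof (cases "finite S")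
          case True
          then have "card S = Suc (card S - 1)" using S by (simp add: card_gt_0_iff)
          then have p: "\<tau> ^ card S = \<tau> * \<tau> ^ (card S - 1)" by (metis power_Suc)
          have "4 / \<tau> * wdeg V (?u vs) S \<le> 4 / \<tau> * ((K' + K) * \<tau> ^ card S / N)"
            using \<tau> u_spread[OF vs(1) S] by (intro mult_left_mono) auto
          also have "\<dots> = K'' * \<tau> ^ (card S - 1) / card V"
            using \<tau> N unfolding p K''_def N_def[symmetric] by (simp add: field_simps)
          finally show ?thesis .
        next
          case False
          then show ?thesis using wdeg_infinite[OF V(1)] K'' \<tau> by simp
        qed
      qed (use True \<tau> u_nonneg in \<open>auto simp: field_simps\<close>)
      from IH[OF V \<tau>(1) _ \<tau>(3) this] \<tau>(2)
      obtain \<D> where D: "finite \<D>" "card \<D> \<le> card V ^ (r * t)"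
        "\<And>C. C \<in> \<D> \<Longrightarrow> C \<subseteq> V \<and> card C \<le> (1 - \<delta>1) * card V" "covers_independent V ?w \<D>"
        unfolding t_def \<tau>0_def by auto
      show ?thesis
      proof (intro exI[of _ \<D>] conjI ballI allI impI D(1,2))
        fix C assume C: "C \<in> \<D>"
        then show "C \<subseteq> V" using D(3) by blast
        have "(1 - \<delta>1) * card V \<le> (1 - \<delta>) * card V"
          by (intro mult_right_mono) (auto simp: \<delta>_def)
        then show "card C \<le> (1 - \<delta>) * card V" using D(3)[OF C] by linarith
      next
        fix I assume I: "I \<subseteq> V" "I \<noteq> {}" "\<forall>e. w e \<noteq> 0 \<longrightarrow> \<not> e \<subseteq> I" "set vs \<subseteq> I"
        have "\<not> e \<subseteq> I" if "?w e \<noteq> 0" for e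
        proof
          assume e: "e \<subseteq> I"
          have "?u vs e \<noteq> 0" using that by simp
          from link_weight_support[OF V(1) w_nonneg this] I e show False by blast
        qed
        then show "\<exists>C\<in>\<D>. I \<subseteq> C" using D(4) I unfolding covers_independent_def by blast
      qed
    next
      case False
      have "1 - real t * (K / N) - K / (K' * \<tau>) * 2 ^ Suc r * (real t * (K / N)) \<le>
          wdeg V w {} - real (length vs) * (K / N) - K / (K' * \<tau>) * 2 ^ Suc r * (real (length vs) * (K / N))"
        using w_total vs by simp
      also have "\<dots> \<le> wdeg V (?rem vs) {}"
      proof (rule wdeg_remaining_ge[OF V(1) w_nonneg vs(1)])
        fix v assume "v \<in> V"
        then show "wdeg V w {v} \<le> K / N" using w_spread[of "{v}"] by simp
      next
        fix S :: "'a set" assume S: "S \<noteq> {}" "S \<subseteq> V"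
        then have "card S > 0" using finite_subset[OF S(2) V(1)] by (simp add: card_gt_0_iff)
        then have "card S = Suc (card S - 1)" by simp
        then have p: "\<tau> ^ card S = \<tau> * \<tau> ^ (card S - 1)" by (metis power_Suc)
        show "wdeg V w S \<le> K / (K' * \<tau>) * cap (card S)"
          using w_spread[OF S(1)] \<tau> K' unfolding cap_def p by (simp add: field_simps)
      next
        show "0 \<le> cap j" for j by (rule less_imp_le[OF cap_pos])
        show "0 \<le> K / (K' * \<tau>)" using K' \<tau> Suc.prems by simp
        show "card e \<le> Suc (Suc r)" "finite e" if "w e \<noteq> 0" for e
          using w_card[OF that] finite_subset[OF _ V(1)] by auto
      qed
      finally have *: "1 - real t * (K / N) - K / (K' * \<tau>) * 2 ^ Suc r * (real t * (K / N)) \<le> wdeg V (?rem vs) {}" .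
      have "real t * (K / N) \<le> 2 * (\<tau> * N) * (K / N)"
        using t Suc.prems N by (intro mult_right_mono) auto
      also have "\<dots> = 2 * \<tau> * K" using N by simp
      finally have a: "real t * (K / N) \<le> 2 * \<tau> * K" .
      have "2 * \<tau> * K \<le> 1 / 4" using \<tau> Suc.prems by (simp add: \<tau>0_def field_simps)
      moreover have "K / (K' * \<tau>) * 2 ^ Suc r * (real t * (K / N)) \<le> K / (K' * \<tau>) * 2 ^ Suc r * (2 * \<tau> * K)"
        using a K' \<tau> Suc.prems by (intro mult_left_mono) auto
      moreover have "K / (K' * \<tau>) * 2 ^ Suc r * (2 * \<tau> * K) = 1 / 4"
        using K' \<tau> Suc.prems by (simp add: K'_def field_simps power2_eq_square power_add)
      ultimately have "1 / 2 \<le> wdeg V (?rem vs) {}" using * a by linarith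
      also have "\<dots> \<le> (\<Sum>x\<in>V. wdeg V (?rem vs) {x})"
      proof (rule sum_wdeg_singleton_ge[OF V(1)])
        fix e assume "?rem vs e \<noteq> 0"
        then have "w e \<noteq> 0" unfolding residue_weight_def by metis
        then show "e \<noteq> {}" using w_card by fastforce
      qed (rule residue_weight_nonneg[OF V(1) w_nonneg])
      finally have "card (?low vs) \<le> (1 - (1 / 2 - 1 / (4 * N) * card V) / K) * card V"
      proof (intro card_low_value_le[OF V])
        fix x assume "x \<in> V"
        have "wdeg V (?rem vs) {x} \<le> wdeg V w {x}"
          by (intro wdeg_mono residue_weight_le[OF V(1) w_nonneg])
        then show "wdeg V (?rem vs) {x} \<le> K / card V" using w_spread[of "{x}"] by (simp add: N_def)
      qed (use Suc.prems N in auto)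
      also have "\<dots> = (1 - 1 / (4 * K)) * card V" using N unfolding N_def[symmetric] by simp
      also have "\<dots> \<le> (1 - \<delta>) * card V" by (intro mult_right_mono) (auto simp: \<delta>_def)
      finally have low: "card (?low vs) \<le> (1 - \<delta>) * card V" .
      show ?thesis
      proof (intro exI[of _ "{?low vs}"] conjI ballI allI impI)
        show "card {?low vs} \<le> card V ^ (r * t)" using V by (simp add: card_gt_0_iff Suc_le_eq)
      next
        fix I assume I: "I \<subseteq> V" "\<forall>x\<in>I. real t * wdeg V (?rem vs) {x} \<le> wdeg V (?u vs) {}"
        \<comment> \<open>Light links: their total is below \<open>\<tau> / 4\<close>, and
          \<open>t\<close>, which is at least \<open>\<tau> * N\<close>, times the degree of
          \<open>x\<close> does not exceed it. So \<open>I\<close> avoids the vertices of larger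
          degree, of which there are many.\<close>
        have "wdeg V (?rem vs) {x} \<le> 1 / (4 * N)" if "x \<in> I" for x
        proof -
          have d: "0 \<le> wdeg V (?rem vs) {x}"
            by (rule wdeg_nonneg) (rule residue_weight_nonneg[OF V(1) w_nonneg])
          have "\<tau> * N * wdeg V (?rem vs) {x} \<le> real t * wdeg V (?rem vs) {x}"
            using t(1) d by (rule mult_right_mono)
          also have "\<dots> \<le> \<tau> / 4" using I that False by force
          finally show ?thesis using \<tau> N by (simp add: field_simps)
        qed
        then show "\<exists>C\<in>{?low vs}. I \<subseteq> C" using I by auto
      qed (use low in auto)
    qed
    let ?Q = "\<lambda>vs \<D>. finite \<D> \<and> card \<D> \<le> card V ^ (r * t) \<and>
        (\<forall>C\<in>\<D>. C \<subseteq> V \<and> card C \<le> (1 - \<delta>) * card V) \<and>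
        (\<forall>I. I \<subseteq> V \<longrightarrow> I \<noteq> {} \<longrightarrow> (\<forall>e. w e \<noteq> 0 \<longrightarrow> \<not> e \<subseteq> I) \<longrightarrow> set vs \<subseteq> I \<longrightarrow>
          (\<forall>x\<in>I. real t * wdeg V (?rem vs) {x} \<le> wdeg V (?u vs) {}) \<longrightarrow> (\<exists>C\<in>\<D>. I \<subseteq> C))"
    have "\<forall>vs\<in>{vs. set vs \<subseteq> V \<and> length vs = t}. \<exists>\<D>. ?Q vs \<D>"
    proof
      fix vs assume "vs \<in> {vs. set vs \<subseteq> V \<and> length vs = t}"
      then have "set vs \<subseteq> V" "length vs = t" by auto
      then show "\<exists>\<D>. ?Q vs \<D>" by (rule ex)
    qed
    from bchoice[OF this] obtain \<D> where D': "\<forall>vs\<in>{vs. set vs \<subseteq> V \<and> length vs = t}. ?Q vs (\<D> vs)" ..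
    then have D: "?Q vs (\<D> vs)" if "set vs \<subseteq> V" "length vs = t" for vs
      using that by simp
    let ?A = "{vs. set vs \<subseteq> V \<and> length vs = t}"
    have finA: "finite ?A" using V by (simp add: finite_lists_length_eq)
    have cov: "covers_independent V w (\<Union>vs\<in>?A. \<D> vs)"
      unfolding covers_independent_def
    proof (intro allI impI)
      fix I assume I: "I \<subseteq> V" "I \<noteq> {}" "\<forall>e. w e \<noteq> 0 \<longrightarrow> \<not> e \<subseteq> I"
      obtain vs where vs: "length vs = t" "set vs \<subseteq> I"
        "\<forall>x\<in>I. real t * wdeg V (?rem vs) {x} \<le> wdeg V (?u vs) {}"
        using greedy_list[where w = w and cap = cap and t = t, OF V(1) w_nonneg I(1,2)] by blast
      have "\<exists>C\<in>\<D> vs. I \<subseteq> C"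
        using D[of vs] vs I by blast
      then show "\<exists>C\<in>(\<Union>vs\<in>?A. \<D> vs). I \<subseteq> C" using vs I(1) by blast
    qed
    have "card (\<Union>vs\<in>?A. \<D> vs) \<le> (\<Sum>vs\<in>?A. card (\<D> vs))"
      by (rule card_UN_le[OF finA])
    also have "\<dots> \<le> (\<Sum>vs\<in>?A. card V ^ (r * t))" using D by (intro sum_mono) blast
    also have "\<dots> = card V ^ (Suc r * t)"
      using V by (simp add: card_lists_length_eq power_add)
    finally have crd: "card (\<Union>vs\<in>?A. \<D> vs) \<le> card V ^ (Suc r * t)" .
    have good: "\<forall>C\<in>(\<Union>vs\<in>?A. \<D> vs). C \<subseteq> V \<and> card C \<le> (1 - \<delta>) * card V" using D by blast
    have fin: "finite (\<Union>vs\<in>?A. \<D> vs)" using finA D by blast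
    show "\<exists>\<C>. finite \<C> \<and> card \<C> \<le> card V ^ (Suc r * nat \<lceil>\<tau> * card V\<rceil>) \<and>
        (\<forall>C\<in>\<C>. C \<subseteq> V \<and> card C \<le> (1 - \<delta>) * card V) \<and> covers_independent V w \<C>"
      unfolding t_def[symmetric] using fin crd good cov by blast
  qed
qed

theorem container_step:
  fixes K :: real
  assumes "0 < K"
  obtains \<delta> \<tau>0 :: real where "0 < \<delta>" "0 < \<tau>0"
    and "\<And>(V::'a set) (\<tau>::real) w. finite V \<Longrightarrow> V \<noteq> {} \<Longrightarrow> 0 < \<tau> \<Longrightarrow> \<tau> \<le> \<tau>0 \<Longrightarrow> 1 \<le> \<tau> * card V \<Longrightarrow>
      spread_weight V (Suc r) K \<tau> w \<Longrightarrow>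
      \<exists>\<C>. finite \<C> \<and> card \<C> \<le> card V ^ (r * nat \<lceil>\<tau> * card V\<rceil>) \<and>
        (\<forall>C\<in>\<C>. C \<subseteq> V \<and> card C \<le> (1 - \<delta>) * card V) \<and> covers_independent V w \<C>"
  using container_step_exists[OF assms, where 'a = 'a and r = r]
proof (elim exE conjE)
  fix \<delta> \<tau>0 :: real
  assume *: "0 < \<delta>" "0 < \<tau>0" and **: "\<forall>(V::'a set) (\<tau>::real) w. finite V \<longrightarrow> V \<noteq> {} \<longrightarrow> 0 < \<tau> \<longrightarrow> \<tau> \<le> \<tau>0 \<longrightarrow> 1 \<le> \<tau> * card V \<longrightarrow>
     spread_weight V (Suc r) K \<tau> w \<longrightarrow>
     (\<exists>\<C>. finite \<C> \<and> card \<C> \<le> card V ^ (r * nat \<lceil>\<tau> * card V\<rceil>) \<and>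
        (\<forall>C\<in>\<C>. C \<subseteq> V \<and> card C \<le> (1 - \<delta>) * card V) \<and> covers_independent V w \<C>)"
  show thesis by (rule that[OF * **[THEN spec, THEN spec, THEN spec, THEN mp, THEN mp, THEN mp, THEN mp, THEN mp, THEN mp]])
qed

subsection \<open>Containers for cycle-free graphs\<close>

lemma cycles_restrict: "D \<in> cycles k E \<Longrightarrow> D \<subseteq> F \<Longrightarrow> D \<in> cycles k F"
  unfolding cycles_def by blast

text \<open>The general step is applied to the hypergraph on \<open>E\<close> whose hyperedges are
  the members of a balanced family, all with weight \<open>1 / card F\<close>. A cycle-free set of
  edges is independent in it.\<close>

theorem cycle_free_container_step:
  fixes l :: nat
  assumes l: "2 \<le> l"
  obtains \<delta> \<tau>0 C :: real where "0 < \<delta>" "\<delta> < 1" "0 < \<tau>0" "1 \<le> C"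
    and "\<And>(V::'a set) E (\<tau>::real). finite V \<Longrightarrow> V \<noteq> {} \<Longrightarrow> E \<subseteq> all_edges V \<Longrightarrow> 0 < \<tau> \<Longrightarrow> \<tau> \<le> \<tau>0 \<Longrightarrow>
      C * card V ^ (l + 1) \<le> card E ^ l * \<tau> ^ (l - 1) \<Longrightarrow>
      C * card V ^ (2 * l) \<le> (card E * \<tau>) ^ (2 * l - 1) \<Longrightarrow>
      \<exists>\<C>. finite \<C> \<and> card \<C> \<le> card E ^ ((2 * l - 1) * nat \<lceil>\<tau> * card E\<rceil>) \<and>
        (\<forall>D\<in>\<C>. D \<subseteq> E \<and> card D \<le> (1 - \<delta>) * card E) \<and>
        (\<forall>F\<subseteq>E. F \<noteq> {} \<longrightarrow> cycles (2 * l) F = {} \<longrightarrow> (\<exists>D\<in>\<C>. F \<subseteq> D))"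
proof (rule balanced_supersaturation[OF l, where 'a = 'a])
  fix K C :: real
  assume K: "0 < K" and C: "1 \<le> C" and
    bal: "\<And>(V::'a set) E (\<tau>::real). finite V \<Longrightarrow> V \<noteq> {} \<Longrightarrow> E \<subseteq> all_edges V \<Longrightarrow> 0 < \<tau> \<Longrightarrow> \<tau> \<le> 1 / 2 \<Longrightarrow>
      C * card V ^ (l + 1) \<le> card E ^ l * \<tau> ^ (l - 1) \<Longrightarrow>
      C * card V ^ (2 * l) \<le> (card E * \<tau>) ^ (2 * l - 1) \<Longrightarrow>
      \<exists>F\<subseteq>cycles (2 * l) E. card E * (1 / \<tau>) ^ (2 * l - 1) / K \<le> card F \<and>
        (\<forall>S. S \<noteq> {} \<longrightarrow> card {D \<in> F. S \<subseteq> D} \<le> (1 / \<tau>) ^ (2 * l - card S))"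
  show ?thesis
  proof (rule container_step[OF K, where 'a = "'a set" and r = "2 * l - 1"])
    fix \<delta> \<tau>0 :: real
    assume \<delta>: "0 < \<delta>" and \<tau>0: "0 < \<tau>0" and
      cont: "\<And>(W::'a set set) (\<tau>::real) w. finite W \<Longrightarrow> W \<noteq> {} \<Longrightarrow> 0 < \<tau> \<Longrightarrow> \<tau> \<le> \<tau>0 \<Longrightarrow> 1 \<le> \<tau> * card W \<Longrightarrow>
        spread_weight W (Suc (2 * l - 1)) K \<tau> w \<Longrightarrow>
        \<exists>\<C>. finite \<C> \<and> card \<C> \<le> card W ^ ((2 * l - 1) * nat \<lceil>\<tau> * card W\<rceil>) \<and>
          (\<forall>D\<in>\<C>. D \<subseteq> W \<and> card D \<le> (1 - \<delta>) * card W) \<and> covers_independent W w \<C>"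
    show ?thesis
    \<comment> \<open>The minimum with 1/2 keeps the shrinking factor \<open>1 - \<delta>\<close>
      positive and meets the condition on \<open>\<tau>\<close> in balanced supersaturation.\<close>
    proof (rule that[of "min \<delta> (1 / 2)" "min \<tau>0 (1 / 2)" C])
      fix V :: "'a set" and E and \<tau> :: real
      assume V: "finite V" "V \<noteq> {}" and E: "E \<subseteq> all_edges V" and \<tau>: "0 < \<tau>" "\<tau> \<le> min \<tau>0 (1 / 2)"
        and c1: "C * card V ^ (l + 1) \<le> card E ^ l * \<tau> ^ (l - 1)"
        and c2: "C * card V ^ (2 * l) \<le> (card E * \<tau>) ^ (2 * l - 1)"
      have \<tau>': "\<tau> \<le> \<tau>0" "\<tau> \<le> 1 / 2" using \<tau> by auto
      from bal[OF V E \<tau>(1) \<tau>'(2) c1 c2] obtain F where F: "F \<subseteq> cycles (2 * l) E"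
        "card E * (1 / \<tau>) ^ (2 * l - 1) / K \<le> card F"
        "\<forall>S. S \<noteq> {} \<longrightarrow> card {D \<in> F. S \<subseteq> D} \<le> (1 / \<tau>) ^ (2 * l - card S)"
        by (elim exE conjE)
      have finE: "finite E" by (rule finite_card_edges[OF V(1) E])
      have "1 \<le> C * card V ^ (2 * l)"
      proof -
        have "1 \<le> real (card V ^ (2 * l))" using V by (simp add: card_gt_0_iff Suc_le_eq)
        then have "1 * 1 \<le> C * real (card V ^ (2 * l))" using C by (intro mult_mono) auto
        then show ?thesis by simp
      qed
      then have "1 \<le> (card E * \<tau>) ^ (2 * l - 1)" using c2 by linarith
      have one: "1 \<le> \<tau> * card E"
      proof (rule ccontr)
        assume "\<not> ?thesis"
        then have "(card E * \<tau>) ^ (2 * l - 1) < 1"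
          using l \<tau>(1) power_strict_mono[of "card E * \<tau>" 1 "2 * l - 1"] by (simp add: mult.commute)
        then show False using \<open>1 \<le> (card E * \<tau>) ^ (2 * l - 1)\<close> by linarith
      qed
      then have E0: "E \<noteq> {}" "0 < real (card E)" by (auto simp: card_gt_0_iff finE)
      define w where "w D = (if D \<in> F then 1 / card F else 0)" for D
      have finF: "finite F" using F(1) finite_cycles[OF finE] by (rule finite_subset)
      have "0 < card E * (1 / \<tau>) ^ (2 * l - 1) / K" using E0 \<tau> K by simp
      then have F0: "0 < real (card F)" using F(2) by linarith
      have wdeg_w: "wdeg E w S = card {D \<in> F. S \<subseteq> D} / card F" for S
      proof -
        have "D \<subseteq> E" if "D \<in> F" for D using that F(1) cycle_subset by blast
        then have "wdeg E w S = (\<Sum>D | D \<in> F \<and> S \<subseteq> D. 1 / card F)"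
          unfolding wdeg_def w_def using finE
          by (intro sum.mono_neutral_cong_right) auto
        then show ?thesis by simp
      qed
      have "spread_weight E (Suc (2 * l - 1)) K \<tau> w"
        unfolding spread_weight_def
      proof (intro conjI allI impI)
        fix D assume "w D \<noteq> 0"
        then have D: "D \<in> cycles (2 * l) E" using F(1) by (auto simp: w_def split: if_splits)
        then show "D \<subseteq> E" by (rule cycle_subset)
        show "card D = Suc (2 * l - 1)" using card_cycle[OF D] l by simp
      next
        show "1 \<le> wdeg E w {}" using F0 by (simp add: wdeg_w)
      next
        fix S :: "'a set set" assume S: "S \<noteq> {}"
        show "wdeg E w S \<le> K * \<tau> ^ (card S - 1) / card E"
        proof (cases "{D \<in> F. S \<subseteq> D} = {}")
          case True
          have "card {D \<in> F. S \<subseteq> D} = 0" unfolding True by simp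
          then show ?thesis unfolding wdeg_w using K \<tau> by simp
        next
          case False
          then obtain D where D: "D \<in> cycles (2 * l) E" "S \<subseteq> D" using F(1) by blast
          have cD: "card D = 2 * l" "finite D" using card_cycle[OF D(1)] finite_cycle[OF D(1)] l by auto
          have S1: "1 \<le> card S" using S finite_subset[OF D(2) cD(2)] by (simp add: card_gt_0_iff Suc_le_eq)
          have S2: "card S \<le> 2 * l" using card_mono[OF cD(2) D(2)] cD(1) by simp
          have F_inv: "1 / card F \<le> K / (card E * (1 / \<tau>) ^ (2 * l - 1))"
            using F(2) F0 K E0 \<tau> by (simp add: field_simps)
          have "wdeg E w S \<le> (1 / \<tau>) ^ (2 * l - card S) / card F"
            unfolding wdeg_w using F(3) S by (intro divide_right_mono) auto
          also have "\<dots> \<le> (1 / \<tau>) ^ (2 * l - card S) * (K / (card E * (1 / \<tau>) ^ (2 * l - 1)))"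
            using mult_left_mono[OF F_inv, of "(1 / \<tau>) ^ (2 * l - card S)"] \<tau> by simp
          also have "(1 / \<tau>) ^ (2 * l - 1) = (1 / \<tau>) ^ (2 * l - card S) * (1 / \<tau>) ^ (card S - 1)"
            using S1 S2 by (simp flip: power_add)
          also have "(1 / \<tau>) ^ (2 * l - card S) * (K / (card E * ((1 / \<tau>) ^ (2 * l - card S) * (1 / \<tau>) ^ (card S - 1))))
              = K * \<tau> ^ (card S - 1) / card E"
            using \<tau>(1) E0 by (simp add: power_one_over field_simps)
          finally show ?thesis .
        qed
      qed (use F0 in \<open>auto simp: w_def\<close>)
      from cont[OF finE E0(1) \<tau>(1) \<tau>'(1) one this]
      obtain \<C> where \<C>: "finite \<C>" "card \<C> \<le> card E ^ ((2 * l - 1) * nat \<lceil>\<tau> * card E\<rceil>)"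
        "\<And>D. D \<in> \<C> \<Longrightarrow> D \<subseteq> E \<and> card D \<le> (1 - \<delta>) * card E" "covers_independent E w \<C>" by blast
      have "card D \<le> (1 - min \<delta> (1 / 2)) * card E" if "D \<in> \<C>" for D
      proof -
        have "(1 - \<delta>) * card E \<le> (1 - min \<delta> (1 / 2)) * card E" by (intro mult_right_mono) auto
        then show ?thesis using \<C>(3)[OF that] by linarith
      qed
      moreover have "\<exists>D\<in>\<C>. F' \<subseteq> D" if F': "F' \<subseteq> E" "F' \<noteq> {}" "cycles (2 * l) F' = {}" for F'
      proof -
        have "\<not> D \<subseteq> F'" if "w D \<noteq> 0" for D
          using that F(1) F'(3) cycles_restrict[of D "2 * l" E F'] by (auto simp: w_def split: if_splits)
        then show ?thesis using \<C>(4) F' unfolding covers_independent_def by blast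
      qed
      ultimately show "\<exists>\<C>. finite \<C> \<and> card \<C> \<le> card E ^ ((2 * l - 1) * nat \<lceil>\<tau> * card E\<rceil>) \<and>
          (\<forall>D\<in>\<C>. D \<subseteq> E \<and> card D \<le> (1 - min \<delta> (1 / 2)) * card E) \<and>
          (\<forall>F\<subseteq>E. F \<noteq> {} \<longrightarrow> cycles (2 * l) F = {} \<longrightarrow> (\<exists>D\<in>\<C>. F \<subseteq> D))"
        using \<C>(1,2,3) by (intro exI[of _ \<C>]) blast
    qed (use \<delta> \<tau>0 C in auto)
  qed
qed

text \<open>The step is iterated until every container has at most \<open>m\<close> edges. The first
  part of \<open>\<tau> * N\<close> is the same in each of the \<open>O(ln n)\<close> rounds, whence
  the extra logarithm in the first term. The second part grows geometrically as containers shrink,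
  so the last round dominates and no logarithm is added.\<close>

theorem cycle_free_containers:
  fixes l :: nat
  assumes l: "2 \<le> l"
  obtains C2 C3 :: real where "1 \<le> C2" "0 < C3"
    and "\<And>(V::'a set) (m::real). finite V \<Longrightarrow> 1 \<le> ln (card V) \<Longrightarrow> C2 * card V powr (1 + 1 / l) \<le> m \<Longrightarrow>
      \<exists>\<C>. finite \<C> \<and>
        card \<C> \<le> exp (C3 * ln (card V) * (card V powr (1 + 1 / (2 * real l - 1)) * ln (card V)
                        + card V powr ((real l + 1) / (real l - 1)) * m powr (- (1 / (real l - 1))))) \<and>
        (\<forall>D\<in>\<C>. D \<subseteq> all_edges V \<and> card D \<le> m) \<and>
        (\<forall>F\<subseteq>all_edges V. F \<noteq> {} \<longrightarrow> cycles (2 * l) F = {} \<longrightarrow> (\<exists>D\<in>\<C>. F \<subseteq> D))"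
proof (rule cycle_free_container_step[OF l, where 'a = 'a])
  fix \<delta> \<tau>0 C :: real
  assume \<delta>: "0 < \<delta>" "\<delta> < 1" and \<tau>0: "0 < \<tau>0" and C: "1 \<le> C"
    and step: "\<And>(V::'a set) E (\<tau>::real). finite V \<Longrightarrow> V \<noteq> {} \<Longrightarrow> E \<subseteq> all_edges V \<Longrightarrow> 0 < \<tau> \<Longrightarrow> \<tau> \<le> \<tau>0 \<Longrightarrow>
      C * card V ^ (l + 1) \<le> card E ^ l * \<tau> ^ (l - 1) \<Longrightarrow>
      C * card V ^ (2 * l) \<le> (card E * \<tau>) ^ (2 * l - 1) \<Longrightarrow>
      \<exists>\<C>. finite \<C> \<and> card \<C> \<le> card E ^ ((2 * l - 1) * nat \<lceil>\<tau> * card E\<rceil>) \<and>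
        (\<forall>D\<in>\<C>. D \<subseteq> E \<and> card D \<le> (1 - \<delta>) * card E) \<and>
        (\<forall>F\<subseteq>E. F \<noteq> {} \<longrightarrow> cycles (2 * l) F = {} \<longrightarrow> (\<exists>D\<in>\<C>. F \<subseteq> D))"
  \<comment> \<open>Above \<open>C2 * n powr (1 + 1 / l)\<close> edges, each of the two parts of
    \<open>\<tau>\<close> is at most \<open>\<tau>0 / 2\<close>.\<close>
  define C2 where "C2 = 2 * C / \<tau>0 + 1"
  define \<rho> where "\<rho> = 1 / (1 - \<delta>)"
  define L where "L = real l"
  define k where "k = 1 / (L - 1)"
  define \<theta> where "\<theta> = \<rho> powr (- k)"
  \<comment> \<open>The factor \<open>8 * L\<close> collects \<open>2 * l - 1 \<le> 2 * L\<close>, a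
    doubling from the ceiling and \<open>ln N \<le> 2 * ln n\<close>. The bracket adds the number of
    rounds per \<open>ln n\<close> and the sum of the geometric series.\<close>
  define C3 where "C3 = 8 * L * C * (2 / ln \<rho> + 1 + 1 / (1 - \<theta>))"
  have L: "2 \<le> L" using l by (simp add: L_def)
  have L1: "real (l - 1) = L - 1" "real (2 * l - 1) = 2 * L - 1" using l by (auto simp: L_def of_nat_diff)
  have k: "0 < k" "k * (L - 1) = 1" using L by (auto simp: k_def)
  have pw: "(x powr a) ^ j = x powr (a * real j)" if "0 < x" for x a :: real and j
    using that by (simp add: powr_realpow[symmetric] powr_powr)
  have \<rho>: "1 < \<rho>" using \<delta> by (simp add: \<rho>_def)
  have \<theta>: "0 < \<theta>" "\<theta> < 1" using \<rho> k by (auto simp: \<theta>_def powr_less_one)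
  have C2: "1 \<le> C2" using C \<tau>0 by (simp add: C2_def)
  have ln\<rho>: "0 < ln \<rho>" using \<rho> by simp
  have C3: "0 < C3" unfolding C3_def using C L ln\<rho> \<theta> by (intro mult_pos_pos add_pos_pos) auto
  show ?thesis
  proof (rule that[OF C2 C3])
    fix V :: "'a set" and m :: real
    assume V: "finite V" and lnV: "1 \<le> ln (card V)" and m: "C2 * card V powr (1 + 1 / l) \<le> m"
    define n where "n = real (card V)"
    have V0: "V \<noteq> {}" using lnV by auto
    have n1: "1 \<le> n" using V V0 by (simp add: n_def card_gt_0_iff Suc_le_eq)
    have n0: "0 < n" using n1 by simp
    have lnn: "1 \<le> ln n" using lnV by (simp add: n_def)
    define a where "a = C * n powr (1 + 1 / (2 * L - 1))"
    define b where "b = C * n powr ((L + 1) / (L - 1))"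
    have a0: "0 < a" and b0: "0 < b" using C n1 by (auto simp: a_def b_def)
    have m': "C2 * n powr (1 + 1 / L) \<le> m" using m by (simp add: n_def L_def)
    have "1 \<le> n powr (1 + 1 / L)" using n1 L by (intro ge_one_powr_ge_zero) auto
    then have "1 * 1 \<le> C2 * n powr (1 + 1 / L)" using C2 by (intro mult_mono) auto
    then have m1: "1 \<le> m" using m' by linarith
    \<comment> \<open>The cost of the last \<open>i\<close> rounds; index \<open>j\<close> belongs
      to graphs with between \<open>m * \<rho> ^ j\<close> and \<open>m * \<rho> ^ (j + 1)\<close>
      edges.\<close>
    define g where "g i = (\<Sum>j<i. a + b * m powr (- k) * \<theta> ^ j)" for i :: nat
    have claim: "\<exists>\<C>. finite \<C> \<and> card \<C> \<le> exp (8 * L * ln n * g i) \<and>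
        (\<forall>D\<in>\<C>. D \<subseteq> all_edges V \<and> card D \<le> m) \<and>
        (\<forall>F\<subseteq>E. F \<noteq> {} \<longrightarrow> cycles (2 * l) F = {} \<longrightarrow> (\<exists>D\<in>\<C>. F \<subseteq> D))"
      if "E \<subseteq> all_edges V" "card E \<le> m * \<rho> ^ i" for E i
      using that
    proof (induction i arbitrary: E)
      case 0
      then show ?case by (intro exI[of _ "{E}"]) (auto simp: g_def)
    next
      case (Suc i)
      define d where "d = a + b * m powr (- k) * \<theta> ^ i"
      have d0: "0 < d" using a0 b0 m1 \<theta> unfolding d_def by (intro add_pos_nonneg) auto
      have g_Suc: "8 * L * ln n * g (Suc i) = 8 * L * ln n * d + 8 * L * ln n * g i"
        by (simp add: g_def d_def algebra_simps)
      show ?case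
      proof (cases "card E \<le> m * \<rho> ^ i")
        case True
        from Suc.IH[OF Suc.prems(1) True] obtain \<C> where \<C>: "finite \<C>" "card \<C> \<le> exp (8 * L * ln n * g i)"
          "\<forall>D\<in>\<C>. D \<subseteq> all_edges V \<and> card D \<le> m"
          "\<forall>F\<subseteq>E. F \<noteq> {} \<longrightarrow> cycles (2 * l) F = {} \<longrightarrow> (\<exists>D\<in>\<C>. F \<subseteq> D)" by (elim exE conjE)
        have "0 \<le> 8 * L * ln n * d" using L lnn d0 by simp
        then have "exp (8 * L * ln n * g i) \<le> exp (8 * L * ln n * g (Suc i))" unfolding g_Suc by simp
        then have "card \<C> \<le> exp (8 * L * ln n * g (Suc i))" using \<C>(2) by linarith
        then show ?thesis using \<C>(1,3,4) by (intro exI[of _ \<C>] conjI)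
      next
        case False
        define N where "N = real (card E)"
        have N_gt: "m * \<rho> ^ i < N" using False by (simp add: N_def)
        have "1 \<le> \<rho> ^ i" using \<rho> by (simp add: one_le_power)
        then have "m * 1 \<le> m * \<rho> ^ i" using m1 by (intro mult_left_mono) auto
        then have Nm: "m < N" using N_gt by linarith
        then have N1: "1 < N" using m1 by linarith
        have Nn: "N \<le> n ^ 2" using finite_card_edges(2)[OF V Suc.prems(1)]
          unfolding N_def n_def of_nat_power[symmetric] of_nat_le_iff .
        \<comment> \<open>\<open>s\<close> is the intended value of \<open>\<tau> * N\<close>. Up to
          powers of \<open>C\<close>, its summands are the least values that the second and the
          first hypothesis of the step allow.\<close>
        define s where "s = a + b * N powr (- k)"
        define \<tau> where "\<tau> = s / N"
        have s0: "0 < s" unfolding s_def using a0 b0 N1 by (intro add_pos_pos) auto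
        have \<tau>_pos: "0 < \<tau>" using s0 N1 by (simp add: \<tau>_def)
        have \<tau>N: "\<tau> * N = s" using N1 by (simp add: \<tau>_def)
        have N_C2: "C2 * n powr (1 + 1 / L) \<le> N" using m' Nm by linarith
        have np: "0 < n powr (1 + 1 / L)" using n1 by simp
        have CC2: "C / C2 \<le> \<tau>0 / 2"
        proof -
          have "C \<le> \<tau>0 / 2 * C2" using \<tau>0 by (simp add: C2_def algebra_simps)
          then show ?thesis using C2 by (simp add: pos_divide_le_eq)
        qed
        have t1: "a / N \<le> \<tau>0 / 2"
        proof -
          have "n powr (1 + 1 / (2 * L - 1)) \<le> n powr (1 + 1 / L)"
            using n1 L by (intro powr_mono add_left_mono divide_left_mono) auto
          then have "a \<le> C * n powr (1 + 1 / L)" unfolding a_def using C by (intro mult_left_mono) auto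
          then have "a / N \<le> C * n powr (1 + 1 / L) / (C2 * n powr (1 + 1 / L))"
            using N_C2 np C2 a0 C by (intro frac_le) auto
          also have "\<dots> = C / C2" using np by simp
          finally show ?thesis using CC2 by linarith
        qed
        \<comment> \<open>At \<open>N\<close> of order \<open>n powr (1 + 1 / L)\<close> the powers
          of \<open>n\<close> cancel exactly; this is why the containers cannot be taken smaller
          here.\<close>
        have t2: "b * N powr (- k) / N \<le> \<tau>0 / 2"
        proof -
          have k1: "k + 1 = L / (L - 1)" using L by (simp add: k_def field_simps)
          have "N powr (- k) / N = N powr (- (k + 1))"
          proof -
            have e: "- (k + 1) = - k - 1" by simp
            show ?thesis unfolding e powr_diff using N1 by simp
          qed
          also have "\<dots> \<le> (C2 * n powr (1 + 1 / L)) powr (- (k + 1))"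
            using N_C2 np C2 k by (intro powr_mono2') auto
          also have "\<dots> = C2 powr (- (k + 1)) * n powr (- ((L + 1) / (L - 1)))"
          proof -
            have "(1 + 1 / L) * (k + 1) = (L + 1) / (L - 1)" unfolding k1 using L by (simp add: field_simps)
            then have "(1 + 1 / L) * (- (k + 1)) = - ((L + 1) / (L - 1))" by (simp only: mult_minus_right)
            then show ?thesis using C2 n1 by (simp only: powr_mult powr_powr)
          qed
          also have "\<dots> \<le> 1 / C2 * n powr (- ((L + 1) / (L - 1)))"
          proof (rule mult_right_mono)
            have "C2 powr (- (k + 1)) \<le> C2 powr (- 1)" using C2 k by (intro powr_mono) auto
            then show "C2 powr (- (k + 1)) \<le> 1 / C2" using C2 by (simp add: powr_minus_divide)
          qed simp
          finally have "N powr (- k) / N \<le> 1 / C2 * n powr (- ((L + 1) / (L - 1)))" .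
          then have "b * (N powr (- k) / N) \<le> b * (1 / C2 * n powr (- ((L + 1) / (L - 1))))"
            using b0 by (intro mult_left_mono) auto
          also have "\<dots> = C / C2 * (n powr ((L + 1) / (L - 1)) * n powr (- ((L + 1) / (L - 1))))"
            by (simp add: b_def)
          also have "n powr ((L + 1) / (L - 1)) * n powr (- ((L + 1) / (L - 1))) = 1"
            using n1 by (simp add: powr_add[symmetric])
          finally have "b * N powr (- k) / N \<le> C / C2" by simp
          then show ?thesis using CC2 by (rule order_trans)
        qed
        have \<tau>_le: "\<tau> \<le> \<tau>0" unfolding \<tau>_def s_def add_divide_distrib using t1 t2 by linarith
        have c1: "C * card V ^ (l + 1) \<le> card E ^ l * \<tau> ^ (l - 1)"
        proof -
          have "N * (b * N powr (- k)) ^ (l - 1) = C ^ (l - 1) * n ^ (l + 1)"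
          proof -
            have "- k * (L - 1) = - 1" using k(2) by simp
            then have "(N powr (- k)) ^ (l - 1) = N powr (- 1)"
              using pw[of N "- k" "l - 1"] N1 unfolding L1 by simp
            then have N: "N * (N powr (- k)) ^ (l - 1) = 1" using N1 by (simp add: powr_minus_divide)
            have "(L + 1) / (L - 1) * (L - 1) = L + 1" using L by simp
            then have "(n powr ((L + 1) / (L - 1))) ^ (l - 1) = n powr (L + 1)"
              using pw[OF n0, of "(L + 1) / (L - 1)" "l - 1"] unfolding L1 by simp
            also have "\<dots> = n ^ (l + 1)"
              using n1 powr_realpow[of n "l + 1"] by (simp add: L_def add.commute)
            finally show ?thesis using N unfolding b_def by (simp add: power_mult_distrib mult_ac)
          qed
          moreover have "N * (b * N powr (- k)) ^ (l - 1) \<le> N * s ^ (l - 1)"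
            using N1 a0 b0 unfolding s_def by (intro mult_left_mono power_mono) auto
          moreover have "N * s ^ (l - 1) = N ^ l * \<tau> ^ (l - 1)"
          proof -
            have "N * N ^ (l - 1) = N ^ l" using l power_minus_mult[of l N] by (simp add: mult.commute)
            then show ?thesis unfolding \<tau>N[symmetric] by (simp add: power_mult_distrib mult_ac)
          qed
          moreover have "C * n ^ (l + 1) \<le> C ^ (l - 1) * n ^ (l + 1)"
            using C l n1 by (intro mult_right_mono self_le_power) auto
          ultimately show ?thesis by (simp add: N_def n_def)
        qed
        have c2: "C * card V ^ (2 * l) \<le> (card E * \<tau>) ^ (2 * l - 1)"
        proof -
          have "a ^ (2 * l - 1) = C ^ (2 * l - 1) * n ^ (2 * l)"
          proof -
            have e: "(1 + 1 / (2 * L - 1)) * (2 * L - 1) = real (2 * l)" using L by (simp add: field_simps L_def)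
            have "(n powr (1 + 1 / (2 * L - 1))) ^ (2 * l - 1) = n powr ((1 + 1 / (2 * L - 1)) * (2 * L - 1))"
              using pw[OF n0, of "1 + 1 / (2 * L - 1)" "2 * l - 1"] unfolding L1 .
            also have "\<dots> = n ^ (2 * l)" unfolding e by (rule powr_realpow[OF n0])
            finally show ?thesis unfolding a_def by (simp add: power_mult_distrib)
          qed
          moreover have "a ^ (2 * l - 1) \<le> (N * \<tau>) ^ (2 * l - 1)"
            using a0 b0 unfolding mult.commute[of N \<tau>] \<tau>N s_def by (intro power_mono) auto
          moreover have "C * n ^ (2 * l) \<le> C ^ (2 * l - 1) * n ^ (2 * l)"
            using C l n1 by (intro mult_right_mono self_le_power) auto
          ultimately show ?thesis by (simp add: N_def n_def)
        qed
        from step[OF V V0 Suc.prems(1) \<tau>_pos \<tau>_le c1 c2]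
        obtain \<D> where \<D>: "finite \<D>" "card \<D> \<le> card E ^ ((2 * l - 1) * nat \<lceil>\<tau> * card E\<rceil>)"
          "\<forall>D\<in>\<D>. D \<subseteq> E \<and> card D \<le> (1 - \<delta>) * card E"
          "\<forall>F\<subseteq>E. F \<noteq> {} \<longrightarrow> cycles (2 * l) F = {} \<longrightarrow> (\<exists>D\<in>\<D>. F \<subseteq> D)" by (elim exE conjE)
        let ?Q = "\<lambda>D \<C>. finite \<C> \<and> card \<C> \<le> exp (8 * L * ln n * g i) \<and>
          (\<forall>D\<in>\<C>. D \<subseteq> all_edges V \<and> card D \<le> m) \<and>
          (\<forall>F\<subseteq>D. F \<noteq> {} \<longrightarrow> cycles (2 * l) F = {} \<longrightarrow> (\<exists>D\<in>\<C>. F \<subseteq> D))"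
        have "\<forall>D\<in>\<D>. \<exists>\<C>. ?Q D \<C>"
        proof
          fix D assume D: "D \<in> \<D>"
          have DE: "D \<subseteq> E" "card D \<le> (1 - \<delta>) * card E" using \<D>(3) D by auto
          note DE(2)
          also have "\<dots> \<le> (1 - \<delta>) * (m * \<rho> ^ Suc i)"
            using Suc.prems(2) \<delta> by (intro mult_left_mono) auto
          also have "\<dots> = m * \<rho> ^ i" using \<delta> by (simp add: \<rho>_def)
          finally have "card D \<le> m * \<rho> ^ i" .
          moreover have "D \<subseteq> all_edges V" using DE(1) Suc.prems(1) by (rule subset_trans)
          ultimately show "\<exists>\<C>. ?Q D \<C>" by (intro Suc.IH)
        qed
        from bchoice[OF this] obtain \<C> where \<C>: "\<forall>D\<in>\<D>. ?Q D (\<C> D)" ..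
        have s_d: "s \<le> d"
        proof -
          have "N powr (- k) \<le> (m * \<rho> ^ i) powr (- k)"
            using N_gt m1 \<rho> k by (intro powr_mono2') auto
          also have "\<dots> = m powr (- k) * \<theta> ^ i"
          proof -
            have "(\<rho> ^ i) powr (- k) = \<theta> ^ i"
              using \<rho> by (simp add: \<theta>_def powr_realpow[symmetric] powr_powr mult.commute)
            then show ?thesis using m1 \<rho> by (simp add: powr_mult)
          qed
          finally show ?thesis unfolding s_def d_def using b0 by (simp add: mult.assoc)
        qed
        have "1 \<le> s"
        proof -
          have "1 \<le> n powr (1 + 1 / (2 * L - 1))" using n1 L by (intro ge_one_powr_ge_zero) auto
          then have "1 * 1 \<le> a" unfolding a_def using C by (intro mult_mono) auto
          then show ?thesis using b0 unfolding s_def by (simp add: add_increasing2)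
        qed
        have "real (card \<D>) \<le> N ^ ((2 * l - 1) * nat \<lceil>s\<rceil>)"
        proof -
          have "real (card \<D>) \<le> real (card E ^ ((2 * l - 1) * nat \<lceil>\<tau> * card E\<rceil>))"
            using \<D>(2) by (rule of_nat_mono)
          then show ?thesis using \<tau>N by (simp add: N_def)
        qed
        also have "\<dots> = exp (real ((2 * l - 1) * nat \<lceil>s\<rceil>) * ln N)"
          using N1 by (subst exp_of_nat_mult) simp
        also have "\<dots> \<le> exp (8 * L * ln n * d)"
        proof -
          have "real (nat \<lceil>s\<rceil>) \<le> 2 * d" using \<open>1 \<le> s\<close> s_d by linarith
          moreover have "real (2 * l - 1) \<le> 2 * L" unfolding L1 by simp
          ultimately have "real (2 * l - 1) * real (nat \<lceil>s\<rceil>) \<le> 2 * L * (2 * d)"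
            using L by (intro mult_mono) auto
          moreover have "ln N \<le> 2 * ln n"
          proof -
            have "ln N \<le> ln (n ^ 2)" using Nn N1 by (intro ln_mono) auto
            then show ?thesis using n1 by (simp add: ln_realpow)
          qed
          ultimately have "(real (2 * l - 1) * real (nat \<lceil>s\<rceil>)) * ln N \<le> (2 * L * (2 * d)) * (2 * ln n)"
            by (rule mult_mono) (use N1 L d0 in auto)
          also have "\<dots> = 8 * L * ln n * d" by simp
          finally show ?thesis unfolding exp_le_cancel_iff of_nat_mult .
        qed
        finally have card_\<D>: "real (card \<D>) \<le> exp (8 * L * ln n * d)" .
        show ?thesis
        proof (intro exI[of _ "\<Union>D\<in>\<D>. \<C> D"] conjI)
          show "finite (\<Union>D\<in>\<D>. \<C> D)" using \<D>(1) \<C> by simp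
          have "card (\<Union>D\<in>\<D>. \<C> D) \<le> (\<Sum>D\<in>\<D>. card (\<C> D))" by (rule card_UN_le[OF \<D>(1)])
          then have "real (card (\<Union>D\<in>\<D>. \<C> D)) \<le> (\<Sum>D\<in>\<D>. real (card (\<C> D)))"
            unfolding of_nat_sum[symmetric] by (rule of_nat_mono)
          also have "\<dots> \<le> (\<Sum>D\<in>\<D>. exp (8 * L * ln n * g i))" using \<C> by (intro sum_mono) simp
          also have "\<dots> = real (card \<D>) * exp (8 * L * ln n * g i)" by simp
          also have "\<dots> \<le> exp (8 * L * ln n * d) * exp (8 * L * ln n * g i)"
            using card_\<D> by (intro mult_right_mono) auto
          also have "\<dots> = exp (8 * L * ln n * g (Suc i))" unfolding g_Suc by (rule exp_add[symmetric])
          finally show "card (\<Union>D\<in>\<D>. \<C> D) \<le> exp (8 * L * ln n * g (Suc i))" .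
          show "\<forall>D\<in>(\<Union>D\<in>\<D>. \<C> D). D \<subseteq> all_edges V \<and> card D \<le> m" using \<C> by simp
          show "\<forall>F\<subseteq>E. F \<noteq> {} \<longrightarrow> cycles (2 * l) F = {} \<longrightarrow> (\<exists>D\<in>(\<Union>D\<in>\<D>. \<C> D). F \<subseteq> D)"
          proof (intro allI impI)
            fix F assume F: "F \<subseteq> E" "F \<noteq> {}" "cycles (2 * l) F = {}"
            have "\<exists>D\<in>\<D>. F \<subseteq> D" using \<D>(4) F by simp
            then obtain D where D: "D \<in> \<D>" "F \<subseteq> D" ..
            have "\<exists>D'\<in>\<C> D. F \<subseteq> D'" using bspec[OF \<C> D(1)] D(2) F(2,3) by simp
            then show "\<exists>D\<in>(\<Union>D\<in>\<D>. \<C> D). F \<subseteq> D" using D(1) by blast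
          qed
        qed
      qed
    qed
    \<comment> \<open>Enough rounds for \<open>\<rho> ^ i\<close> to exceed
      \<open>n\<^sup>2\<close>, hence to start from the complete graph.\<close>
    define i where "i = nat \<lceil>2 * ln n / ln \<rho>\<rceil>"
    have i_ge: "2 * ln n / ln \<rho> \<le> i" unfolding i_def by linarith
    have "0 \<le> 2 * ln n / ln \<rho>" using lnn ln\<rho> by simp
    then have i_le: "i \<le> 2 * ln n / ln \<rho> + 1" unfolding i_def by linarith
    have "real (card (all_edges V)) \<le> n ^ 2"
      using finite_card_edges(2)[OF V order_refl] unfolding n_def of_nat_power[symmetric] of_nat_le_iff .
    also have "\<dots> = exp (2 * ln n)" using n0 by (simp add: exp_double)
    also have "\<dots> \<le> exp (real i * ln \<rho>)" using i_ge ln\<rho> by (simp add: pos_divide_le_eq)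
    also have "\<dots> = \<rho> ^ i" using \<rho> by (simp add: exp_of_nat_mult)
    also have "\<dots> \<le> m * \<rho> ^ i" using m1 \<rho> by simp
    finally have card_all: "real (card (all_edges V)) \<le> m * \<rho> ^ i" .
    from claim[OF order_refl card_all] obtain \<C> where \<C>: "finite \<C>" "card \<C> \<le> exp (8 * L * ln n * g i)"
      "\<forall>D\<in>\<C>. D \<subseteq> all_edges V \<and> card D \<le> m"
      "\<forall>F\<subseteq>all_edges V. F \<noteq> {} \<longrightarrow> cycles (2 * l) F = {} \<longrightarrow> (\<exists>D\<in>\<C>. F \<subseteq> D)" by (elim exE conjE)
    define A where "A = n powr (1 + 1 / (2 * L - 1)) * ln n"
    define B where "B = n powr ((L + 1) / (L - 1)) * m powr (- k)"
    have A0: "0 \<le> A" and B0: "0 \<le> B" using lnn by (auto simp: A_def B_def)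
    define q where "q = 2 / ln \<rho> + 1"
    have q: "0 < q" unfolding q_def using ln\<rho> by (simp add: add_pos_pos)
    have "g i \<le> C * (q + 1 / (1 - \<theta>)) * (A + B)"
    proof -
      have "g i = i * a + b * m powr (- k) * (\<Sum>j<i. \<theta> ^ j)"
        by (simp add: g_def sum.distrib sum_distrib_left)
      also have "\<dots> \<le> (q * ln n) * a + b * m powr (- k) * (1 / (1 - \<theta>))"
      proof (intro add_mono mult_right_mono mult_left_mono)
        have "2 * ln n / ln \<rho> + 1 \<le> q * ln n" using lnn by (simp add: q_def algebra_simps)
        then show "real i \<le> q * ln n" using i_le by linarith
        have "(\<Sum>j<i. \<theta> ^ j) = (1 - \<theta> ^ i) / (1 - \<theta>)" using \<theta> by (simp add: sum_gp_strict)
        also have "\<dots> \<le> 1 / (1 - \<theta>)" using \<theta> by (intro divide_right_mono) auto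
        finally show "(\<Sum>j<i. \<theta> ^ j) \<le> 1 / (1 - \<theta>)" .
      qed (use a0 b0 in auto)
      also have "\<dots> = C * (q * A + 1 / (1 - \<theta>) * B)" by (simp add: a_def b_def A_def B_def algebra_simps)
      also have "\<dots> \<le> C * ((q + 1 / (1 - \<theta>)) * (A + B))"
      proof (rule mult_left_mono)
        have "0 \<le> q * B + 1 / (1 - \<theta>) * A" using q \<theta> A0 B0 by simp
        then show "q * A + 1 / (1 - \<theta>) * B \<le> (q + 1 / (1 - \<theta>)) * (A + B)"
          by (simp add: algebra_simps add_divide_distrib)
      qed (use C in simp)
      finally show ?thesis by (simp add: mult.assoc)
    qed
    then have "8 * L * ln n * g i \<le> 8 * L * ln n * (C * (q + 1 / (1 - \<theta>)) * (A + B))"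
      using L lnn by (intro mult_left_mono) auto
    also have "\<dots> = C3 * ln n * (A + B)" by (simp add: C3_def q_def mult_ac)
    finally have "card \<C> \<le> exp (C3 * ln n * (A + B))" using \<C>(2) by (meson exp_le_cancel_iff order_trans)
    then have "card \<C> \<le> exp (C3 * ln (card V) * (card V powr (1 + 1 / (2 * real l - 1)) * ln (card V)
                        + card V powr ((real l + 1) / (real l - 1)) * m powr (- (1 / (real l - 1)))))"
      unfolding A_def B_def k_def n_def by (simp add: L_def)
    then show "\<exists>\<C>. finite \<C> \<and>
        card \<C> \<le> exp (C3 * ln (card V) * (card V powr (1 + 1 / (2 * real l - 1)) * ln (card V)
                        + card V powr ((real l + 1) / (real l - 1)) * m powr (- (1 / (real l - 1))))) \<and>
        (\<forall>D\<in>\<C>. D \<subseteq> all_edges V \<and> card D \<le> m) \<and>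
        (\<forall>F\<subseteq>all_edges V. F \<noteq> {} \<longrightarrow> cycles (2 * l) F = {} \<longrightarrow> (\<exists>D\<in>\<C>. F \<subseteq> D))"
      using \<C>(1,3,4) by (intro exI[of _ \<C>] conjI)
  qed
qed

subsection \<open>Random graphs\<close>

lemma power_div_fact_le_exp:
  fixes x :: real
  assumes "0 \<le> x"
  shows "x ^ k / fact k \<le> exp x"
proof -
  have "sum (\<lambda>n. x ^ n /\<^sub>R fact n) {k} \<le> (\<Sum>n. x ^ n /\<^sub>R fact n)"
    using assms by (intro sum_le_suminf sums_summable[OF exp_converges]) auto
  then show ?thesis by (simp add: exp_def divide_inverse mult.commute)
qed

lemma binomial_le_exp_power:
  assumes "0 < k"
  shows "real (N choose k) \<le> (exp 1 * real N / real k) ^ k"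
proof -
  have "real (N choose k) * fact k \<le> real N ^ k"
    using of_nat_mono[OF binomial_fact_pow[of N k], where 'a = real] by simp
  then have "real (N choose k) \<le> real N ^ k / fact k" by (simp add: pos_le_divide_eq)
  also have "\<dots> = (real N / real k) ^ k * (real k ^ k / fact k)"
    using assms by (simp add: power_divide)
  also have "\<dots> \<le> (real N / real k) ^ k * exp (real k)"
    by (intro mult_left_mono power_div_fact_le_exp) auto
  also have "exp (real k) = exp 1 ^ k" using exp_of_nat_mult[of k "1::real"] by simp
  finally show ?thesis by (simp add: power_mult_distrib power_divide mult_ac)
qed

lemma finite_all_edges: "finite V \<Longrightarrow> finite (all_edges V)"
  by (rule finite_card_edges(1)) auto

lemma prob_Pi_pmf_contains:
  assumes "finite A" "X \<subseteq> A" "0 \<le> p" "p \<le> 1"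
  shows "measure_pmf.prob (Pi_pmf A False (\<lambda>_. bernoulli_pmf p)) {Y. \<forall>e\<in>X. Y e} = p ^ card X"
proof -
  let ?B = "\<lambda>e. if e \<in> X then {True} else UNIV"
  have "{Y. \<forall>e\<in>X. Y e} = Pi A ?B" using assms(2) by (auto simp: Pi_def split: if_splits)
  then have "measure_pmf.prob (Pi_pmf A False (\<lambda>_. bernoulli_pmf p)) {Y. \<forall>e\<in>X. Y e}
      = (\<Prod>e\<in>A. measure_pmf.prob (bernoulli_pmf p) (?B e))"
    using assms(1) by (simp add: measure_Pi_pmf_Pi)
  also have "\<dots> = (\<Prod>e\<in>A. if e \<in> X then p else 1)"
    using assms by (intro prod.cong refl) (auto simp: measure_pmf_single)
  also have "\<dots> = p ^ card X"
    using assms(1,2) by (simp add: prod.If_cases Int_absorb1)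
  finally show ?thesis .
qed

section \<open>The extremal number and the first moment bound\<close>

lemma contains_cycle:
  assumes "2 \<le> l" "simple_graph F" "cycles (2 * l) (edges F) \<noteq> {}"
  shows "contains_copy F (cycle_graph (2 * l))"
proof -
  obtain xs where xs: "length xs = 2 * l" "distinct xs" "cycle_edges xs \<subseteq> edges F"
    using assms(3) unfolding cycles_def by blast
  have "set xs = \<Union> (cycle_edges xs)" by (rule Union_cycle_edges[symmetric])
  also have "\<dots> \<subseteq> verts F" using xs(3) assms(2) unfolding simple_graph_def all_edges_def by blast
  finally have verts: "set xs \<subseteq> verts F" .
  show ?thesis
    unfolding contains_copy_def cycle_graph_def
  proof (intro exI[of _ "(!) xs"] conjI)
    show "inj_on ((!) xs) (verts ({..<2 * l}, {{i, Suc i mod (2 * l)} |i. i < 2 * l}))"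
      using xs by (auto intro!: inj_onI simp: nth_eq_iff_index_eq)
    show "(!) xs ` verts ({..<2 * l}, {{i, Suc i mod (2 * l)} |i. i < 2 * l}) \<subseteq> verts F"
      using verts xs(1) by auto
    have "{xs ! i, xs ! (Suc i mod (2 * l))} \<in> edges F" if "i < 2 * l" for i
      using that xs(1) by (intro subsetD[OF xs(3)]) (auto simp: cycle_edges_def)
    then show "\<forall>e\<in>edges ({..<2 * l}, {{i, Suc i mod (2 * l)} |i. i < 2 * l}). (!) xs ` e \<in> edges F"
      by auto
  qed
qed

lemma ex_number_witness:
  assumes "2 \<le> l" "finite (edges G)"
  obtains F where "F \<subseteq> edges G" "F \<subseteq> all_edges (verts G)" "cycles (2 * l) F = {}"
    "card F = ex_number G (cycle_graph (2 * l))"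
proof -
  let ?H = "cycle_graph (2 * l)"
  let ?S = "{card (edges F) | F. subgraph_of F G \<and> \<not> contains_copy F ?H}"
  have "?S \<subseteq> {..card (edges G)}"
    using assms(2) by (auto simp: subgraph_of_def card_mono)
  then have fin: "finite ?S" by (rule finite_subset) simp
  \<comment> \<open>The graph without vertices admits no copy because the cycle has vertices; so the
    maximum is taken over a nonempty set.\<close>
  have "subgraph_of ({}, {}) G \<and> \<not> contains_copy (({}, {}) :: 'a graph) ?H"
    using assms(1) by (auto simp: subgraph_of_def simple_graph_def contains_copy_def cycle_graph_def lessThan_empty_iff)
  then have "?S \<noteq> {}" by blast
  with fin have "Max ?S \<in> ?S" by (rule Max_in)
  then obtain F where F: "subgraph_of F G" "\<not> contains_copy F ?H" "card (edges F) = ex_number G ?H"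
    unfolding ex_number_def by auto
  then have "simple_graph F" by (simp add: subgraph_of_def)
  show ?thesis
  proof (rule that[of "edges F"])
    show "cycles (2 * l) (edges F) = {}"
      using F(2) contains_cycle[OF assms(1)] \<open>simple_graph F\<close> by blast
    show "edges F \<subseteq> all_edges (verts G)"
      using F(1) by (auto simp: subgraph_of_def simple_graph_def all_edges_def)
  qed (use F in \<open>auto simp: subgraph_of_def\<close>)
qed

text \<open>A large cycle-free subgraph has \<open>k\<close> edges inside one container, with
  \<open>k\<close> the least integer above \<open>m\<close>. The expected number of such
  \<open>k\<close>-sets in one container is at most \<open>(exp 1 * card D * p / k) ^ k\<close>. Of
  the three exponents in \<open>exp 3\<close>, one cancels \<open>exp 1\<close>; the other two leave
  \<open>exp (- (2 * m))\<close>, enough to beat \<open>exp m\<close> containers.\<close>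

lemma prob_ex_number_gt_le:
  fixes p m M :: real
  assumes "2 \<le> l" "0 < p" "p \<le> 1" "0 < m"
    and \<C>: "finite \<C>" "card \<C> \<le> M"
      "\<And>D. D \<in> \<C> \<Longrightarrow> D \<subseteq> all_edges {..<n} \<and> card D \<le> m / (exp 3 * p)"
      "\<And>F. F \<subseteq> all_edges {..<n} \<Longrightarrow> F \<noteq> {} \<Longrightarrow> cycles (2 * l) F = {} \<Longrightarrow> \<exists>D\<in>\<C>. F \<subseteq> D"
  shows "measure_pmf.prob (erdos_renyi n p) {G. m < real (ex_number G (cycle_graph (2 * l)))} \<le> M * exp (- (2 * m))"
proof -
  define A where "A = all_edges {..<n}"
  define Q where "Q = Pi_pmf A False (\<lambda>_. bernoulli_pmf p)"
  define k where "k = nat \<lfloor>m\<rfloor> + 1"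
  have finA: "finite A" unfolding A_def by (rule finite_all_edges) simp
  have k: "m < real k" "0 < k" unfolding k_def by linarith+
  have le_k: "k \<le> N" if "m < real N" for N using that assms(4) unfolding k_def by linarith
  let ?G = "\<lambda>X. ({..<n}, {e \<in> A. X e})"
  let ?P = "\<lambda>D. {Y. Y \<subseteq> D \<and> card Y = k}"
  let ?ev = "\<lambda>Y. {X. \<forall>e\<in>Y. X e}"
  have finD: "finite D" if "D \<in> \<C>" for D
    using \<C>(3)[OF that] finA finite_subset unfolding A_def by blast
  have finP: "finite (?P D)" if "D \<in> \<C>" for D
    by (rule finite_subset[of _ "Pow D"]) (use finD[OF that] in auto)
  have sub: "?G -` {G. m < real (ex_number G (cycle_graph (2 * l)))} \<subseteq> (\<Union>D\<in>\<C>. \<Union>Y\<in>?P D. ?ev Y)"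
  proof
    fix X assume "X \<in> ?G -` {G. m < real (ex_number G (cycle_graph (2 * l)))}"
    then have big: "m < real (ex_number (?G X) (cycle_graph (2 * l)))" by simp
    obtain F where F: "F \<subseteq> edges (?G X)" "F \<subseteq> all_edges (verts (?G X))" "cycles (2 * l) F = {}"
      "card F = ex_number (?G X) (cycle_graph (2 * l))"
      by (rule ex_number_witness[OF assms(1), of "?G X"]) (use finA in auto)
    have cF: "m < real (card F)" using big F(4) by simp
    have "F \<noteq> {}" using cF assms(4) by auto
    moreover have "F \<subseteq> all_edges {..<n}" using F(2) by simp
    ultimately obtain D where D: "D \<in> \<C>" "F \<subseteq> D" using \<C>(4) F(3) by blast
    obtain Y where Y: "Y \<subseteq> F" "card Y = k" using obtain_subset_with_card_n[OF le_k[OF cF]] by blast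
    have "X \<in> ?ev Y" using Y(1) F(1) by auto
    moreover have "Y \<in> ?P D" using Y D(2) by auto
    ultimately show "X \<in> (\<Union>D\<in>\<C>. \<Union>Y\<in>?P D. ?ev Y)" using D(1) by blast
  qed
  have "measure_pmf.prob (erdos_renyi n p) {G. m < real (ex_number G (cycle_graph (2 * l)))}
      = measure_pmf.prob Q (?G -` {G. m < real (ex_number G (cycle_graph (2 * l)))})"
    by (simp add: erdos_renyi_def Q_def A_def)
  also have "\<dots> \<le> measure_pmf.prob Q (\<Union>D\<in>\<C>. \<Union>Y\<in>?P D. ?ev Y)"
    using sub by (intro measure_pmf.finite_measure_mono) auto
  also have "\<dots> \<le> (\<Sum>D\<in>\<C>. measure_pmf.prob Q (\<Union>Y\<in>?P D. ?ev Y))"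
    using \<C>(1) by (intro measure_pmf.finite_measure_subadditive_finite) auto
  also have "\<dots> \<le> (\<Sum>D\<in>\<C>. exp (- (2 * m)))"
  proof (intro sum_mono)
    fix D assume D: "D \<in> \<C>"
    have "measure_pmf.prob Q (\<Union>Y\<in>?P D. ?ev Y) \<le> (\<Sum>Y\<in>?P D. measure_pmf.prob Q (?ev Y))"
      using finP[OF D] by (intro measure_pmf.finite_measure_subadditive_finite) auto
    also have "\<dots> = (\<Sum>Y\<in>?P D. p ^ k)"
    proof (intro sum.cong refl)
      fix Y assume Y: "Y \<in> ?P D"
      then have "Y \<subseteq> A" using \<C>(3)[OF D] unfolding A_def by blast
      then show "measure_pmf.prob Q (?ev Y) = p ^ k"
        unfolding Q_def using prob_Pi_pmf_contains[OF finA] Y assms by simp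
    qed
    also have "\<dots> = real (card D choose k) * p ^ k" using n_subsets[OF finD[OF D]] by simp
    also have "\<dots> \<le> (exp 1 * real (card D) / real k) ^ k * p ^ k"
      using binomial_le_exp_power[OF k(2)] assms by (intro mult_right_mono) auto
    also have "\<dots> = (exp 1 * real (card D) / real k * p) ^ k" by (rule power_mult_distrib[symmetric])
    also have "\<dots> \<le> exp (- 2) ^ k"
    proof (rule power_mono)
      have "real (card D) * (exp 3 * p) \<le> m"
        using \<C>(3)[OF D] assms by (simp add: pos_le_divide_eq)
      then have "real (card D) * (exp 3 * p) \<le> real k" using k by linarith
      moreover have "exp 3 = exp 1 * exp (2::real)" by (simp add: exp_add[symmetric])
      ultimately have "exp 1 * real (card D) * p * exp 2 \<le> real k" by (simp add: mult_ac)
      then have "exp 1 * real (card D) / real k * p * exp 2 \<le> 1" using k by (simp add: divide_le_eq)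
      then show "exp 1 * real (card D) / real k * p \<le> exp (- 2)"
        by (simp add: exp_minus pos_le_divide_eq inverse_eq_divide)
    qed (use assms in auto)
    also have "\<dots> = exp (- (2 * real k))" using exp_of_nat_mult[of k "- 2::real"] by (simp add: mult.commute)
    also have "\<dots> \<le> exp (- (2 * m))" using k by simp
    finally show "measure_pmf.prob Q (\<Union>Y\<in>?P D. ?ev Y) \<le> exp (- (2 * m))" .
  qed
  also have "\<dots> \<le> M * exp (- (2 * m))" using \<C>(2) by (simp add: mult_right_mono)
  finally show ?thesis .
qed

theorem theorem5p3:
  fixes l :: nat and p :: "nat \<Rightarrow> real"
  assumes "l \<ge> 2"
    and "\<And>n. 0 \<le> p n \<and> p n \<le> 1"
    and "filterlim (\<lambda>n. p n / (real n powr (- ((real l - 1) / (2 * real l - 1))) * ln (real n) ^ (l + 1)))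
           at_top sequentially"
  shows "(\<lambda>n. measure_pmf.prob (erdos_renyi n (p n))
            {G. real (ex_number G (cycle_graph (2 * l)))
                  \<le> p n powr (1 / real l) * real n powr (1 + 1 / real l) * ln (real n)})
         \<longlonglongrightarrow> 1"
proof (rule cycle_free_containers[OF assms(1), where 'a = nat])
  fix C2 C3 :: real
  assume C2: "1 \<le> C2" and C3: "0 < C3" and
    cont: "\<And>(V::nat set) (m::real). finite V \<Longrightarrow> 1 \<le> ln (card V) \<Longrightarrow> C2 * card V powr (1 + 1 / l) \<le> m \<Longrightarrow>
      \<exists>\<C>. finite \<C> \<and>
        card \<C> \<le> exp (C3 * ln (card V) * (card V powr (1 + 1 / (2 * real l - 1)) * ln (card V)
                        + card V powr ((real l + 1) / (real l - 1)) * m powr (- (1 / (real l - 1))))) \<and>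
        (\<forall>D\<in>\<C>. D \<subseteq> all_edges V \<and> card D \<le> m) \<and>
        (\<forall>F\<subseteq>all_edges V. F \<noteq> {} \<longrightarrow> cycles (2 * l) F = {} \<longrightarrow> (\<exists>D\<in>\<C>. F \<subseteq> D))"
  define L where "L = real l"
  have L: "2 \<le> L" using assms(1) by (simp add: L_def)
  define k where "k = 1 / (L - 1)"
  have k: "0 < k" using L by (simp add: k_def)
  define m where "m n = p n powr (1 / L) * real n powr (1 + 1 / L) * ln (real n)" for n
  have ev_ln: "\<forall>\<^sub>F n in sequentially. c \<le> ln (real n) powr e" if "0 < e" for c e :: real
  proof -
    have "filterlim (\<lambda>n. ln (real n) powr e) at_top sequentially"
      using that by real_asymp
    then show ?thesis by (simp add: filterlim_at_top)
  qed
  have ev1: "\<forall>\<^sub>F n in sequentially. 1 \<le> p n / (real n powr (- ((L - 1) / (2 * L - 1))) * ln (real n) ^ (l + 1))"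
    using assms(3) unfolding filterlim_at_top L_def by blast
  have "filterlim (\<lambda>n. ln (real n)) at_top sequentially" by real_asymp
  then have ev2: "\<forall>\<^sub>F n in sequentially. max 1 (C2 * exp 3) \<le> ln (real n)" unfolding filterlim_at_top by blast
  \<comment> \<open>The spare powers of the logarithm, \<open>1 / L\<close> in the first container
    term and \<open>k\<close> in the second, absorb all constants.\<close>
  have ev3: "\<forall>\<^sub>F n in sequentially. 2 * C3 \<le> ln (real n) powr (1 / L)" by (rule ev_ln) (use L in simp)
  have ev4: "\<forall>\<^sub>F n in sequentially. 2 * C3 * exp (3 * k) \<le> ln (real n) powr k" by (rule ev_ln) (rule k)
  have "\<forall>\<^sub>F n in sequentially. 1 - exp (- real n) \<le> measure_pmf.prob (erdos_renyi n (p n))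
            {G. real (ex_number G (cycle_graph (2 * l))) \<le> m n}"
    using ev1 ev2 ev3 ev4
  proof eventually_elim
    case (elim n)
    define x where "x = real n"
    define s where "s = ln x"
    have s1: "1 \<le> s" and sC: "C2 * exp 3 \<le> s" using elim(2) unfolding s_def x_def by linarith+
    have x1: "1 < x"
    proof (rule ccontr)
      assume "\<not> 1 < x"
      \<comment> \<open>For \<open>n = 0\<close> this is the default value
        \<open>ln 0 = 0\<close>.\<close>
      then have "s \<le> 0" unfolding s_def x_def by (cases "n = 0") auto
      then show False using s1 by simp
    qed
    have x0: "0 < x" and s0: "0 < s" using x1 s1 by auto
    have p1: "p n \<le> 1" using assms(2) by blast
    have p_ge: "x powr (- ((L - 1) / (2 * L - 1))) * s ^ (l + 1) \<le> p n"
      using elim(1) x0 s0 by (simp add: pos_le_divide_eq x_def s_def)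
    have p0: "0 < p n"
    proof -
      have "0 < x powr (- ((L - 1) / (2 * L - 1))) * s ^ (l + 1)" using x0 s0 by simp
      then show ?thesis using p_ge by linarith
    qed
    define \<mu> where "\<mu> = m n"
    have \<mu>_eq: "\<mu> = p n powr (1 / L) * x powr (1 + 1 / L) * s" by (simp add: \<mu>_def m_def x_def s_def)
    have \<mu>0: "0 < \<mu>" unfolding \<mu>_eq using p0 x0 s0 by simp
    \<comment> \<open>The \<open>1 / L\<close>-th power of the lower bound on \<open>p\<close>
      contributes the logarithm to the power \<open>1 + 1 / L\<close>, and the target has one more.
      Two of these match the first container term; \<open>1 / L\<close> is to spare.\<close>
    have \<mu>_ge: "x powr (1 + 1 / (2 * L - 1)) * s\<^sup>2 * s powr (1 / L) \<le> \<mu>"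
    proof -
      have "(x powr (- ((L - 1) / (2 * L - 1))) * s powr (L + 1)) powr (1 / L) \<le> p n powr (1 / L)"
      proof (rule powr_mono2)
        have "s powr (L + 1) = s ^ (l + 1)" using powr_realpow[OF s0, of "l + 1"] by (simp add: L_def add.commute)
        then show "x powr (- ((L - 1) / (2 * L - 1))) * s powr (L + 1) \<le> p n" using p_ge by simp
      qed (use L in auto)
      then have "x powr (- ((L - 1) / (2 * L - 1)) * (1 / L)) * s powr ((L + 1) * (1 / L)) \<le> p n powr (1 / L)"
        using x0 s0 by (simp only: powr_mult powr_powr powr_ge_zero)
      then have "x powr (- ((L - 1) / (2 * L - 1)) * (1 / L)) * s powr ((L + 1) * (1 / L)) * (x powr (1 + 1 / L) * s)
          \<le> p n powr (1 / L) * (x powr (1 + 1 / L) * s)"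
        using s0 by (intro mult_right_mono) auto
      also have "\<dots> = \<mu>" by (simp add: \<mu>_eq)
      also have "x powr (- ((L - 1) / (2 * L - 1)) * (1 / L)) * s powr ((L + 1) * (1 / L)) * (x powr (1 + 1 / L) * s)
          = x powr (1 + 1 / (2 * L - 1)) * s\<^sup>2 * s powr (1 / L)"
      proof -
        have e1: "- ((L - 1) / (2 * L - 1)) * (1 / L) + (1 + 1 / L) = 1 + 1 / (2 * L - 1)"
        proof -
          have "2 * L - 1 \<noteq> 0" "L \<noteq> 0" using L by auto
          then show ?thesis by (simp add: divide_simps) (simp add: algebra_simps)
        qed
        have "(L + 1) * (1 / L) = 1 + 1 / L" using L by (simp add: field_simps)
        then have e2: "s powr ((L + 1) * (1 / L)) * s = s\<^sup>2 * s powr (1 / L)"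
          using s0 by (simp add: powr_add power2_eq_square)
        have "a * b * (c * d) = (a * c) * (b * d)" for a b c d :: real by simp
        from this[of "x powr (- ((L - 1) / (2 * L - 1)) * (1 / L))" "s powr ((L + 1) * (1 / L))" "x powr (1 + 1 / L)" s]
        show ?thesis unfolding e2 powr_add[symmetric] e1 by (simp only: mult.assoc)
      qed
      finally show ?thesis .
    qed
    define Nf where "Nf = \<mu> / (exp 3 * p n)"
    have Nf_eq: "Nf = p n powr (1 / L - 1) * x powr (1 + 1 / L) * s / exp 3"
      unfolding Nf_def \<mu>_eq using p0 by (simp add: powr_diff)
    \<comment> \<open>Since \<open>p n\<close> is at most 1, its negative exponent only helps, and
      the logarithm in the target exceeds the constant \<open>C2 * exp 3\<close>.\<close>
    have Nf_ge: "C2 * x powr (1 + 1 / L) \<le> Nf"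
    proof -
      have "1 = p n powr 0" using p0 by simp
      also have "\<dots> \<le> p n powr (1 / L - 1)" using p0 p1 L by (intro powr_mono') auto
      finally have "(C2 * exp 3) * 1 \<le> s * p n powr (1 / L - 1)"
        using sC C2 s0 by (intro mult_mono) auto
      then have "(C2 * exp 3) * x powr (1 + 1 / L) \<le> (s * p n powr (1 / L - 1)) * x powr (1 + 1 / L)"
        by (intro mult_right_mono) auto
      then show ?thesis unfolding Nf_eq by (simp add: pos_le_divide_eq mult_ac)
    qed
    have Nf0: "0 < Nf" unfolding Nf_def using \<mu>0 p0 by simp
    have term1: "C3 * s * (x powr (1 + 1 / (2 * L - 1)) * s) \<le> \<mu> / 2"
    proof -
      have "2 * C3 \<le> s powr (1 / L)" using elim(3) by (simp add: s_def x_def)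
      then have "(x powr (1 + 1 / (2 * L - 1)) * s\<^sup>2) * (2 * C3) \<le> (x powr (1 + 1 / (2 * L - 1)) * s\<^sup>2) * s powr (1 / L)"
        by (intro mult_left_mono) auto
      also have "\<dots> \<le> \<mu>" by (rule \<mu>_ge)
      finally show ?thesis by (simp add: power2_eq_square mult_ac)
    qed
    \<comment> \<open>Raising \<open>Nf\<close> to the power \<open>- k\<close> turns the exponent
      \<open>1 / L - 1\<close> of \<open>p n\<close> into \<open>1 / L\<close>, and the powers of
      \<open>x\<close> combine to \<open>1 + 1 / L\<close>. The term is therefore
      \<open>\<mu>\<close> itself times a constant and \<open>s powr (- k)\<close>.\<close>
    have term2: "C3 * s * (x powr ((L + 1) / (L - 1)) * Nf powr (- k)) \<le> \<mu> / 2"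
    proof -
      have "Nf powr (- k) = (p n powr (1 / L - 1)) powr (- k) * (x powr (1 + 1 / L)) powr (- k) * s powr (- k) * (1 / exp 3) powr (- k)"
        unfolding Nf_eq using s0 by (simp add: powr_mult powr_divide)
      also have "(p n powr (1 / L - 1)) powr (- k) = p n powr (1 / L)"
      proof -
        have "(1 / L - 1) * (- k) = 1 / L" using L by (simp add: k_def field_simps)
        then show ?thesis by (simp only: powr_powr)
      qed
      also have "(1 / exp 3) powr (- k) = exp (3 * k)"
        by (simp add: powr_def ln_div)
      finally have Nfk: "Nf powr (- k) = p n powr (1 / L) * (x powr (1 + 1 / L)) powr (- k) * s powr (- k) * exp (3 * k)" .
      have "x powr ((L + 1) / (L - 1)) * (x powr (1 + 1 / L)) powr (- k) = x powr (1 + 1 / L)"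
      proof -
        have "(L + 1) / (L - 1) + (1 + 1 / L) * (- k) = 1 + 1 / L"
        proof -
          have "L \<noteq> 0" "L - 1 \<noteq> 0" using L by auto
          then show ?thesis unfolding k_def by (simp add: divide_simps) (simp add: algebra_simps)
        qed
        then show ?thesis by (simp only: powr_powr powr_add[symmetric])
      qed
      then have eq: "C3 * s * (x powr ((L + 1) / (L - 1)) * Nf powr (- k)) = \<mu> * (C3 * exp (3 * k) * s powr (- k))"
        unfolding Nfk \<mu>_eq by (simp add: mult_ac)
      have "2 * C3 * exp (3 * k) \<le> s powr k" using elim(4) by (simp add: s_def x_def)
      then have "2 * C3 * exp (3 * k) * s powr (- k) \<le> s powr k * s powr (- k)"
        by (intro mult_right_mono) auto
      also have "\<dots> = 1" using s0 by (simp add: powr_add[symmetric])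
      finally have "C3 * exp (3 * k) * s powr (- k) \<le> 1 / 2" by simp
      then have "\<mu> * (C3 * exp (3 * k) * s powr (- k)) \<le> \<mu> * (1 / 2)"
        using \<mu>0 by (intro mult_left_mono) auto
      then show ?thesis unfolding eq by simp
    qed
    have "1 \<le> ln (real (card {..<n}))" "C2 * real (card {..<n}) powr (1 + 1 / real l) \<le> Nf"
      using s1 Nf_ge by (simp_all add: s_def x_def L_def)
    from cont[OF _ this] obtain \<C> where \<C>: "finite \<C>"
      "real (card \<C>) \<le> exp (C3 * s * (x powr (1 + 1 / (2 * L - 1)) * s + x powr ((L + 1) / (L - 1)) * Nf powr (- k)))"
      "\<forall>D\<in>\<C>. D \<subseteq> all_edges {..<n} \<and> card D \<le> Nf"
      "\<forall>F\<subseteq>all_edges {..<n}. F \<noteq> {} \<longrightarrow> cycles (2 * l) F = {} \<longrightarrow> (\<exists>D\<in>\<C>. F \<subseteq> D)"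
      by (auto simp: s_def x_def L_def k_def)
    have "C3 * s * (x powr (1 + 1 / (2 * L - 1)) * s + x powr ((L + 1) / (L - 1)) * Nf powr (- k)) \<le> \<mu>"
      unfolding distrib_left using term1 term2 by linarith
    then have card\<C>: "real (card \<C>) \<le> exp \<mu>" using \<C>(2) by (meson exp_le_cancel_iff order_trans)
    have "measure_pmf.prob (erdos_renyi n (p n)) {G. \<mu> < real (ex_number G (cycle_graph (2 * l)))}
        \<le> exp \<mu> * exp (- (2 * \<mu>))"
      by (rule prob_ex_number_gt_le[OF assms(1) p0 p1 \<mu>0 \<C>(1) card\<C>])
        (use \<C>(3,4) in \<open>auto simp: Nf_def\<close>)
    also have "\<dots> = exp (- \<mu>)" by (simp add: exp_add[symmetric])
    also have "\<dots> \<le> exp (- x)"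
    proof -
      have "x powr 1 \<le> x powr (1 + 1 / (2 * L - 1))" using x1 L by (intro powr_mono) auto
      moreover have "1 \<le> s\<^sup>2 * s powr (1 / L)"
      proof -
        have "1 \<le> s\<^sup>2" "1 \<le> s powr (1 / L)" using s1 L by (auto simp: one_le_power intro!: ge_one_powr_ge_zero)
        then have "1 * 1 \<le> s\<^sup>2 * s powr (1 / L)" by (intro mult_mono) auto
        then show ?thesis by simp
      qed
      ultimately have "x powr 1 * 1 \<le> x powr (1 + 1 / (2 * L - 1)) * (s\<^sup>2 * s powr (1 / L))"
        by (intro mult_mono) auto
      then have "x \<le> \<mu>" using \<mu>_ge x0 by (simp add: mult.assoc)
      then show ?thesis by simp
    qed
    finally have bad: "measure_pmf.prob (erdos_renyi n (p n)) {G. \<mu> < real (ex_number G (cycle_graph (2 * l)))} \<le> exp (- x)" .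
    have compl: "measure_pmf.prob (erdos_renyi n (p n)) (- {G. \<mu> < real (ex_number G (cycle_graph (2 * l)))})
        = 1 - measure_pmf.prob (erdos_renyi n (p n)) {G. \<mu> < real (ex_number G (cycle_graph (2 * l)))}"
      using measure_pmf.prob_compl[of "{G. \<mu> < real (ex_number G (cycle_graph (2 * l)))}" "erdos_renyi n (p n)"]
      by (simp add: Compl_eq_Diff_UNIV)
    have set_eq: "- {G. \<mu> < real (ex_number G (cycle_graph (2 * l)))} = {G. real (ex_number G (cycle_graph (2 * l))) \<le> m n}"
      by (auto simp: \<mu>_def)
    show ?case using bad compl unfolding set_eq x_def by linarith
  qed
  then have "(\<lambda>n. measure_pmf.prob (erdos_renyi n (p n))
            {G. real (ex_number G (cycle_graph (2 * l))) \<le> m n}) \<longlonglongrightarrow> 1"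
  proof (rule tendsto_sandwich)
    show "(\<lambda>n. 1 - exp (- real n)) \<longlonglongrightarrow> 1" by real_asymp
    show "(\<lambda>n. 1 :: real) \<longlonglongrightarrow> 1" by simp
  qed simp
  then show ?thesis by (simp only: m_def L_def)
qed

end
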